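(* The 3-coloring problem is polynomial-time solvable on $(2P_4,C_5)$-free graphs; that is, there is a polynomial-time algorithm which, given a finite simple graph $G$ that contains neither $2P_4$ nor $C_5$ as an induced subgraph, decides whether $G$ has a proper coloring $c:V(G)\to\{1,2,3\}$.
   Context: $P_4$ is the path on 4 vertices, $2P_4$ is the disjoint union of two copies of $P_4$ (with no edges between them), and $C_5$ is the cycle on 5 vertices. A graph is $(H_1,H_2,\ldots)$-free if it contains none of the $H_i$ as an induced subgraph. A coloring is proper if adjacent vertices receive distinct colors. *)

theory Defs
  imports "HOL-Computational_Algebra.Polynomial" "HOL-Library.FuncSet"
begin

section \<open>Graphs\<close>

text \<open>A graph is a pair of a vertex set and a set of edges, each edge being a two-element set of
  vertices.\<close>

type_synonym 'a graph = "'a set \<times> 'a set set"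

abbreviation verts :: "'a graph \<Rightarrow> 'a set" where
  "verts G \<equiv> fst G"

abbreviation edges :: "'a graph \<Rightarrow> 'a set set" where
  "edges G \<equiv> snd G"

definition simple_graph :: "'a graph \<Rightarrow> bool" where
  "simple_graph G \<longleftrightarrow> finite (verts G) \<and> (\<forall>e\<in>edges G. e \<subseteq> verts G \<and> card e = 2)"

definition induced_subgraph :: "'a graph \<Rightarrow> 'a set \<Rightarrow> 'a graph" where
  "induced_subgraph G S = (S, {e \<in> edges G. e \<subseteq> S})"

definition isomorphic :: "'a graph \<Rightarrow> 'b graph \<Rightarrow> bool" where
  "isomorphic G H \<longleftrightarrow> (\<exists>f. bij_betw f (verts G) (verts H) \<and>
     (\<forall>u\<in>verts G. \<forall>v\<in>verts G. {u, v} \<in> edges G \<longleftrightarrow> {f u, f v} \<in> edges H))"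

definition contains_induced :: "'a graph \<Rightarrow> 'b graph \<Rightarrow> bool" where
  "contains_induced G H \<longleftrightarrow> (\<exists>S\<subseteq>verts G. isomorphic (induced_subgraph G S) H)"

definition path_graph :: "nat \<Rightarrow> nat graph" where
  "path_graph n = ({..<n}, {{i, Suc i} | i. Suc i < n})"

definition cycle_graph :: "nat \<Rightarrow> nat graph" where
  "cycle_graph n = ({..<n}, {{i, Suc i mod n} | i. i < n})"

definition disjoint_union :: "'a graph \<Rightarrow> 'b graph \<Rightarrow> ('a + 'b) graph" where
  "disjoint_union G H = (verts G <+> verts H, image Inl ` edges G \<union> image Inr ` edges H)"

definition proper_coloring :: "'a graph \<Rightarrow> 'c set \<Rightarrow> ('a \<Rightarrow> 'c) \<Rightarrow> bool" where
  "proper_coloring G C c \<longleftrightarrow> c \<in> verts G \<rightarrow> C \<and> (\<forall>u v. {u, v} \<in> edges G \<longrightarrow> c u \<noteq> c v)"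

definition three_colorable :: "'a graph \<Rightarrow> bool" where
  "three_colorable G \<longleftrightarrow> (\<exists>c. proper_coloring G {1, 2, 3 :: nat} c)"


section \<open>Polynomial time\<close>

text \<open>The machine model is a random access machine with structured control flow. It has
  registers and a separate memory with indirect addressing, both holding natural numbers. Every
  operation costs one time unit. The only arithmetic is addition and truncated subtraction, so
  that the bit length of the numbers grows by at most a constant per time unit. With this
  restriction (in particular without multiplication), polynomial time on the machine coincides
  with polynomial time on Turing machines.\<close>

datatype expr =
    Num nat
  | Reg nat
  | Load expr
  | Plus expr expr
  | Minus expr expr

datatype prog =
    Skip
  | Assign nat expr
  | Store expr expr
  | Seq prog prog
  | Cond expr prog prog
  | While expr prog

type_synonym state = "(nat \<Rightarrow> nat) \<times> (nat \<Rightarrow> nat)"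

fun eval_expr :: "expr \<Rightarrow> state \<Rightarrow> nat" where
  "eval_expr (Num k) s = k"
| "eval_expr (Reg x) s = fst s x"
| "eval_expr (Load a) s = snd s (eval_expr a s)"
| "eval_expr (Plus a b) s = eval_expr a s + eval_expr b s"
| "eval_expr (Minus a b) s = eval_expr a s - eval_expr b s"

fun expr_cost :: "expr \<Rightarrow> nat" where
  "expr_cost (Num k) = 1"
| "expr_cost (Reg x) = 1"
| "expr_cost (Load a) = expr_cost a + 1"
| "expr_cost (Plus a b) = expr_cost a + expr_cost b + 1"
| "expr_cost (Minus a b) = expr_cost a + expr_cost b + 1"

text \<open>\<open>exec P s t s'\<close>: started in state \<open>s\<close>, the program \<open>P\<close> halts after exactly \<open>t\<close> time units in
  state \<open>s'\<close>. Conditions count as true when nonzero.\<close>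

inductive exec :: "prog \<Rightarrow> state \<Rightarrow> nat \<Rightarrow> state \<Rightarrow> bool" where
  Skip: "exec Skip s 1 s"
| Assign: "exec (Assign x a) s (expr_cost a + 1) ((fst s)(x := eval_expr a s), snd s)"
| Store: "exec (Store a b) s (expr_cost a + expr_cost b + 1)
            (fst s, (snd s)(eval_expr a s := eval_expr b s))"
| Seq: "exec P s t s' \<Longrightarrow> exec Q s' t' s'' \<Longrightarrow> exec (Seq P Q) s (t + t') s''"
| CondTrue: "eval_expr a s \<noteq> 0 \<Longrightarrow> exec P s t s' \<Longrightarrow> exec (Cond a P Q) s (expr_cost a + 1 + t) s'"
| CondFalse: "eval_expr a s = 0 \<Longrightarrow> exec Q s t s' \<Longrightarrow> exec (Cond a P Q) s (expr_cost a + 1 + t) s'"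
| WhileTrue: "eval_expr a s \<noteq> 0 \<Longrightarrow> exec P s t s' \<Longrightarrow> exec (While a P) s' t' s'' \<Longrightarrow>
    exec (While a P) s (expr_cost a + 1 + t + t') s''"
| WhileFalse: "eval_expr a s = 0 \<Longrightarrow> exec (While a P) s (expr_cost a + 1) s"

lemma exec_deterministic:
  "exec P s t s' \<Longrightarrow> exec P s u r \<Longrightarrow> t = u \<and> s' = r"
proof (induction arbitrary: u r rule: exec.induct)
  case (Skip s)
  from Skip.prems show ?case by cases simp
next
  case (Assign x a s)
  from Assign.prems show ?case by cases simp
next
  case (Store a b s)
  from Store.prems show ?case by cases simp
next
  case (Seq P s t s' Q t' s'')
  from Seq.prems show ?case
  proof cases
    case prems: (Seq t1 s1 t2)
    have eq: "t = t1 \<and> s' = s1" by (rule Seq.IH(1)) (rule prems(2))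
    have "exec Q s' t2 r" using prems(3) eq by simp
    then have "t' = t2 \<and> s'' = r" by (rule Seq.IH(2))
    then show ?thesis using eq prems(1) by simp
  qed
next
  case (CondTrue a s P t s' Q)
  from CondTrue.prems show ?case
  proof cases
    case prems: (CondTrue t1)
    have "t = t1 \<and> s' = r" by (rule CondTrue.IH) (rule prems(3))
    then show ?thesis using prems(1) by simp
  next
    case CondFalse
    then show ?thesis using CondTrue.hyps(1) by simp
  qed
next
  case (CondFalse a s Q t s' P)
  from CondFalse.prems show ?case
  proof cases
    case CondTrue
    then show ?thesis using CondFalse.hyps(1) by simp
  next
    case prems: (CondFalse t1)
    have "t = t1 \<and> s' = r" by (rule CondFalse.IH) (rule prems(3))
    then show ?thesis using prems(1) by simp
  qed
next
  case (WhileTrue a s P t s' t' s'')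
  from WhileTrue.prems show ?case
  proof cases
    case prems: (WhileTrue t1 s1 t2)
    have eq: "t = t1 \<and> s' = s1" by (rule WhileTrue.IH(1)) (rule prems(3))
    have "exec (While a P) s' t2 r" using prems(4) eq by simp
    then have "t' = t2 \<and> s'' = r" by (rule WhileTrue.IH(2))
    then show ?thesis using eq prems(1) by simp
  next
    case WhileFalse
    then show ?thesis using WhileTrue.hyps(1) by simp
  qed
next
  case (WhileFalse a s P)
  from WhileFalse.prems show ?case
  proof cases
    case WhileTrue
    then show ?thesis using WhileFalse.hyps(1) by simp
  next
    case WhileFalse
    then show ?thesis by simp
  qed
qed

text \<open>A graph is presented to the machine by its adjacency matrix with respect to some listing
  \<open>vs\<close> of its vertices: register 0 holds the number \<open>n\<close> of vertices, and memory cell \<open>i * n + j\<close>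
  holds 1 or 0 for \<open>i, j < n\<close>. All else is 0.\<close>

definition input_state :: "'a graph \<Rightarrow> 'a list \<Rightarrow> state" where
  "input_state G vs = (let n = length vs in
     ((\<lambda>_. 0)(0 := n),
      (\<lambda>k. if k < n * n \<and> {vs ! (k div n), vs ! (k mod n)} \<in> edges G then 1 else 0)))"

text \<open>The algorithm answers through register 0 (1 for yes, 0 for no). It has to be correct and
  fast only on the graphs in \<open>\<C>\<close>, but there for every listing of the vertices. The time bound is a
  polynomial in the number of vertices. As the adjacency matrix has size quadratic in it, this is
  the same as a polynomial in the input size.\<close>

definition poly_time_solvable_on :: "nat graph set \<Rightarrow> (nat graph \<Rightarrow> bool) \<Rightarrow> bool" where
  "poly_time_solvable_on \<C> D \<longleftrightarrow>
     (\<exists>(P :: prog) (p :: nat poly).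
        \<forall>G\<in>\<C>. \<forall>vs. distinct vs \<and> set vs = verts G \<longrightarrow>
          (\<exists>t s. exec P (input_state G vs) t s \<and>
                 t \<le> poly p (card (verts G)) \<and>
                 fst s 0 = (if D G then 1 else 0)))"

end

theory Submission imports Defs begin

text \<open>For a large constant \<open>k\<close> the algorithm enforces \<open>k\<close>-consistency: starting from all \<open>k\<close>-tuples of coloured
  vertices, it discards a tuple if it is not properly coloured, or if for some position and some vertex \<open>v\<close> all three
  ways of putting a coloured \<open>v\<close> at this position have been discarded. The answer is yes if some tuple survives.

  What has to be shown is that survival implies colourability. The surviving partial colourings form a
  family \<open>H\<close> in which every position with fewer than \<open>k\<close> coloured vertices extends to any further vertex. Colour an
  induced \<open>P\<^sub>4\<close> first. Then keep colouring small obstructions (gadgets) as long as there are any: of each of boundedly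
  many kinds at most two can be nested, since a third one would create an induced \<open>2P\<^sub>4\<close> or \<open>C\<^sub>5\<close>. So a gadget-free
  position \<open>\<sigma>\<close> with boundedly many coloured vertices is reached. Vertices with at most two colours left can be coloured pairwise
  consistently, as in 2-SAT. The remaining vertices belong to a \<open>P\<^sub>4\<close>-free graph \<open>W\<close>, and by the absence of gadgets
  a bounded number of local configurations in \<open>W\<close> are impossible; this is enough to extend the colouring along
  the decomposition of \<open>W\<close> into unions and joins.\<close>

section \<open>Cographs\<close>

text \<open>The obstacle is that \<open>H\<close> only offers partial colourings of bounded size,
  and that the 2-SAT colouring \<open>f\<close> agrees with a position of \<open>H\<close> on two
  vertices at a time. A contradiction may therefore fix at most two vertices according to
  \<open>f\<close>; everything else has to hold in all positions above \<open>\<sigma>\<close>. The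
  kinds of gadgets are chosen for this. Their absence lets one vertex exclude a colour at both ends
  of an edge (\<open>edge_cost\<close>), lets two vertices do the work of three at a full list
  (\<open>Ex_not_UNIV\<close>), and yields a rule on equal colours along paths that holds in every
  position (last clause of \<open>valid\<close>). Gadgets are removed in two rounds because the
  number of labels has to be bounded before a round begins. In the first round the labels are the
  four vertices of the \<open>P4\<close>, in the second they are built from the set \<open>S\<close>
  coloured in the first. \<open>S\<close> stays fixed while \<open>\<sigma>\<close> grows, so that
  \<open>X S\<close>, \<open>R S\<close> and the labels keep their meaning. The bound 200000 is what
  the two rounds consume, with 20 pebbles to spare, rounded up.\<close>

datatype col = Red | Green | Blue

lemma col_UNIV: "(UNIV :: col set) = {Red, Green, Blue}"
  by (auto intro: col.exhaust)

instance col :: finite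
  by standard (simp add: col_UNIV)

lemma card_col [simp]: "card (UNIV :: col set) = 3"
  by (simp add: col_UNIV)

lemma third_col: "\<exists>c::col. c \<noteq> p \<and> c \<noteq> q"
  by (cases p; cases q) (auto intro: col.distinct)

lemma col_cases3: "p \<noteq> q \<Longrightarrow> q \<noteq> m \<Longrightarrow> p \<noteq> m \<Longrightarrow> (c::col) = p \<or> c = q \<or> c = m"
  by (cases p; cases q; cases m; cases c) auto

locale fgraph =
  fixes V :: "'a set" and adj :: "'a \<Rightarrow> 'a \<Rightarrow> bool"
  assumes finV: "finite V"
    and adj_V: "adj u v \<Longrightarrow> u \<in> V"
    and adj_sym: "adj u v \<Longrightarrow> adj v u"
    and adj_irrefl: "\<not> adj v v"
begin

lemma adj_comm: "adj u v \<longleftrightarrow> adj v u"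
  using adj_sym by blast

lemma adj_V2: "adj u v \<Longrightarrow> v \<in> V"
  using adj_V adj_sym by blast

text \<open>The listed edges and non-edges force the four vertices to be distinct.\<close>

definition P4 :: "'a \<Rightarrow> 'a \<Rightarrow> 'a \<Rightarrow> 'a \<Rightarrow> bool" where
  "P4 a b c d \<longleftrightarrow> adj a b \<and> adj b c \<and> adj c d \<and> \<not> adj a c \<and> \<not> adj a d \<and> \<not> adj b d"

definition P4_free :: "'a set \<Rightarrow> bool" where
  "P4_free K \<longleftrightarrow> (\<forall>a\<in>K. \<forall>b\<in>K. \<forall>c\<in>K. \<forall>d\<in>K. \<not> P4 a b c d)"

definition complete_to :: "'a set \<Rightarrow> 'a set \<Rightarrow> bool" where
  "complete_to A B \<longleftrightarrow> (\<forall>a\<in>A. \<forall>b\<in>B. adj a b)"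

definition anticomplete :: "'a set \<Rightarrow> 'a set \<Rightarrow> bool" where
  "anticomplete A B \<longleftrightarrow> (\<forall>a\<in>A. \<forall>b\<in>B. \<not> adj a b)"

definition stable :: "'a set \<Rightarrow> bool" where
  "stable A \<longleftrightarrow> anticomplete A A"

lemma P4_free_subset: "P4_free K \<Longrightarrow> L \<subseteq> K \<Longrightarrow> P4_free L"
  unfolding P4_free_def by blast

lemma P4_freeD: "P4_free K \<Longrightarrow> P4 a b c d \<Longrightarrow> a \<in> K \<Longrightarrow> b \<in> K \<Longrightarrow> c \<in> K \<Longrightarrow> d \<in> K \<Longrightarrow> False"
  unfolding P4_free_def by blast

text \<open>A vertex \<open>v\<close> is added to a split \<open>A\<close>, \<open>B\<close>. Say
  these are anticomplete. If \<open>v\<close> is adjacent to everything, \<open>{v}\<close> splits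
  off. If it misses some vertex of \<open>A\<close> and has no neighbour in \<open>B\<close>, then
  \<open>B\<close> splits off; with a neighbour \<open>b\<close> in \<open>B\<close>, the
  non-neighbours of \<open>v\<close> in \<open>A\<close> do, because an edge from them to a
  neighbour of \<open>v\<close> in \<open>A\<close> would continue through \<open>v\<close> to
  \<open>b\<close> as an induced \<open>P4\<close>. Joins are the complement of this.\<close>

lemma cograph_split:
  assumes "finite K" "card K \<ge> 2" "P4_free K"
  shows "\<exists>A B. A \<noteq> {} \<and> B \<noteq> {} \<and> A \<inter> B = {} \<and> A \<union> B = K \<and> (complete_to A B \<or> anticomplete A B)"
  using assms
proof (induction K rule: finite_induct)
  case empty
  then show ?case by simp
next
  case (insert v K)
  note P4 = insert.prems(2)
  have vK: "v \<notin> K" by fact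
  show ?case
  proof (cases "card K \<ge> 2")
    case False
    with insert have "card K = 1" by simp
    then obtain w where w: "K = {w}" by (auto simp: card_1_singleton_iff)
    with vK have "{v} \<noteq> {} \<and> {w} \<noteq> {} \<and> {v} \<inter> {w} = {} \<and> {v} \<union> {w} = insert v K \<and>
        (complete_to {v} {w} \<or> anticomplete {v} {w})"
      by (auto simp: complete_to_def anticomplete_def)
    then show ?thesis by blast
  next
    case True
    have "P4_free K" using P4 P4_free_subset by blast
    then obtain A B where AB: "A \<noteq> {}" "B \<noteq> {}" "A \<inter> B = {}" "A \<union> B = K"
      and c: "complete_to A B \<or> anticomplete A B"
      using insert.IH[OF True] by blast
    have good: ?thesis if "C \<noteq> {}" "C \<subseteq> insert v K" "C \<noteq> insert v K"
      "complete_to C (insert v K - C) \<or> anticomplete C (insert v K - C)" for C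
      using that by (intro exI[of _ C] exI[of _ "insert v K - C"]) auto
    have anti: ?thesis if ac: "anticomplete A B" and AB: "A \<noteq> {}" "B \<noteq> {}" "A \<inter> B = {}" "A \<union> B = K"
      and vA: "m \<in> A" "\<not> adj v m" for A B m
    proof (cases "\<exists>b\<in>B. adj v b")
      case False
      then have "anticomplete B (insert v K - B)" using ac AB adj_sym unfolding anticomplete_def by blast
      then show ?thesis using AB vK by (intro good[of B]) auto
    next
      case True
      then obtain b where b: "b \<in> B" "adj v b" by blast
      let ?C = "{x\<in>A. \<not> adj v x}"
      have no: "\<not> adj n x" if "n \<in> A" "adj v n" "x \<in> ?C" for n x
      proof
        assume "adj n x"
        then have "P4 x n v b" using that b ac by (auto simp: P4_def anticomplete_def adj_comm)
        then show False using P4 that b AB by (auto dest!: P4_freeD[OF P4])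
      qed
      have "anticomplete ?C (insert v K - ?C)" using ac AB no adj_sym unfolding anticomplete_def by blast
      then show ?thesis using vA AB vK by (intro good[of ?C]) auto
    qed
    have comp: ?thesis if ac: "complete_to A B" and AB: "A \<noteq> {}" "B \<noteq> {}" "A \<inter> B = {}" "A \<union> B = K"
      and vA: "m \<in> A" "adj v m" for A B m
    proof (cases "\<exists>b\<in>B. \<not> adj v b")
      case False
      then have "complete_to B (insert v K - B)" using ac AB adj_sym unfolding complete_to_def by blast
      then show ?thesis using AB vK by (intro good[of B]) auto
    next
      case True
      then obtain b where b: "b \<in> B" "\<not> adj v b" by blast
      let ?C = "{x\<in>A. adj v x}"
      have no: "adj x n" if "n \<in> A" "\<not> adj v n" "x \<in> ?C" for n x
      proof (rule ccontr)
        assume "\<not> adj x n"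
        then have "P4 v x b n" using that b ac by (auto simp: P4_def complete_to_def adj_comm)
        then show False using that b AB by (auto dest!: P4_freeD[OF P4])
      qed
      have "complete_to ?C (insert v K - ?C)" using ac AB no adj_sym unfolding complete_to_def by blast
      then show ?thesis using vA AB vK by (intro good[of ?C]) auto
    qed
    from c show ?thesis
    proof
      assume ac: "complete_to A B"
      show ?thesis
      proof (cases "\<exists>m\<in>K. adj v m")
        case True
        then obtain m where "m \<in> K" "adj v m" by blast
        moreover have "complete_to B A" using ac using adj_sym unfolding complete_to_def by blast
        ultimately show ?thesis using comp[of A B m] comp[of B A m] ac AB by (auto simp: Un_commute Int_commute)
      next
        case False
        then show ?thesis using vK AB by (intro good[of "{v}"]) (auto simp: anticomplete_def)
      qed
    next
      assume ac: "anticomplete A B"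
      show ?thesis
      proof (cases "\<exists>m\<in>K. \<not> adj v m")
        case True
        then obtain m where "m \<in> K" "\<not> adj v m" by blast
        moreover have "anticomplete B A" using ac using adj_sym unfolding anticomplete_def by blast
        ultimately show ?thesis using anti[of A B m] anti[of B A m] ac AB by (auto simp: Un_commute Int_commute)
      next
        case False
        then show ?thesis using vK AB by (intro good[of "{v}"]) (auto simp: complete_to_def)
      qed
    qed
  qed
qed

lemma stableD: "stable A \<Longrightarrow> u \<in> A \<Longrightarrow> v \<in> A \<Longrightarrow> \<not> adj u v"
  unfolding stable_def anticomplete_def by blast

lemma not_stable: "\<not> stable A \<Longrightarrow> \<exists>u\<in>A. \<exists>v\<in>A. adj u v"
  unfolding stable_def anticomplete_def by blast

text \<open>The join case comes without induction hypotheses: colourings of the two sides compete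
  for the same three colours and do not combine, so joins are treated directly. Sets with at most
  one vertex fall under the stable case.\<close>

lemma cograph_induct [consumes 2, case_names stable anticomplete complete]:
  assumes fin: "finite K" and P4: "P4_free K"
    and st: "\<And>A. A \<subseteq> K \<Longrightarrow> stable A \<Longrightarrow> P A"
    and an: "\<And>A B. A \<subseteq> K \<Longrightarrow> B \<subseteq> K \<Longrightarrow> anticomplete A B \<Longrightarrow> P A \<Longrightarrow> P B \<Longrightarrow> P (A \<union> B)"
    and co: "\<And>A B. A \<subseteq> K \<Longrightarrow> B \<subseteq> K \<Longrightarrow> A \<noteq> {} \<Longrightarrow> B \<noteq> {} \<Longrightarrow> complete_to A B \<Longrightarrow> P (A \<union> B)"
  shows "P K"
proof -
  have "P J" if "J \<subseteq> K" for J
    using that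
  proof (induction "card J" arbitrary: J rule: less_induct)
    case less
    have finJ: "finite J" by (rule finite_subset[OF less.prems fin])
    show ?case
    proof (cases "card J \<ge> 2")
      case False
      have "stable J"
      proof (rule ccontr)
        assume "\<not> stable J"
        then obtain u v where uv: "u \<in> J" "v \<in> J" "adj u v" using not_stable by blast
        then have "u \<noteq> v" using adj_irrefl by blast
        then show False using card_mono[OF finJ, of "{u, v}"] uv False by simp
      qed
      then show ?thesis by (rule st[OF less.prems])
    next
      case True
      obtain A B where AB: "A \<noteq> {}" "B \<noteq> {}" "A \<inter> B = {}" "A \<union> B = J" "complete_to A B \<or> anticomplete A B"
        using cograph_split[OF finJ True P4_free_subset[OF P4 less.prems]] by blast
      have sub: "A \<subset> J" "B \<subset> J" "A \<subseteq> K" "B \<subseteq> K" using AB less.prems by blast+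
      have "P A" "P B" using less.hyps sub psubset_card_mono[OF finJ] by blast+
      then show ?thesis using AB an[OF sub(3,4)] co[OF sub(3,4)] by blast
    qed
  qed
  then show ?thesis by blast
qed

end

section \<open>Strategies in the pebble game\<close>

context
  fixes gad :: "'l \<Rightarrow> 's \<Rightarrow> 's \<Rightarrow> bool" and sub :: "'s \<Rightarrow> 's \<Rightarrow> bool" and size :: "'s \<Rightarrow> nat"
    and c :: nat and \<Lambda> :: "'l set"
  assumes fin: "finite \<Lambda>"
    and sub_refl: "\<And>s. sub s s"
    and sub_trans: "\<And>s t u. sub s t \<Longrightarrow> sub t u \<Longrightarrow> sub s u"
    and gad_sub: "\<And>l s t. gad l s t \<Longrightarrow> sub s t"
    and gad_size: "\<And>l s t. gad l s t \<Longrightarrow> size t \<le> size s + c"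
    and no_chain: "\<And>l s s' t t' u u'. l \<in> \<Lambda> \<Longrightarrow> gad l s s' \<Longrightarrow> sub s' t \<Longrightarrow> gad l t t' \<Longrightarrow> sub t' u \<Longrightarrow>
      gad l u u' \<Longrightarrow> False"
begin

text \<open>A chain of \<open>i\<close> nested gadgets with label \<open>l\<close>, the last of them
  below \<open>s\<close>. By \<open>no_chain\<close> the length 3 is never attained.\<close>

private fun ch :: "nat \<Rightarrow> 'l \<Rightarrow> 's \<Rightarrow> bool" where
  "ch 0 l s = True"
| "ch (Suc i) l s = (\<exists>t t'. ch i l t \<and> gad l t t' \<and> sub t' s)"

private lemma ch_mono: "ch i l s \<Longrightarrow> sub s t \<Longrightarrow> ch i l t"
  by (cases i) (auto intro: sub_trans)

private lemma ch_3: "l \<in> \<Lambda> \<Longrightarrow> \<not> ch 3 l s"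
  by (auto simp: numeral_3_eq_3 dest: no_chain)

text \<open>Each gadget added increases, for its label, the length of the longest chain of nested gadgets.\<close>

lemma gadget_free_extension:
  "\<exists>t. sub s t \<and> size t \<le> size s + c * (3 * card \<Lambda>) \<and> (\<forall>l\<in>\<Lambda>. \<forall>u. \<not> gad l t u)"
proof -
  \<comment> \<open>A label contributes the number of lengths 1, 2, 3 not yet attained, hence at
    most 3; this is the 3 in the bound.\<close>
  define pot where "pot s = (\<Sum>l\<in>\<Lambda>. card {i\<in>{1..3}. \<not> ch i l s})" for s
  have bound: "pot s \<le> 3 * card \<Lambda>" for s
  proof -
    have "card {i\<in>{1..3::nat}. \<not> ch i l s} \<le> card {1..3::nat}" for l
      by (rule card_mono) auto
    then show ?thesis unfolding pot_def using sum_bounded_above[of \<Lambda> "\<lambda>l. card {i\<in>{1..3}. \<not> ch i l s}" 3] by simp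
  qed
  have "\<exists>t. sub s t \<and> size t \<le> size s + c * pot s \<and> (\<forall>l\<in>\<Lambda>. \<forall>u. \<not> gad l t u)" for s
  proof (induction "pot s" arbitrary: s rule: less_induct)
    case less
    show ?case
    proof (cases "\<forall>l\<in>\<Lambda>. \<forall>u. \<not> gad l s u")
      case True
      then show ?thesis using sub_refl by (intro exI[of _ s]) auto
    next
      case False
      then obtain l t where l: "l \<in> \<Lambda>" and g: "gad l s t" by blast
      have mono: "{i\<in>{1..3}. \<not> ch i m t} \<subseteq> {i\<in>{1..3}. \<not> ch i m s}" for m
        using ch_mono[OF _ gad_sub[OF g]] by blast
      \<comment> \<open>\<open>Suc j\<close> is the least unattained length. The gadget found
        extends the chain of length \<open>j\<close>, so \<open>Suc j\<close> becomes attained and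
        the potential drops.\<close>
      obtain j where j: "j < 3" "ch j l s" "\<not> ch (Suc j) l s"
        using ex_least_nat_less[of "\<lambda>i. \<not> ch i l s" 3] ch_3[OF l, of s] by auto
      have "ch (Suc j) l t" using j(2) g sub_refl by auto
      then have "{i\<in>{1..3}. \<not> ch i l t} \<subset> {i\<in>{1..3}. \<not> ch i l s}"
        using mono[of l] j(1,3) by (intro psubsetI) (auto simp: set_eq_iff intro!: exI[of _ "Suc j"])
      then have "card {i\<in>{1..3}. \<not> ch i l t} < card {i\<in>{1..3}. \<not> ch i l s}"
        by (intro psubset_card_mono) auto
      moreover have "card {i\<in>{1..3}. \<not> ch i m t} \<le> card {i\<in>{1..3}. \<not> ch i m s}" for m
        using mono by (intro card_mono) auto
      ultimately have lt: "pot t < pot s"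
        unfolding pot_def using fin l by (intro sum_strict_mono_ex1) auto
      obtain u where u: "sub t u" "size u \<le> size t + c * pot t" "\<forall>l\<in>\<Lambda>. \<forall>v. \<not> gad l u v"
        using less[OF lt] by blast
      have "size u \<le> size s + c + c * pot t" using u(2) gad_size[OF g] by simp
      also have "\<dots> \<le> size s + c * pot s"
        using mult_le_mono2[of "Suc (pot t)" "pot s" c] lt by simp
      finally show ?thesis using u sub_trans[OF gad_sub[OF g]] by blast
    qed
  qed
  then obtain t where t: "sub s t" "size t \<le> size s + c * pot s" "\<forall>l\<in>\<Lambda>. \<forall>u. \<not> gad l t u" by blast
  have "c * pot s \<le> c * (3 * card \<Lambda>)" using bound by simp
  then have "size t \<le> size s + c * (3 * card \<Lambda>)" using t(2) by linarith
  then show ?thesis using t by blast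
qed

end

text \<open>The positions in which Duplicator survives in the existential \<open>k\<close>-pebble game, as left over by
  \<open>k\<close>-consistency.\<close>

definition strategy :: "'a set \<Rightarrow> ('a \<Rightarrow> 'a \<Rightarrow> bool) \<Rightarrow> nat \<Rightarrow> ('a \<rightharpoonup> col) set \<Rightarrow> bool" where
  "strategy V adj k H \<longleftrightarrow> H \<noteq> {} \<and>
     (\<forall>\<tau>\<in>H. dom \<tau> \<subseteq> V \<and> (\<forall>u v. adj u v \<longrightarrow> u \<in> dom \<tau> \<longrightarrow> v \<in> dom \<tau> \<longrightarrow> \<tau> u \<noteq> \<tau> v)) \<and>
     (\<forall>\<tau>\<in>H. \<forall>\<sigma>. \<sigma> \<subseteq>\<^sub>m \<tau> \<longrightarrow> \<sigma> \<in> H) \<and>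
     (\<forall>\<tau>\<in>H. \<forall>v\<in>V. card (dom \<tau>) < k \<longrightarrow> v \<notin> dom \<tau> \<longrightarrow> (\<exists>c. \<tau>(v \<mapsto> c) \<in> H))"

locale strat = fgraph +
  fixes k :: nat and H :: "('a \<rightharpoonup> col) set"
  assumes strategy: "strategy V adj k H"
    and C5_free: "\<lbrakk>adj a b; adj b c; adj c d; adj d e; adj e a;
      \<not> adj a c; \<not> adj a d; \<not> adj b d; \<not> adj b e; \<not> adj c e\<rbrakk> \<Longrightarrow> False"
    and two_P4_free: "\<lbrakk>P4 a b c d; P4 p q r s; anticomplete {a, b, c, d} {p, q, r, s}\<rbrakk> \<Longrightarrow> False"
begin

lemma H_dom: "\<tau> \<in> H \<Longrightarrow> dom \<tau> \<subseteq> V"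
  using strategy unfolding strategy_def by blast

lemma H_fin: "\<tau> \<in> H \<Longrightarrow> finite (dom \<tau>)"
  using H_dom finV finite_subset by blast

lemma H_proper: "\<tau> \<in> H \<Longrightarrow> adj u v \<Longrightarrow> \<tau> u = Some c \<Longrightarrow> \<tau> v = Some d \<Longrightarrow> c \<noteq> d"
  using strategy unfolding strategy_def by (metis domI)

lemma H_down: "\<tau> \<in> H \<Longrightarrow> \<sigma> \<subseteq>\<^sub>m \<tau> \<Longrightarrow> \<sigma> \<in> H"
  using strategy unfolding strategy_def by blast

lemma H_extend1: "\<tau> \<in> H \<Longrightarrow> v \<in> V \<Longrightarrow> card (dom \<tau>) < k \<Longrightarrow> v \<notin> dom \<tau> \<Longrightarrow> \<exists>c. \<tau>(v \<mapsto> c) \<in> H"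
  using strategy unfolding strategy_def by blast

lemma H_empty: "Map.empty \<in> H"
  using strategy H_down unfolding strategy_def by (metis ex_in_conv map_le_empty)

lemma H_extend:
  assumes "finite T" "\<tau> \<in> H" "T \<subseteq> V" "card (dom \<tau>) + card T \<le> k"
  shows "\<exists>\<rho>\<in>H. \<tau> \<subseteq>\<^sub>m \<rho> \<and> dom \<rho> = dom \<tau> \<union> T"
  using assms
proof (induction T rule: finite_induct)
  case empty
  then show ?case by (auto intro: bexI[of _ \<tau>])
next
  case (insert v T)
  then obtain \<rho> where r: "\<rho> \<in> H" "\<tau> \<subseteq>\<^sub>m \<rho>" "dom \<rho> = dom \<tau> \<union> T" by auto
  show ?case
  proof (cases "v \<in> dom \<rho>")
    case True
    then show ?thesis using r by (intro bexI[of _ \<rho>]) auto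
  next
    case False
    have "card (dom \<rho>) < k" using insert r card_Un_le[of "dom \<tau>" T] by simp
    then obtain c where "\<rho>(v \<mapsto> c) \<in> H" using H_extend1 r(1) False insert.prems by blast
    moreover have "\<tau> \<subseteq>\<^sub>m \<rho>(v \<mapsto> c)" using r(2) False unfolding map_le_def by (metis domIff fun_upd_apply)
    moreover have "dom (\<rho>(v \<mapsto> c)) = dom \<tau> \<union> insert v T" using r(3) by simp
    ultimately show ?thesis by blast
  qed
qed

lemma H_restrict:
  assumes "\<tau> \<in> H" "\<sigma> \<subseteq>\<^sub>m \<tau>" "T \<subseteq> dom \<tau>"
  shows "\<exists>\<rho>\<in>H. \<sigma> \<subseteq>\<^sub>m \<rho> \<and> \<rho> \<subseteq>\<^sub>m \<tau> \<and> dom \<rho> = dom \<sigma> \<union> T"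
proof -
  let ?r = "\<tau> |` (dom \<sigma> \<union> T)"
  have le: "?r \<subseteq>\<^sub>m \<tau>" by (auto simp: map_le_def)
  have "dom \<sigma> \<subseteq> dom \<tau>" using assms(2) by (rule map_le_implies_dom_le)
  then have "dom ?r = dom \<sigma> \<union> T" using assms(3) by (simp add: Int_absorb1)
  moreover have "\<sigma> \<subseteq>\<^sub>m ?r" using assms(2) by (simp add: map_le_def restrict_map_def)
  ultimately show ?thesis using le H_down[OF assms(1) le] by blast
qed

definition L :: "('a \<rightharpoonup> col) \<Rightarrow> 'a \<Rightarrow> col set" where
  "L \<sigma> v = {c. \<exists>\<tau>\<in>H. \<sigma> \<subseteq>\<^sub>m \<tau> \<and> \<tau> v = Some c}"

lemma L_I: "\<tau> \<in> H \<Longrightarrow> \<sigma> \<subseteq>\<^sub>m \<tau> \<Longrightarrow> \<tau> v = Some c \<Longrightarrow> c \<in> L \<sigma> v"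
  unfolding L_def by blast

lemma L_mono: "\<sigma> \<subseteq>\<^sub>m \<tau> \<Longrightarrow> L \<tau> v \<subseteq> L \<sigma> v"
  unfolding L_def using map_le_trans by blast

lemma L_adj:
  assumes "adj v a" "\<sigma> a = Some c"
  shows "c \<notin> L \<sigma> v"
proof
  assume "c \<in> L \<sigma> v"
  then obtain \<tau> where t: "\<tau> \<in> H" "\<sigma> \<subseteq>\<^sub>m \<tau>" "\<tau> v = Some c" unfolding L_def by blast
  then have "\<tau> a = Some c" using assms(2) unfolding map_le_def by (metis domI)
  then show False using H_proper[OF t(1) assms(1) t(3)] by blast
qed

lemma L_dom: "\<sigma> a = Some c \<Longrightarrow> L \<sigma> a \<subseteq> {c}"
  unfolding L_def map_le_def by force

lemma L_nonempty:
  assumes "\<sigma> \<in> H" "v \<in> V" "card (dom \<sigma>) < k"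
  shows "L \<sigma> v \<noteq> {}"
proof -
  have "\<exists>\<rho>\<in>H. \<sigma> \<subseteq>\<^sub>m \<rho> \<and> dom \<rho> = dom \<sigma> \<union> {v}"
    using assms by (intro H_extend) auto
  then obtain \<rho> where r: "\<rho> \<in> H" "\<sigma> \<subseteq>\<^sub>m \<rho>" "v \<in> dom \<rho>" by blast
  then obtain c where "\<rho> v = Some c" by blast
  then show ?thesis using L_I r by blast
qed

lemma col_card2:
  assumes "c \<notin> (A :: col set)" "card A = 2"
  shows "A = - {c}"
proof (rule card_subset_eq)
  have "card (UNIV - {c}) = 2" by (subst card_Diff_subset) auto
  then show "card A = card (- {c})" using assms(2) by (simp only: Compl_eq_Diff_UNIV)
qed (use assms in auto)

lemma col_card2_eq: "c \<notin> (A :: col set) \<Longrightarrow> d \<notin> A \<Longrightarrow> card A = 2 \<Longrightarrow> c = d"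
  using col_card2 by fastforce

text \<open>A vertex with a list of two colours next to a coloured vertex is called free in the
  names below. This neighbour already accounts for the one missing colour, so all coloured
  neighbours of a free vertex share that colour.\<close>

lemma L_free: "adj x a \<Longrightarrow> \<sigma> a = Some t \<Longrightarrow> card (L \<sigma> x) = 2 \<Longrightarrow> L \<sigma> x = - {t}"
  by (rule col_card2) (rule L_adj)

lemma L_free_mono:
  "adj x a \<Longrightarrow> adj x b \<Longrightarrow> \<sigma> a = Some t \<Longrightarrow> \<sigma> b = Some u \<Longrightarrow> card (L \<sigma> x) = 2 \<Longrightarrow> t = u"
  by (rule col_card2_eq[of _ "L \<sigma> x"]) (auto dest: L_adj)

end

section \<open>Gadgets\<close>

context strat
begin

definition X :: "'a set \<Rightarrow> 'a set" where
  "X S = {v \<in> V - S. \<exists>a\<in>S. adj v a}"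

definition R :: "'a set \<Rightarrow> 'a set" where
  "R S = {v \<in> V - S. \<forall>a\<in>S. \<not> adj v a}"

lemma R_nonadj: "r \<in> R S \<Longrightarrow> a \<in> S \<Longrightarrow> \<not> adj r a \<and> \<not> adj a r"
  unfolding R_def using adj_sym by blast

lemma free_nonadj:
  assumes "adj x a" "\<sigma> a = Some t" "card (L \<sigma> x) = 2" "\<sigma> v = Some c" "c \<noteq> t"
  shows "\<not> adj x v \<and> \<not> adj v x"
  using L_free_mono[OF assms(1) _ assms(2,4,3)] assms(5) adj_sym by blast

text \<open>If \<open>z w\<close> were an edge, \<open>w\<close> would have colour \<open>t\<close>;
  as \<open>v\<close> and \<open>u\<close> have other colours, \<open>z\<close> would miss both, and
  \<open>z w v u b\<close> would be an induced \<open>C5\<close>.\<close>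

lemma free_turn:
  assumes "adj z b" "\<sigma> b = Some t" "card (L \<sigma> z) = 2" "\<sigma> v = Some cv" "\<sigma> w = Some cw" "cv \<noteq> cw"
    "adj u v" "adj v w" "\<not> adj u w" "adj u b" "\<sigma> u = Some q" "q \<noteq> t" "\<not> adj b v" "\<not> adj b w"
  shows "\<not> adj z w"
proof
  assume e: "adj z w"
  note n = free_nonadj[OF assms(1-3)]
  have "cw = t" using n[OF assms(5)] e by blast
  then have "\<not> adj z v" "\<not> adj z u" using n[OF assms(4)] n[OF assms(11)] assms(6,12) by simp_all
  then show False using C5_free[of z w v u b] e assms(1,7-10,13,14) by (simp add: adj_comm)
qed

lemma full_nonadj: "card (L \<sigma> r) = 3 \<Longrightarrow> v \<in> dom \<sigma> \<Longrightarrow> \<not> adj r v \<and> \<not> adj v r"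
proof -
  assume "card (L \<sigma> r) = 3" "v \<in> dom \<sigma>"
  moreover from this have "L \<sigma> r = UNIV" by (intro card_subset_eq) auto
  ultimately show ?thesis using L_adj[of r v \<sigma>] adj_sym by blast
qed

section \<open>First kind of gadgets: paths leaving a free vertex\<close>

definition gadA_at :: "'a \<Rightarrow> ('a \<rightharpoonup> col) \<Rightarrow> ('a \<rightharpoonup> col) \<Rightarrow> 'a \<Rightarrow> 'a \<Rightarrow> 'a \<Rightarrow> 'a \<Rightarrow> col \<Rightarrow> col \<Rightarrow> bool" where
  "gadA_at a \<sigma> \<tau> x r s u c t \<longleftrightarrow> \<sigma> a = Some t \<and> adj x a \<and> card (L \<sigma> x) = 2 \<and>
     {r, s, u} \<subseteq> R (dom \<sigma>) \<and> P4 x r s u \<and> \<tau> \<in> H \<and> \<sigma> \<subseteq>\<^sub>m \<tau> \<and> dom \<tau> = dom \<sigma> \<union> {x, r, s, u} \<and>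
     \<tau> r = Some c \<and> \<tau> u = Some c \<and> c \<noteq> t"

text \<open>The absence of these gadgets gives \<open>path_rule\<close>: along an induced path
  \<open>x r s u\<close> from a free \<open>x\<close> into the rest of the graph, \<open>r\<close>
  and \<open>u\<close> can share only the colour that \<open>x\<close> has lost.\<close>

definition gadA :: "'a \<Rightarrow> ('a \<rightharpoonup> col) \<Rightarrow> ('a \<rightharpoonup> col) \<Rightarrow> bool" where
  "gadA a \<sigma> \<tau> \<longleftrightarrow> (\<exists>x r s u c t. gadA_at a \<sigma> \<tau> x r s u c t)"

lemma map_leD: "\<sigma> \<subseteq>\<^sub>m \<tau> \<Longrightarrow> \<sigma> v = Some c \<Longrightarrow> \<tau> v = Some c"
  unfolding map_le_def by (metis domI)

text \<open>Two nested gadgets already contradict each other. The coloured \<open>x1\<close>,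
  \<open>r1\<close>, \<open>u1\<close> avoid the colour \<open>t\<close> of \<open>a\<close>, so the
  free \<open>x2\<close> misses them; an edge \<open>s1 x2\<close> would close the cycle
  \<open>x1 r1 s1 x2 a\<close>. Hence the two paths are anticomplete.\<close>

lemma gadA_no_chain:
  assumes 1: "gadA a \<sigma>1 \<tau>1" and le: "\<tau>1 \<subseteq>\<^sub>m \<sigma>2" and 2: "gadA a \<sigma>2 \<tau>2"
  shows False
proof -
  obtain x1 r1 s1 u1 c1 t where "gadA_at a \<sigma>1 \<tau>1 x1 r1 s1 u1 c1 t"
    using 1 unfolding gadA_def by blast
  then have g1: "\<sigma>1 a = Some t" "adj x1 a" "{r1, s1, u1} \<subseteq> R (dom \<sigma>1)" "P4 x1 r1 s1 u1"
    "\<tau>1 \<in> H" "\<sigma>1 \<subseteq>\<^sub>m \<tau>1" "dom \<tau>1 = dom \<sigma>1 \<union> {x1, r1, s1, u1}" "\<tau>1 r1 = Some c1" "\<tau>1 u1 = Some c1" "c1 \<noteq> t"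
    unfolding gadA_at_def by simp_all
  obtain x2 r2 s2 u2 c2 t2 where "gadA_at a \<sigma>2 \<tau>2 x2 r2 s2 u2 c2 t2"
    using 2 unfolding gadA_def by blast
  then have g2: "adj x2 a" "card (L \<sigma>2 x2) = 2" "{r2, s2, u2} \<subseteq> R (dom \<sigma>2)" "P4 x2 r2 s2 u2"
    unfolding gadA_at_def by simp_all
  have \<tau>a: "\<tau>1 a = Some t" by (rule map_leD[OF g1(6,1)])
  have \<sigma>a: "\<sigma>2 a = Some t" by (rule map_leD[OF le \<tau>a])
  obtain c where c: "\<tau>1 x1 = Some c" using g1(7) by blast
  have "c \<noteq> t" using H_proper[OF g1(5) g1(2) c \<tau>a] by simp
  have x2: "\<not> adj x2 x1" "\<not> adj x2 r1" "\<not> adj x2 u1"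
    using free_nonadj[OF g2(1) \<sigma>a g2(2) map_leD[OF le c]] \<open>c \<noteq> t\<close>
      free_nonadj[OF g2(1) \<sigma>a g2(2) map_leD[OF le g1(8)]]
      free_nonadj[OF g2(1) \<sigma>a g2(2) map_leD[OF le g1(9)]] g1(10) by simp_all
  have ra: "\<not> adj r1 a" "\<not> adj s1 a" using g1(1,3) R_nonadj by blast+
  have P: "adj x1 r1" "adj r1 s1" "adj s1 u1" "\<not> adj x1 s1" using g1(4) by (auto simp: P4_def)
  have "\<not> adj s1 x2"
  proof
    assume "adj s1 x2"
    then show False
      using C5_free[of x1 r1 s1 x2 a] P g1(2) g2(1) ra x2 by (simp add: adj_comm)
  qed
  moreover have "{x1, r1, s1, u1} \<subseteq> dom \<sigma>2" using g1(7) le map_le_implies_dom_le by blast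
  then have "\<not> adj v w" if "v \<in> {x1, r1, s1, u1}" "w \<in> {r2, s2, u2}" for v w
    using R_nonadj[of w "dom \<sigma>2" v] g2(3) that by blast
  moreover have "\<not> adj x1 x2" "\<not> adj r1 x2" "\<not> adj u1 x2" using x2 adj_sym by blast+
  ultimately have "anticomplete {x1, r1, s1, u1} {x2, r2, s2, u2}" using \<open>\<not> adj s1 x2\<close> unfolding anticomplete_def by blast
  then show False using two_P4_free g1(4) g2(4) by blast
qed

section \<open>Second kind of gadgets: two free neighbours of a vertex with a full list\<close>

definition gad1_at :: "'a set \<Rightarrow> 'a \<Rightarrow> 'a \<Rightarrow> ('a \<rightharpoonup> col) \<Rightarrow> ('a \<rightharpoonup> col) \<Rightarrow> 'a \<Rightarrow> 'a \<Rightarrow> 'a \<Rightarrow> col \<Rightarrow> col \<Rightarrow> bool" where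
  "gad1_at S a d \<sigma> \<tau> x y r s t \<longleftrightarrow> S \<subseteq> dom \<sigma> \<and> a \<in> S \<and> d \<in> S \<and> \<sigma> a = Some s \<and> \<sigma> d = Some t \<and> s \<noteq> t \<and>
     r \<in> R S \<and> adj x a \<and> adj y d \<and> adj r x \<and> adj r y \<and> \<not> adj x y \<and>
     card (L \<sigma> r) = 3 \<and> card (L \<sigma> x) = 2 \<and> card (L \<sigma> y) = 2 \<and>
     \<tau> \<in> H \<and> \<sigma> \<subseteq>\<^sub>m \<tau> \<and> dom \<tau> = dom \<sigma> \<union> {x, r, y}"

text \<open>The absence of these gadgets gives \<open>type_rule\<close>, which saves one of three
  vertices in \<open>Ex_not_UNIV\<close>.\<close>

definition gad1 :: "'a set \<Rightarrow> 'a \<times> 'a \<Rightarrow> ('a \<rightharpoonup> col) \<Rightarrow> ('a \<rightharpoonup> col) \<Rightarrow> bool" where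
  "gad1 S = (\<lambda>(a, d) \<sigma> \<tau>. \<exists>x y r s t. gad1_at S a d \<sigma> \<tau> x y r s t)"

text \<open>The colour of the middle vertex \<open>r2\<close> differs from that of \<open>a\<close> or from that of \<open>d\<close>; in the first case the
  paths \<open>r3 x3 a x1\<close> and \<open>r2 y2 d y1\<close> are anticomplete, in the second case the mirror images.\<close>

lemma spiders_no_chain:
  assumes P: "adj x1 a" "adj x2 a" "adj x3 a" "adj y1 d" "adj y2 d" "adj y3 d"
      "adj r1 x1" "adj r2 x2" "adj r3 x3" "adj r1 y1" "adj r2 y2" "adj r3 y3"
      "\<not> adj x1 y1" "\<not> adj x2 y2" "\<not> adj x3 y3" "\<not> adj a d"
    and a: "\<not> adj a r1" "\<not> adj a r2" "\<not> adj a r3" "\<not> adj a y1" "\<not> adj a y2" "\<not> adj a y3"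
    and d: "\<not> adj d r1" "\<not> adj d r2" "\<not> adj d r3" "\<not> adj d x1" "\<not> adj d x2" "\<not> adj d x3"
    and x: "\<not> adj x1 x2" "\<not> adj x1 x3" and y: "\<not> adj y1 y2" "\<not> adj y1 y3"
    and r: "\<not> adj r2 x1" "\<not> adj r2 y1" "\<not> adj r3 x1" "\<not> adj r3 y1" "\<not> adj r3 x2" "\<not> adj r3 y2"
      "\<not> adj r3 r2"
    and xy: "\<not> adj x2 y1" "\<not> adj x3 y1" "\<not> adj x3 y2" "\<not> adj y2 x1" "\<not> adj y3 x1" "\<not> adj y3 x2"
    and alt: "\<not> adj x3 r2 \<or> \<not> adj y3 r2"
  shows False
  using alt
proof
  assume "\<not> adj x3 r2"
  moreover have "P4 r3 x3 a x1" "P4 r2 y2 d y1" using assms by (simp_all add: P4_def adj_comm)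
  ultimately show False
    using two_P4_free[of r3 x3 a x1 r2 y2 d y1] assms by (simp add: anticomplete_def adj_comm)
next
  assume "\<not> adj y3 r2"
  moreover have "P4 r3 y3 d y1" "P4 r2 x2 a x1" using assms by (simp_all add: P4_def adj_comm)
  ultimately show False
    using two_P4_free[of r3 y3 d y1 r2 x2 a x1] assms by (simp add: anticomplete_def adj_comm)
qed

lemma gad1D:
  assumes "gad1 S (a, d) \<sigma> \<tau>"
  obtains x y r s t cx cy cr where "S \<subseteq> dom \<sigma>" "a \<in> S" "d \<in> S" "\<sigma> a = Some s" "\<sigma> d = Some t" "s \<noteq> t"
    "adj x a" "adj y d" "adj r x" "adj r y" "\<not> adj x y" "\<not> adj a r" "\<not> adj d r" "\<not> adj a y" "\<not> adj d x" "\<not> adj a d"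
    "card (L \<sigma> r) = 3" "card (L \<sigma> x) = 2" "card (L \<sigma> y) = 2" "\<tau> x = Some cx" "\<tau> y = Some cy" "\<tau> r = Some cr"
    "cx \<noteq> s" "cy \<noteq> t" "cr \<noteq> cx" "cr \<noteq> cy" "\<tau> a = Some s" "\<tau> d = Some t"
proof -
  obtain x y r s t where "gad1_at S a d \<sigma> \<tau> x y r s t"
    using assms unfolding gad1_def by auto
  then have g: "S \<subseteq> dom \<sigma>" "a \<in> S" "d \<in> S" "\<sigma> a = Some s" "\<sigma> d = Some t" "s \<noteq> t" "r \<in> R S"
    "adj x a" "adj y d" "adj r x" "adj r y" "\<not> adj x y"
    "card (L \<sigma> r) = 3" "card (L \<sigma> x) = 2" "card (L \<sigma> y) = 2" "\<tau> \<in> H" "\<sigma> \<subseteq>\<^sub>m \<tau>" "dom \<tau> = dom \<sigma> \<union> {x, r, y}"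
    unfolding gad1_at_def by simp_all
  have c: "x \<in> dom \<tau>" "y \<in> dom \<tau>" "r \<in> dom \<tau>" using g(18) by auto
  then obtain cx cy cr where cc: "\<tau> x = Some cx" "\<tau> y = Some cy" "\<tau> r = Some cr" by blast
  have \<tau>: "\<tau> a = Some s" "\<tau> d = Some t" using map_leD[OF g(17)] g(4,5) by simp_all
  have ne: "cx \<noteq> s" "cy \<noteq> t" "cr \<noteq> cx" "cr \<noteq> cy" using H_proper[OF g(16)] g(8-11) cc \<tau> by blast+
  have na: "\<not> adj a r" "\<not> adj d r" using g(2,3,7) R_nonadj by blast+
  have nb: "\<not> adj a y" "\<not> adj d x"
    using free_nonadj[OF g(9,5,15,4)] free_nonadj[OF g(8,4,14,5)] g(6) by auto
  have "\<not> adj a d"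
    using C5_free[of r x a d y] g(8-12) na nb by (auto simp: adj_comm)
  then show thesis
    using g(1-6,8-15) cc \<tau> ne na nb that[of s t x y r cx cy cr] by simp
qed

lemma gad1_le: "gad1 S l \<sigma> \<tau> \<Longrightarrow> \<sigma> \<subseteq>\<^sub>m \<tau>"
  unfolding gad1_def gad1_at_def by (auto split: prod.splits)

text \<open>The vertices \<open>r2\<close> and \<open>r3\<close> have full lists when their gadget
  is added, hence no coloured neighbours. The later \<open>x2\<close>, \<open>x3\<close>,
  \<open>y2\<close>, \<open>y3\<close> are free, so they miss earlier vertices whose colour differs
  from that of \<open>a\<close> or \<open>d\<close> respectively, and \<open>free_turn\<close>
  separates them from the earlier vertices on the opposite side.\<close>

lemma gad1_no_chain:
  assumes 1: "gad1 S l \<sigma>1 \<tau>1" and le1: "\<tau>1 \<subseteq>\<^sub>m \<sigma>2" and 2: "gad1 S l \<sigma>2 \<tau>2" and le2: "\<tau>2 \<subseteq>\<^sub>m \<sigma>3"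
    and 3: "gad1 S l \<sigma>3 \<tau>3"
  shows False
proof -
  obtain a d where l: "l = (a, d)" by (cases l)
  have sub: "\<tau>1 \<subseteq>\<^sub>m \<sigma>3"
    using gad1_le[OF 2] le1 le2 by (blast intro: map_le_trans)
  obtain x1 y1 r1 s t cx1 cy1 cr1 where g1: "\<sigma>1 a = Some s" "\<sigma>1 d = Some t" "s \<noteq> t"
    "adj x1 a" "adj y1 d" "adj r1 x1" "adj r1 y1" "\<not> adj x1 y1" "\<not> adj a r1" "\<not> adj d r1" "\<not> adj a y1" "\<not> adj d x1" "\<not> adj a d"
    "\<tau>1 x1 = Some cx1" "\<tau>1 y1 = Some cy1" "\<tau>1 r1 = Some cr1"
    "cx1 \<noteq> s" "cy1 \<noteq> t" "cr1 \<noteq> cx1" "cr1 \<noteq> cy1" "\<tau>1 a = Some s" "\<tau>1 d = Some t"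
    using 1 unfolding l by (rule gad1D) blast
  have s2: "\<sigma>2 a = Some s" "\<sigma>2 d = Some t" "\<sigma>3 a = Some s" "\<sigma>3 d = Some t"
    using g1 map_leD[OF le1] map_leD[OF sub] by simp_all
  obtain x2 y2 r2 cx2 cy2 cr2 where g2:
    "adj x2 a" "adj y2 d" "adj r2 x2" "adj r2 y2" "\<not> adj x2 y2" "\<not> adj a r2" "\<not> adj d r2" "\<not> adj a y2" "\<not> adj d x2"
    "card (L \<sigma>2 r2) = 3" "card (L \<sigma>2 x2) = 2" "card (L \<sigma>2 y2) = 2"
    "\<tau>2 x2 = Some cx2" "\<tau>2 y2 = Some cy2" "\<tau>2 r2 = Some cr2"
    "cx2 \<noteq> s" "cy2 \<noteq> t" "cr2 \<noteq> cx2" "cr2 \<noteq> cy2"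
    using 2 s2 unfolding l by (elim gad1D) auto
  obtain x3 y3 r3 where g3:
    "adj x3 a" "adj y3 d" "adj r3 x3" "adj r3 y3" "\<not> adj x3 y3" "\<not> adj a r3" "\<not> adj d r3" "\<not> adj a y3" "\<not> adj d x3"
    "card (L \<sigma>3 r3) = 3" "card (L \<sigma>3 x3) = 2" "card (L \<sigma>3 y3) = 2"
    using 3 s2 unfolding l by (elim gad1D) auto
  have \<sigma>: "\<sigma>2 x1 = Some cx1" "\<sigma>2 y1 = Some cy1" "\<sigma>2 r1 = Some cr1" "\<sigma>3 x1 = Some cx1" "\<sigma>3 y1 = Some cy1"
    "\<sigma>3 r1 = Some cr1" "\<sigma>3 x2 = Some cx2" "\<sigma>3 y2 = Some cy2" "\<sigma>3 r2 = Some cr2"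
    using g1 g2 map_leD[OF le1] map_leD[OF sub] map_leD[OF le2] by simp_all
  note nx2 = free_nonadj[OF g2(1) s2(1) g2(11)] and ny2 = free_nonadj[OF g2(2) s2(2) g2(12)]
    and nx3 = free_nonadj[OF g3(1) s2(3) g3(11)] and ny3 = free_nonadj[OF g3(2) s2(4) g3(12)]
  note fr2 = full_nonadj[OF g2(10), OF domI] and fr3 = full_nonadj[OF g3(10), OF domI]
  have P: "adj x1 r1" "adj y1 r1" "adj x2 r2" "adj y2 r2" "\<not> adj y1 x1" "\<not> adj y2 x2"
    using g1(6-8) g2(3-5) adj_sym by blast+
  show False
  proof (rule spiders_no_chain[of x1 a x2 x3 y1 d y2 y3 r1 r2 r3])
    show "\<not> adj x1 x2" "\<not> adj x1 x3" "\<not> adj y1 y2" "\<not> adj y1 y3"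
      using nx2 nx3 ny2 ny3 \<sigma> g1 by blast+
    show "\<not> adj x2 y1"
      by (rule free_turn[OF g2(1) s2(1) g2(11) \<sigma>(3,2) g1(20) P(1) g1(7,8,4) \<sigma>(1) g1(17,9,11)])
    show "\<not> adj x3 y1"
      by (rule free_turn[OF g3(1) s2(3) g3(11) \<sigma>(6,5) g1(20) P(1) g1(7,8,4) \<sigma>(4) g1(17,9,11)])
    show "\<not> adj x3 y2"
      by (rule free_turn[OF g3(1) s2(3) g3(11) \<sigma>(9,8) g2(19) P(3) g2(4,5,1) \<sigma>(7) g2(16,6,8)])
    show "\<not> adj y2 x1"
      by (rule free_turn[OF g2(2) s2(2) g2(12) \<sigma>(3,1) g1(19) P(2) g1(6) P(5) g1(5) \<sigma>(2) g1(18,10,12)])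
    show "\<not> adj y3 x1"
      by (rule free_turn[OF g3(2) s2(4) g3(12) \<sigma>(6,4) g1(19) P(2) g1(6) P(5) g1(5) \<sigma>(5) g1(18,10,12)])
    show "\<not> adj y3 x2"
      by (rule free_turn[OF g3(2) s2(4) g3(12) \<sigma>(9,7) g2(18) P(4) g2(3) P(6) g2(2) \<sigma>(8) g2(17,7,9)])
    show "\<not> adj x3 r2 \<or> \<not> adj y3 r2" using nx3[OF \<sigma>(9)] ny3[OF \<sigma>(9)] g1(3) by blast
    show "\<not> adj r2 x1" "\<not> adj r2 y1" "\<not> adj r3 x1" "\<not> adj r3 y1" "\<not> adj r3 x2" "\<not> adj r3 y2" "\<not> adj r3 r2"
      using fr2 fr3 \<sigma> by blast+
  qed (use g1 g2 g3 in auto)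
qed

section \<open>Third kind of gadgets: paths with equal colours at both ends\<close>

definition link :: "'a set \<Rightarrow> ('a \<times> 'a) set" where
  "link S = {(u, v). u \<in> R S \<and> v \<in> R S \<and> adj u v}\<^sup>*"

lemma link_refl: "(v, v) \<in> link S"
  unfolding link_def by simp

lemma link_trans: "(u, v) \<in> link S \<Longrightarrow> (v, w) \<in> link S \<Longrightarrow> (u, w) \<in> link S"
  unfolding link_def by (rule rtrancl_trans)

lemma link_adj: "u \<in> R S \<Longrightarrow> v \<in> R S \<Longrightarrow> adj u v \<Longrightarrow> (u, v) \<in> link S"
  unfolding link_def by blast

lemma link_R: "(u, v) \<in> link S \<Longrightarrow> u \<in> R S \<Longrightarrow> v \<in> R S"
  unfolding link_def by (induction rule: rtrancl_induct) auto

text \<open>The components of the graph on \<open>R S\<close> that contain a vertex with a full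
  list. Whole components are taken so that every neighbour of this set outside it lies in
  \<open>X S\<close>, hence has a short list and is coloured as in 2-SAT.\<close>

definition U :: "'a set \<Rightarrow> ('a \<rightharpoonup> col) \<Rightarrow> 'a set" where
  "U S \<sigma> = {v \<in> R S. \<exists>w. (v, w) \<in> link S \<and> card (L \<sigma> w) = 3}"

text \<open>The vertices \<open>p1\<close> and \<open>p2\<close> dominate the component of \<open>r\<close>, so once they are coloured no vertex of this
  component has a full list any more: a later gadget lives in another component.\<close>

definition gad2_at where
  "gad2_at S a d q \<sigma> \<tau> x y r s p1 p2 \<longleftrightarrow> S \<subseteq> dom \<sigma> \<and> a \<in> S \<and> d \<in> S \<and>
     r \<in> U S \<sigma> \<and> s \<in> U S \<sigma> \<and> adj x a \<and> adj y d \<and> P4 x r s y \<and> q \<in> L \<sigma> r \<and> q \<in> L \<sigma> s \<and>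
     card (L \<sigma> x) = 2 \<and> card (L \<sigma> y) = 2 \<and> \<tau> \<in> H \<and> \<sigma> \<subseteq>\<^sub>m \<tau> \<and> dom \<tau> = dom \<sigma> \<union> {x, y, r, s, p1, p2} \<and>
     \<tau> x = Some q \<and> \<tau> y = Some q \<and> (\<forall>v. (r, v) \<in> link S \<longrightarrow> adj v p1 \<or> adj v p2)"

text \<open>The absence of these gadgets gives \<open>edge_rule\<close>, on which
  \<open>edge_cost\<close> depends. The colour \<open>q\<close> is part of the label because later
  vertices with \<open>q\<close> in their list then miss the earlier \<open>x\<close> and
  \<open>y\<close>, which are coloured \<open>q\<close>.\<close>

definition gad2 where
  "gad2 S = (\<lambda>(a, d, q) \<sigma> \<tau>. \<exists>x y r s p1 p2. gad2_at S a d q \<sigma> \<tau> x y r s p1 p2)"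

lemma gad2_le: "gad2 S l \<sigma> \<tau> \<Longrightarrow> \<sigma> \<subseteq>\<^sub>m \<tau>"
  unfolding gad2_def gad2_at_def by (auto split: prod.splits)

text \<open>If \<open>x2 r1\<close> or \<open>y2 s1\<close> is an edge, one of the two paths turns around at that edge and the third
  gadget supplies the other path.\<close>

lemma long_spiders_no_chain:
  assumes P: "P4 x1 r1 s1 y1" "P4 x2 r2 s2 y2" "adj x3 r3" "adj s3 y3"
      "adj x1 a" "adj x2 a" "adj x3 a" "adj y1 d" "adj y2 d" "adj y3 d"
    and a: "\<forall>v\<in>{r1, r2, r3, s1, s2, s3, y1, y2, y3}. \<not> adj a v"
    and d: "\<forall>v\<in>{r1, r2, r3, s1, s2, s3, x1, x2, x3}. \<not> adj d v"
    and x: "\<forall>v\<in>{x1, s1, y1}. \<not> adj x2 v" "\<forall>v\<in>{x1, y1, s1, s2, y2}. \<not> adj x3 v"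
    and y: "\<forall>v\<in>{y1, r1, x1}. \<not> adj y2 v" "\<forall>v\<in>{y1, x1, r1, r2, x2}. \<not> adj y3 v"
    and rs: "\<forall>u\<in>{r2, s2}. \<forall>v\<in>{x1, r1, s1, y1}. \<not> adj u v" "\<forall>u\<in>{r3, s3}. \<forall>v\<in>{x1, r1, s1, y1, x2, r2, s2, y2}. \<not> adj u v"
  shows False
proof -
  note defs = P4_def anticomplete_def
  consider "adj y2 s1" | "adj x2 r1" | "\<not> adj y2 s1" "\<not> adj x2 r1" by blast
  then show False
  proof cases
    case 1
    have "P4 x1 a x3 r3" "P4 y1 s1 y2 s2" using assms 1 by (simp_all add: P4_def adj_comm)
    moreover have "anticomplete {x1, a, x3, r3} {y1, s1, y2, s2}" using assms by (simp add: defs adj_comm)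
    ultimately show False using two_P4_free by blast
  next
    case 2
    have "P4 y1 d y3 s3" "P4 x1 r1 x2 r2" using assms 2 by (simp_all add: P4_def adj_comm)
    moreover have "anticomplete {y1, d, y3, s3} {x1, r1, x2, r2}" using assms by (simp add: defs adj_comm)
    ultimately show False using two_P4_free by blast
  next
    case 3
    have "anticomplete {x1, r1, s1, y1} {x2, r2, s2, y2}" using assms 3 by (simp add: defs adj_comm)
    then show False using two_P4_free P by blast
  qed
qed

text \<open>The last conclusion separates nested gadgets: a later \<open>v\<close> misses
  \<open>x\<close> and \<open>y\<close> because these have colour \<open>q\<close>, and misses
  \<open>r\<close> and \<open>s\<close> because it lies in another component.\<close>

lemma gad2D:
  assumes "gad2_at S a d q \<sigma> \<tau> x y r s p1 p2"
  obtains ta td cr cs where "\<sigma> a = Some ta" "\<sigma> d = Some td" "ta \<noteq> q" "td \<noteq> q" "\<tau> r = Some cr" "\<tau> s = Some cs" "cr \<noteq> cs"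
    "\<tau> x = Some q" "\<tau> y = Some q" "card (L \<sigma> x) = 2" "card (L \<sigma> y) = 2" "P4 x r s y" "adj x a" "adj y d"
    "r \<in> U S \<sigma>" "s \<in> U S \<sigma>" "q \<in> L \<sigma> r" "q \<in> L \<sigma> s"
    "\<forall>v\<in>{r, s, y}. \<not> adj a v" "\<forall>v\<in>{r, s, x}. \<not> adj d v"
    "\<And>\<rho> v. \<tau> \<subseteq>\<^sub>m \<rho> \<Longrightarrow> v \<in> U S \<rho> \<Longrightarrow> q \<in> L \<rho> v \<Longrightarrow> \<forall>w\<in>{x, r, s, y}. \<not> adj v w"
proof -
  have g: "S \<subseteq> dom \<sigma>" "a \<in> S" "d \<in> S" "r \<in> U S \<sigma>" "s \<in> U S \<sigma>" "adj x a" "adj y d" "P4 x r s y" "q \<in> L \<sigma> r" "q \<in> L \<sigma> s"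
     "card (L \<sigma> x) = 2" "card (L \<sigma> y) = 2" "\<tau> \<in> H" "\<sigma> \<subseteq>\<^sub>m \<tau>" "dom \<tau> = dom \<sigma> \<union> {x, y, r, s, p1, p2}"
     "\<tau> x = Some q" "\<tau> y = Some q" and dm: "\<And>v. (r, v) \<in> link S \<Longrightarrow> adj v p1 \<or> adj v p2"
    using assms unfolding gad2_at_def by simp_all
  have P: "adj x r" "adj r s" "adj s y" "\<not> adj x s" "\<not> adj x y" "\<not> adj r y" using g(8) unfolding P4_def by simp_all
  have "a \<in> dom \<sigma>" "d \<in> dom \<sigma>" using g(1-3) by auto
  then obtain ta td where t: "\<sigma> a = Some ta" "\<sigma> d = Some td" by blast
  have t': "\<tau> a = Some ta" "\<tau> d = Some td" using map_leD[OF g(14)] t by simp_all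
  have ne: "ta \<noteq> q" "td \<noteq> q"
    using H_proper[OF g(13,6,16) t'(1)] H_proper[OF g(13,7,17) t'(2)] by simp_all
  have "r \<in> dom \<tau>" "s \<in> dom \<tau>" using g(15) by auto
  then obtain cr cs where c: "\<tau> r = Some cr" "\<tau> s = Some cs" by blast
  have crs: "cr \<noteq> cs" by (rule H_proper[OF g(13) P(2) c])
  have rR: "r \<in> R S" "s \<in> R S" using g(4,5) unfolding U_def by simp_all
  have na: "\<not> adj a r" "\<not> adj a s" "\<not> adj d r" "\<not> adj d s"
    using R_nonadj[OF rR(1) g(2)] R_nonadj[OF rR(2) g(2)] R_nonadj[OF rR(1) g(3)] R_nonadj[OF rR(2) g(3)] by simp_all
  have ay: "\<not> adj a y"
  proof
    assume "adj a y"
    then show False using C5_free[of x r s y a] P g(6) na by (simp add: adj_comm)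
  qed
  have dx: "\<not> adj d x"
  proof
    assume "adj d x"
    then show False using C5_free[of x r s y d] P g(7) na by (simp add: adj_comm)
  qed
  have later: "\<forall>w\<in>{x, r, s, y}. \<not> adj v w" if le: "\<tau> \<subseteq>\<^sub>m \<rho>" and v: "v \<in> U S \<rho>" and q: "q \<in> L \<rho> v" for \<rho> v
  proof -
    have p: "p1 \<in> dom \<rho>" "p2 \<in> dom \<rho>" using g(15) map_le_implies_dom_le[OF le] by auto
    obtain w where w: "(v, w) \<in> link S" "card (L \<rho> w) = 3" and vR: "v \<in> R S" using v unfolding U_def by blast
    have nl: "(r, v) \<notin> link S"
    proof
      assume "(r, v) \<in> link S"
      then have "adj w p1 \<or> adj w p2" using dm link_trans w(1) by blast
      then show False using full_nonadj[OF w(2)] p by blast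
    qed
    have "\<not> adj v r"
    proof
      assume "adj v r"
      then have "(r, v) \<in> link S" using link_adj[OF rR(1) vR] adj_sym by blast
      then show False using nl by simp
    qed
    moreover have "\<not> adj v s"
    proof
      assume "adj v s"
      then have "(s, v) \<in> link S" using link_adj[OF rR(2) vR] adj_sym by blast
      then have "(r, v) \<in> link S" using link_trans[OF link_adj[OF rR P(2)]] by simp
      then show False using nl by simp
    qed
    moreover have "\<not> adj v x" "\<not> adj v y"
      using L_adj[where \<sigma> = \<rho> and v = v] map_leD[OF le g(16)] map_leD[OF le g(17)] q by blast+
    ultimately show ?thesis by simp
  qed
  show thesis
  proof (rule that[OF t ne c crs g(16,17,11,12,8,6,7,4,5,9,10) _ _ later])
    show "\<forall>v\<in>{r, s, y}. \<not> adj a v" "\<forall>v\<in>{r, s, x}. \<not> adj d v" using na ay dx by simp_all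
  qed
qed

text \<open>Together with the last conclusion of \<open>gad2D\<close>, \<open>free_nonadj\<close>
  and \<open>free_turn\<close> remove all edges between the first two paths except possibly
  \<open>x2 r1\<close> and \<open>y2 s1\<close>; \<open>long_spiders_no_chain\<close> deals with
  these.\<close>

lemma gad2_no_chain:
  assumes 1: "gad2 S l \<sigma>1 \<tau>1" and le1: "\<tau>1 \<subseteq>\<^sub>m \<sigma>2" and 2: "gad2 S l \<sigma>2 \<tau>2" and le2: "\<tau>2 \<subseteq>\<^sub>m \<sigma>3"
    and 3: "gad2 S l \<sigma>3 \<tau>3"
  shows False
proof -
  obtain a d q where l: "l = (a, d, q)" by (cases l)
  have sub: "\<tau>1 \<subseteq>\<^sub>m \<sigma>3"
    using gad2_le[OF 2] le1 le2 by (blast intro: map_le_trans)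
  obtain x1 y1 r1 s1 p1 p1' where "gad2_at S a d q \<sigma>1 \<tau>1 x1 y1 r1 s1 p1 p1'"
    using 1 unfolding l gad2_def by auto
  then obtain ta td cr1 cs1 where g1: "\<sigma>1 a = Some ta" "\<sigma>1 d = Some td" "ta \<noteq> q" "td \<noteq> q" "\<tau>1 r1 = Some cr1" "\<tau>1 s1 = Some cs1" "cr1 \<noteq> cs1"
    "\<tau>1 x1 = Some q" "\<tau>1 y1 = Some q" "P4 x1 r1 s1 y1" "adj x1 a" "adj y1 d"
    "\<forall>v\<in>{r1, s1, y1}. \<not> adj a v" "\<forall>v\<in>{r1, s1, x1}. \<not> adj d v"
    and later1: "\<And>\<rho> v. \<tau>1 \<subseteq>\<^sub>m \<rho> \<Longrightarrow> v \<in> U S \<rho> \<Longrightarrow> q \<in> L \<rho> v \<Longrightarrow> \<forall>w\<in>{x1, r1, s1, y1}. \<not> adj v w"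
    by (rule gad2D) blast
  have le12: "\<sigma>1 \<subseteq>\<^sub>m \<tau>1" by (rule gad2_le[OF 1])
  have s2: "\<sigma>2 a = Some ta" "\<sigma>2 d = Some td" "\<sigma>3 a = Some ta" "\<sigma>3 d = Some td"
    using g1(1,2) map_leD[OF map_le_trans[OF le12 le1]] map_leD[OF map_le_trans[OF le12 sub]] by simp_all
  obtain x2 y2 r2 s2 p2 p2' where "gad2_at S a d q \<sigma>2 \<tau>2 x2 y2 r2 s2 p2 p2'"
    using 2 unfolding l gad2_def by auto
  then obtain cr2 cs2 where g2: "\<tau>2 r2 = Some cr2" "\<tau>2 s2 = Some cs2" "cr2 \<noteq> cs2"
    "\<tau>2 x2 = Some q" "\<tau>2 y2 = Some q" "card (L \<sigma>2 x2) = 2" "card (L \<sigma>2 y2) = 2" "P4 x2 r2 s2 y2" "adj x2 a" "adj y2 d"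
    "r2 \<in> U S \<sigma>2" "s2 \<in> U S \<sigma>2" "q \<in> L \<sigma>2 r2" "q \<in> L \<sigma>2 s2"
    "\<forall>v\<in>{r2, s2, y2}. \<not> adj a v" "\<forall>v\<in>{r2, s2, x2}. \<not> adj d v"
    and later2: "\<And>\<rho> v. \<tau>2 \<subseteq>\<^sub>m \<rho> \<Longrightarrow> v \<in> U S \<rho> \<Longrightarrow> q \<in> L \<rho> v \<Longrightarrow> \<forall>w\<in>{x2, r2, s2, y2}. \<not> adj v w"
    by (rule gad2D) blast
  obtain x3 y3 r3 s3 p3 p3' where "gad2_at S a d q \<sigma>3 \<tau>3 x3 y3 r3 s3 p3 p3'"
    using 3 unfolding l gad2_def by auto
  then obtain cr3 where g3: "card (L \<sigma>3 x3) = 2" "card (L \<sigma>3 y3) = 2" "P4 x3 r3 s3 y3" "adj x3 a" "adj y3 d"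
    "r3 \<in> U S \<sigma>3" "s3 \<in> U S \<sigma>3" "q \<in> L \<sigma>3 r3" "q \<in> L \<sigma>3 s3"
    "\<forall>v\<in>{r3, s3, y3}. \<not> adj a v" "\<forall>v\<in>{r3, s3, x3}. \<not> adj d v"
    by (rule gad2D) blast
  have \<sigma>: "\<sigma>2 x1 = Some q" "\<sigma>2 y1 = Some q" "\<sigma>3 x1 = Some q" "\<sigma>3 y1 = Some q" "\<sigma>3 x2 = Some q" "\<sigma>3 y2 = Some q"
    using g1(8,9) g2(4,5) map_leD[OF le1] map_leD[OF sub] map_leD[OF le2] by simp_all
  have \<sigma>r: "\<sigma>2 r1 = Some cr1" "\<sigma>2 s1 = Some cs1" "\<sigma>3 r1 = Some cr1" "\<sigma>3 s1 = Some cs1" "\<sigma>3 r2 = Some cr2" "\<sigma>3 s2 = Some cs2"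
    using g1(5,6) g2(1,2) map_leD[OF le1] map_leD[OF sub] map_leD[OF le2] by simp_all
  note q = g1(3,4)[symmetric]
  note nx2 = free_nonadj[OF g2(9) s2(1) g2(6)] and ny2 = free_nonadj[OF g2(10) s2(2) g2(7)]
    and nx3 = free_nonadj[OF g3(4) s2(3) g3(1)] and ny3 = free_nonadj[OF g3(5) s2(4) g3(2)]
  have P: "adj x1 r1" "adj r1 s1" "adj s1 y1" "\<not> adj x1 s1" "\<not> adj r1 y1" "adj x2 r2" "adj r2 s2" "adj s2 y2" "\<not> adj x2 s2" "\<not> adj r2 y2"
    using g1(10) g2(8) unfolding P4_def by simp_all
  have P': "adj s1 r1" "adj s2 r2" "adj y1 s1" "adj y2 s2" "\<not> adj y1 r1" "\<not> adj y2 r2" using P adj_sym by blast+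
  have na: "\<not> adj a r1" "\<not> adj a s1" "\<not> adj d r1" "\<not> adj d s1" "\<not> adj a r2" "\<not> adj a s2" "\<not> adj d r2" "\<not> adj d s2"
    using g1(13,14) g2(15,16) by simp_all
  have x2: "\<not> adj x2 s1" by (rule free_turn[OF g2(9) s2(1) g2(6) \<sigma>r(1,2) g1(7) P(1,2,4) g1(11) \<sigma>(1) q(1) na(1,2)])
  have x3: "\<not> adj x3 s1" by (rule free_turn[OF g3(4) s2(3) g3(1) \<sigma>r(3,4) g1(7) P(1,2,4) g1(11) \<sigma>(3) q(1) na(1,2)])
  have x3': "\<not> adj x3 s2" by (rule free_turn[OF g3(4) s2(3) g3(1) \<sigma>r(5,6) g2(3) P(6,7,9) g2(9) \<sigma>(5) q(1) na(5,6)])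
  have y2: "\<not> adj y2 r1" by (rule free_turn[OF g2(10) s2(2) g2(7) \<sigma>r(2,1) g1(7)[symmetric] P'(3,1,5) g1(12) \<sigma>(2) q(2) na(4,3)])
  have y3: "\<not> adj y3 r1" by (rule free_turn[OF g3(5) s2(4) g3(2) \<sigma>r(4,3) g1(7)[symmetric] P'(3,1,5) g1(12) \<sigma>(4) q(2) na(4,3)])
  have y3': "\<not> adj y3 r2" by (rule free_turn[OF g3(5) s2(4) g3(2) \<sigma>r(6,5) g2(3)[symmetric] P'(4,2,6) g2(10) \<sigma>(6) q(2) na(8,7)])
  show False
  proof (rule long_spiders_no_chain[of x1 r1 s1 y1 x2 r2 s2 y2 x3 r3 s3 y3 a d])
    show "\<forall>v\<in>{x1, s1, y1}. \<not> adj x2 v" using nx2[OF \<sigma>(1)] nx2[OF \<sigma>(2)] q x2 by simp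
    show "\<forall>v\<in>{x1, y1, s1, s2, y2}. \<not> adj x3 v"
      using nx3[OF \<sigma>(3)] nx3[OF \<sigma>(4)] nx3[OF \<sigma>(6)] q x3 x3' by simp
    show "\<forall>v\<in>{y1, r1, x1}. \<not> adj y2 v" using ny2[OF \<sigma>(1)] ny2[OF \<sigma>(2)] q y2 by simp
    show "\<forall>v\<in>{y1, x1, r1, r2, x2}. \<not> adj y3 v"
      using ny3[OF \<sigma>(3)] ny3[OF \<sigma>(4)] ny3[OF \<sigma>(5)] q y3 y3' by simp
    show "\<forall>u\<in>{r2, s2}. \<forall>v\<in>{x1, r1, s1, y1}. \<not> adj u v"
      using later1[OF le1 g2(11,13)] later1[OF le1 g2(12,14)] by simp
    show "\<forall>u\<in>{r3, s3}. \<forall>v\<in>{x1, r1, s1, y1, x2, r2, s2, y2}. \<not> adj u v"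
      using later1[OF sub g3(6,8)] later1[OF sub g3(7,9)] later2[OF le2 g3(6,8)] later2[OF le2 g3(7,9)] by simp
    show "adj x3 r3" "adj s3 y3" using g3(3) unfolding P4_def by simp_all
  qed (use g1 g2 g3 in auto)
qed

end

section \<open>A gadget-free position\<close>

context strat
begin

text \<open>The three clauses after \<open>P4_free\<close> say that no gadget of the three kinds occurs; the 20 pebbles left suffice
  for all later arguments.\<close>

definition good :: "'a set \<Rightarrow> ('a \<rightharpoonup> col) \<Rightarrow> bool" where
  "good S \<sigma> \<longleftrightarrow> S \<subseteq> dom \<sigma> \<and> \<sigma> \<in> H \<and> card (dom \<sigma>) + 20 \<le> k \<and> P4_free (R S) \<and>
     (\<forall>a x r s u \<tau> c. a \<in> S \<and> adj x a \<and> card (L \<sigma> x) = 2 \<and> {r, s, u} \<subseteq> R S \<and> P4 x r s u \<and> \<tau> \<in> H \<and> \<sigma> \<subseteq>\<^sub>m \<tau> \<and>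
        \<tau> r = Some c \<and> \<tau> u = Some c \<longrightarrow> \<sigma> a = Some c) \<and>
     (\<forall>x y r. r \<in> R S \<and> card (L \<sigma> r) = 3 \<and> x \<in> X S \<and> y \<in> X S \<and> adj r x \<and> adj r y \<and> card (L \<sigma> x) = 2 \<and>
        card (L \<sigma> y) = 2 \<and> L \<sigma> x \<noteq> L \<sigma> y \<longrightarrow> adj x y) \<and>
     (\<forall>x y r s q \<tau>. r \<in> U S \<sigma> \<and> s \<in> U S \<sigma> \<and> x \<in> X S \<and> y \<in> X S \<and> P4 x r s y \<and> card (L \<sigma> x) = 2 \<and>
        card (L \<sigma> y) = 2 \<and> q \<in> L \<sigma> r \<and> q \<in> L \<sigma> s \<and> \<tau> \<in> H \<and> \<sigma> \<subseteq>\<^sub>m \<tau> \<and> \<tau> x = Some q \<longrightarrow> \<tau> y \<noteq> Some q)"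

text \<open>The component of \<open>r\<close> is connected with at least two vertices, so
  \<open>cograph_split\<close> presents it as a join. One vertex from each side then dominates
  it.\<close>

lemma dominating_pair:
  assumes P: "P4_free (R S)" and r: "r \<in> R S" and s: "s \<in> R S" and rs: "adj r s"
  obtains p1 p2 where "p1 \<in> V" "p2 \<in> V" "\<forall>v. (r, v) \<in> link S \<longrightarrow> adj v p1 \<or> adj v p2"
proof -
  define K where "K = {v. (r, v) \<in> link S}"
  have KR: "K \<subseteq> R S" using link_R[OF _ r] unfolding K_def by auto
  have RV: "R S \<subseteq> V" unfolding R_def by blast
  have fin: "finite K" using finite_subset[OF _ finV, of K] KR RV by blast
  have "r \<in> K" "s \<in> K" using link_refl link_adj[OF r s rs] unfolding K_def by simp_all
  moreover have "r \<noteq> s" using rs adj_irrefl by blast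
  ultimately have "card K \<ge> 2" using card_mono[OF fin, of "{r, s}"] by simp
  then obtain A B where AB: "A \<noteq> {}" "B \<noteq> {}" "A \<inter> B = {}" "A \<union> B = K" "complete_to A B \<or> anticomplete A B"
    using cograph_split[OF fin _ P4_free_subset[OF P KR]] by blast
  have stay: "K \<subseteq> C" if "r \<in> C" "\<forall>u\<in>C. \<forall>v\<in>K - C. \<not> adj u v" for C
  proof
    fix v assume "v \<in> K"
    then have "(r, v) \<in> {(u, v). u \<in> R S \<and> v \<in> R S \<and> adj u v}\<^sup>*" unfolding K_def link_def by simp
    then show "v \<in> C"
    proof (induction rule: rtrancl_induct)
      case base
      then show ?case using that by simp
    next
      case (step y z)
      then have "(r, z) \<in> link S" unfolding link_def by (metis (no_types, lifting) rtrancl.rtrancl_into_rtrancl)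
      then have "z \<in> K" unfolding K_def by simp
      then show ?case using that(2) step by blast
    qed
  qed
  have "\<not> anticomplete A B"
  proof
    assume ac: "anticomplete A B"
    show False
    proof (cases "r \<in> A")
      case True
      then have "K \<subseteq> A" using ac AB(4) by (intro stay) (auto simp: anticomplete_def)
      then show False using AB by blast
    next
      case False
      then have "r \<in> B" using \<open>r \<in> K\<close> AB(4) by blast
      moreover have "\<not> adj u v" if "u \<in> B" "v \<in> K - B" for u v
        using that ac AB(4) adj_sym unfolding anticomplete_def by blast
      ultimately have "K \<subseteq> B" by (intro stay) auto
      then show False using AB by blast
    qed
  qed
  then have "complete_to A B" using AB(5) by blast
  moreover obtain p1 p2 where "p1 \<in> A" "p2 \<in> B" using AB by blast
  moreover have "p1 \<in> V" "p2 \<in> V" using calculation AB(4) KR RV by blast+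
  ultimately show thesis
    using that[of p1 p2] AB(4) adj_sym unfolding complete_to_def K_def by blast
qed

lemma X_free_D:
  assumes "x \<in> X S" "S \<subseteq> dom \<sigma>"
  obtains a t where "a \<in> S" "adj x a" "\<sigma> a = Some t" "card (L \<sigma> x) = 2 \<Longrightarrow> L \<sigma> x = - {t}"
proof -
  obtain a where a: "a \<in> S" "adj x a" using assms(1) unfolding X_def by blast
  moreover obtain t where "\<sigma> a = Some t" using a(1) assms(2) by blast
  ultimately show thesis using that[of a t] L_free[of x a \<sigma> t] by blast
qed

text \<open>Membership in \<open>H\<close> is built into the order, since
  \<open>gadget_free_extension\<close> knows only an order and a size.\<close>

definition le where
  "le \<sigma> \<tau> \<longleftrightarrow> \<sigma> \<subseteq>\<^sub>m \<tau> \<and> (\<sigma> \<in> H \<longrightarrow> \<tau> \<in> H)" for \<sigma> \<tau> :: "'a \<rightharpoonup> col"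

lemma le_refl: "le \<sigma> \<sigma>"
  unfolding le_def by simp

lemma le_trans: "le \<sigma> \<tau> \<Longrightarrow> le \<tau> \<rho> \<Longrightarrow> le \<sigma> \<rho>"
  unfolding le_def using map_le_trans by blast

lemma card_insert_bounds:
  "card (A \<union> {x, y, z}) \<le> card A + 3" "card (A \<union> {x, y, z, w}) \<le> card A + 4"
  "card (A \<union> {x, y, z, w, p, q}) \<le> card A + 6"
  by (rule order_trans[OF card_Un_le], simp add: card_insert_if)+

text \<open>Of \<open>\<tau>\<close> only \<open>\<sigma>\<close> and the values on \<open>D\<close>
  are kept before \<open>T\<close> is coloured, so the number of pebbles needed does not depend on
  the size of \<open>\<tau>\<close>.\<close>

lemma H_reextend:
  assumes "\<tau> \<in> H" "\<sigma> \<subseteq>\<^sub>m \<tau>" "D \<subseteq> dom \<tau>" "finite D" "finite T" "T \<subseteq> V" "card (dom \<sigma>) + card D + card T \<le> k"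
  obtains \<rho> where "\<rho> \<in> H" "\<sigma> \<subseteq>\<^sub>m \<rho>" "dom \<rho> = dom \<sigma> \<union> D \<union> T" "\<And>v. v \<in> D \<Longrightarrow> \<rho> v = \<tau> v"
proof -
  obtain \<tau>' where t: "\<tau>' \<in> H" "\<sigma> \<subseteq>\<^sub>m \<tau>'" "\<tau>' \<subseteq>\<^sub>m \<tau>" "dom \<tau>' = dom \<sigma> \<union> D"
    using H_restrict[OF assms(1-3)] by blast
  have "card (dom \<tau>') + card T \<le> k" using assms(7) card_Un_le[of "dom \<sigma>" D] unfolding t(4) by linarith
  then obtain \<rho> where r: "\<rho> \<in> H" "\<tau>' \<subseteq>\<^sub>m \<rho>" "dom \<rho> = dom \<tau>' \<union> T"
    using H_extend[OF assms(5) t(1) assms(6)] by blast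
  have "\<rho> v = \<tau> v" if "v \<in> D" for v
    using that t(3,4) r(2) unfolding map_le_def by auto
  moreover have "\<sigma> \<subseteq>\<^sub>m \<rho>" by (rule map_le_trans[OF t(2) r(2)])
  ultimately show thesis using that r t(4) by blast
qed

lemma P4_V: "P4 a b c d \<Longrightarrow> {a, b, c, d} \<subseteq> V"
  unfolding P4_def using adj_V adj_V2 by blast

text \<open>Only the four vertices of the given path serve as labels, which bounds the number of
  gadgets in advance. As this path is coloured, the uncoloured vertices without coloured neighbours
  are anticomplete to it and contain no second \<open>P4\<close>.\<close>

lemma phase1:
  assumes Q: "P4 a b c d" and k: "k \<ge> 100"
  obtains \<sigma> where "\<sigma> \<in> H" "card (dom \<sigma>) \<le> 52" "P4_free (R (dom \<sigma>))"
    "\<And>a x r s u \<tau> c. a \<in> dom \<sigma> \<Longrightarrow> adj x a \<Longrightarrow> card (L \<sigma> x) = 2 \<Longrightarrow> {r, s, u} \<subseteq> R (dom \<sigma>) \<Longrightarrow> P4 x r s u \<Longrightarrow> \<tau> \<in> H \<Longrightarrow>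
      \<sigma> \<subseteq>\<^sub>m \<tau> \<Longrightarrow> \<tau> r = Some c \<Longrightarrow> \<tau> u = Some c \<Longrightarrow> \<sigma> a = Some c"
proof -
  let ?Q = "{a, b, c, d}"
  have QV: "?Q \<subseteq> V" by (rule P4_V[OF Q])
  have c4: "card ?Q \<le> 4" using card_insert_bounds(2)[of "{}" a b c d] by simp
  have "\<exists>\<rho>\<in>H. Map.empty \<subseteq>\<^sub>m \<rho> \<and> dom \<rho> = dom (Map.empty :: 'a \<rightharpoonup> col) \<union> ?Q"
    using QV c4 k by (intro H_extend H_empty) auto
  then obtain \<sigma>0 where s0: "\<sigma>0 \<in> H" "dom \<sigma>0 = ?Q" by auto
  have "\<exists>t. le \<sigma>0 t \<and> card (dom t) \<le> card (dom \<sigma>0) + 4 * (3 * card ?Q) \<and> (\<forall>l\<in>?Q. \<forall>u. \<not> gadA l t u)"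
  proof (rule gadget_free_extension[of ?Q le gadA "\<lambda>t. card (dom t)" 4])
    show "le s t" if "gadA l s t" for l s t
      using that unfolding gadA_def gadA_at_def le_def by blast
    show "card (dom t) \<le> card (dom s) + 4" if "gadA l s t" for l s t
      using that card_insert_bounds(2) unfolding gadA_def gadA_at_def by (auto simp del: Un_insert_right)
    show False if "gadA l s s'" "le s' t" "gadA l t t'" "le t' u" "gadA l u u'" for l s s' t t' u u'
      using gadA_no_chain[OF that(1) _ that(3)] that(2) unfolding le_def by blast
  qed (use le_refl le_trans in auto)
  then obtain \<sigma> where s: "le \<sigma>0 \<sigma>" "card (dom \<sigma>) \<le> card (dom \<sigma>0) + 4 * (3 * card ?Q)"
    "\<And>l u. l \<in> ?Q \<Longrightarrow> \<not> gadA l \<sigma> u" by blast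
  have le0: "\<sigma>0 \<subseteq>\<^sub>m \<sigma>" and sH: "\<sigma> \<in> H" using s(1) s0(1) unfolding le_def by auto
  \<comment> \<open>4 pebbles for the path and 4 for each of 3 gadgets per label: 4 + 4 * (3 * 4) =
    52.\<close>
  have card: "card (dom \<sigma>) \<le> 52" using s(2) s0(2) c4 by simp
  have Qs: "?Q \<subseteq> dom \<sigma>" using map_le_implies_dom_le[OF le0] s0(2) by simp
  show thesis
  proof (rule that[OF sH card])
    show "P4_free (R (dom \<sigma>))" unfolding P4_free_def
    proof (intro ballI notI)
      fix p q r s assume R: "p \<in> R (dom \<sigma>)" "q \<in> R (dom \<sigma>)" "r \<in> R (dom \<sigma>)" "s \<in> R (dom \<sigma>)" and P: "P4 p q r s"
      have "anticomplete ?Q {p, q, r, s}"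
        using R_nonadj[of _ "dom \<sigma>"] R Qs unfolding anticomplete_def by blast
      then show False using two_P4_free Q P by blast
    qed
    fix a' x r s u \<tau> col
    assume a': "a' \<in> dom \<sigma>" "adj x a'" and x2: "card (L \<sigma> x) = 2" and R: "{r, s, u} \<subseteq> R (dom \<sigma>)" and P: "P4 x r s u"
      and t: "\<tau> \<in> H" "\<sigma> \<subseteq>\<^sub>m \<tau>" "\<tau> r = Some col" "\<tau> u = Some col"
    \<comment> \<open>The rule is wanted for every coloured neighbour \<open>a'\<close> of
      \<open>x\<close>, but labels lie in \<open>?Q\<close>. By \<open>two_P4_free\<close>,
      \<open>x\<close> has a neighbour there too, and a free vertex sees only one colour.\<close>
    have "\<exists>l\<in>?Q. adj x l"
    proof (rule ccontr)
      assume n: "\<not> (\<exists>l\<in>?Q. adj x l)"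
      have "\<not> adj v w" if "v \<in> ?Q" "w \<in> {x, r, s, u}" for v w
        using R_nonadj[of w "dom \<sigma>" v] R Qs n that adj_sym by blast
      then have "anticomplete ?Q {x, r, s, u}" unfolding anticomplete_def by blast
      then show False using two_P4_free Q P by blast
    qed
    then obtain l where l: "l \<in> ?Q" "adj x l" by blast
    obtain t' where t': "\<sigma> a' = Some t'" using a'(1) by blast
    obtain tl where tl: "\<sigma> l = Some tl" using l(1) Qs by blast
    have eq: "tl = t'" by (rule L_free_mono[OF l(2) a'(2) tl t' x2])
    show "\<sigma> a' = Some col"
    proof (rule ccontr)
      assume "\<sigma> a' \<noteq> Some col"
      then have ne: "col \<noteq> tl" using eq t' by simp
      have V: "{x, r, s, u} \<subseteq> V" by (rule P4_V[OF P])
      have "card {r, u} \<le> 2" "card {x, s} \<le> 2" by (simp_all add: card_insert_if)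
      then have "card (dom \<sigma>) + card {r, u} + card {x, s} \<le> k" using card k by linarith
      moreover have "{r, u} \<subseteq> dom \<tau>" "{x, s} \<subseteq> V" using t V by auto
      ultimately obtain \<rho> where r: "\<rho> \<in> H" "\<sigma> \<subseteq>\<^sub>m \<rho>" "dom \<rho> = dom \<sigma> \<union> {r, u} \<union> {x, s}" "\<And>v. v \<in> {r, u} \<Longrightarrow> \<rho> v = \<tau> v"
        using H_reextend[OF t(1,2), of "{r, u}" "{x, s}"] by auto
      have "gadA_at l \<sigma> \<rho> x r s u col tl"
        using r(1-3) r(4)[of r] r(4)[of u] tl l(2) x2 R P t(3,4) ne unfolding gadA_at_def by auto
      then show False using s(3)[OF l(1)] unfolding gadA_def by blast
    qed
  qed
qed

lemma gad_case_le: "case_sum (gad1 S) (gad2 S) l \<sigma> \<tau> \<Longrightarrow> le \<sigma> \<tau>"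
  unfolding le_def
  by (auto simp: gad1_def gad1_at_def gad2_def gad2_at_def split: sum.splits prod.splits)

lemma gad_case_card: "case_sum (gad1 S) (gad2 S) l \<sigma> \<tau> \<Longrightarrow> card (dom \<tau>) \<le> card (dom \<sigma>) + 6"
proof (cases l)
  case (Inl p)
  assume "case_sum (gad1 S) (gad2 S) l \<sigma> \<tau>"
  with Inl obtain x y r where "dom \<tau> = dom \<sigma> \<union> {x, r, y}"
    unfolding gad1_def gad1_at_def by (auto split: prod.splits)
  then show ?thesis using card_insert_bounds(1)[of "dom \<sigma>" x r y] by simp
next
  case (Inr p)
  assume "case_sum (gad1 S) (gad2 S) l \<sigma> \<tau>"
  with Inr obtain x y r s p q where "dom \<tau> = dom \<sigma> \<union> {x, y, r, s, p, q}"
    unfolding gad2_def gad2_at_def by (auto split: prod.splits)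
  then show ?thesis using card_insert_bounds(3)[of "dom \<sigma>" x y r s p q] by simp
qed

text \<open>The set \<open>S\<close> is frozen after the first round, so its pairs, with or without
  a colour, give a bounded number of labels for the second. If there is no \<open>P4\<close> at all,
  the empty position will do.\<close>

lemma good_exists:
  assumes k: "k \<ge> 200000"
  obtains S \<sigma> where "good S \<sigma>"
proof (cases "\<exists>a b c d. P4 a b c d")
  case False
  have "good {} Map.empty"
    unfolding good_def P4_free_def using False k H_empty by (simp add: X_def)
  then show thesis by (rule that)
next
  case True
  then obtain a b c d where Q: "P4 a b c d" by blast
  have "k \<ge> 100" using k by simp
  then obtain \<sigma>1 where s1: "\<sigma>1 \<in> H" "card (dom \<sigma>1) \<le> 52" "P4_free (R (dom \<sigma>1))"
    and A: "\<And>a x r s u \<tau> c. a \<in> dom \<sigma>1 \<Longrightarrow> adj x a \<Longrightarrow> card (L \<sigma>1 x) = 2 \<Longrightarrow> {r, s, u} \<subseteq> R (dom \<sigma>1) \<Longrightarrow> P4 x r s u \<Longrightarrow> \<tau> \<in> H \<Longrightarrow>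
      \<sigma>1 \<subseteq>\<^sub>m \<tau> \<Longrightarrow> \<tau> r = Some c \<Longrightarrow> \<tau> u = Some c \<Longrightarrow> \<sigma>1 a = Some c"
    using phase1[OF Q] by blast
  define S where "S = dom \<sigma>1"
  let ?gad = "case_sum (gad1 S) (gad2 S)"
  let ?\<Lambda> = "(S \<times> S) <+> (S \<times> S \<times> (UNIV :: col set))"
  have finS: "finite S" unfolding S_def by (rule H_fin[OF s1(1)])
  have cS: "card S * card S \<le> 52 * 52" using s1(2) unfolding S_def by (intro mult_le_mono)
  have c\<Lambda>: "card ?\<Lambda> = 4 * (card S * card S)" using finS by (simp add: card_Plus card_cartesian_product)
  have "\<exists>t. le \<sigma>1 t \<and> card (dom t) \<le> card (dom \<sigma>1) + 6 * (3 * card ?\<Lambda>) \<and> (\<forall>l\<in>?\<Lambda>. \<forall>u. \<not> ?gad l t u)"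
  proof (rule gadget_free_extension[of ?\<Lambda> le ?gad "\<lambda>t. card (dom t)" 6])
    show "finite ?\<Lambda>" using finS by simp
    show False if "?gad l s s'" "le s' t" "?gad l t t'" "le t' u" "?gad l u u'" for l s s' t t' u u'
      using that gad1_no_chain[of S _ s s' t t' u u'] gad2_no_chain[of S _ s s' t t' u u'] unfolding le_def
      by (cases l) simp_all
  qed (use le_refl le_trans gad_case_le gad_case_card in auto)
  then obtain \<sigma> where s: "le \<sigma>1 \<sigma>" "card (dom \<sigma>) \<le> card (dom \<sigma>1) + 6 * (3 * card ?\<Lambda>)"
    and no: "\<And>l u. l \<in> ?\<Lambda> \<Longrightarrow> \<not> ?gad l \<sigma> u" by blast
  have le1: "\<sigma>1 \<subseteq>\<^sub>m \<sigma>" and sH: "\<sigma> \<in> H" using s(1) s1(1) unfolding le_def by auto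
  have SD: "S \<subseteq> dom \<sigma>" using map_le_implies_dom_le[OF le1] unfolding S_def .
  \<comment> \<open>4 * 52 * 52 labels, 3 gadgets per label, 6 pebbles per gadget. Adding 52 for the
    first round and the spare 20 stays below 200000.\<close>
  have "6 * (3 * card ?\<Lambda>) \<le> 194688" using cS unfolding c\<Lambda> by simp
  then have room: "card (dom \<sigma>) + 20 \<le> k" using s(2) s1(2) k by linarith
  have XV: "X S \<subseteq> V" "R S \<subseteq> V" unfolding X_def R_def by blast+
  have "good S \<sigma>"
    unfolding good_def
  proof (intro conjI allI impI; (elim conjE)?)
    show "P4_free (R S)" using s1(3) unfolding S_def .
  next
    fix a x r s u \<tau> c
    assume h: "a \<in> S" "adj x a" "card (L \<sigma> x) = 2" "{r, s, u} \<subseteq> R S" "P4 x r s u" "\<tau> \<in> H" "\<sigma> \<subseteq>\<^sub>m \<tau>"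
      "\<tau> r = Some c" "\<tau> u = Some c"
    obtain t where t: "\<sigma>1 a = Some t" using h(1) unfolding S_def by blast
    \<comment> \<open>The rule of the first round speaks of lists at \<open>\<sigma>1\<close>. A
      list with two colours at \<open>\<sigma>\<close> had two there as well, because the neighbour
      \<open>a\<close> had already removed one.\<close>
    have "t \<notin> L \<sigma>1 x" by (rule L_adj[of x a \<sigma>1 t]) fact+
    then have "card (L \<sigma>1 x) \<noteq> 3" using card_subset_eq[of UNIV "L \<sigma>1 x"] by auto
    moreover have "card (L \<sigma>1 x) \<le> 3" using card_mono[of UNIV "L \<sigma>1 x"] by simp
    moreover have "2 \<le> card (L \<sigma>1 x)" using card_mono[OF _ L_mono[OF le1, of x]] h(3) by simp
    ultimately have "card (L \<sigma>1 x) = 2" by linarith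
    then have "\<sigma>1 a = Some c"
      using A[of a x r s u \<tau> c] h map_le_trans[OF le1 h(7)] unfolding S_def by simp
    then show "\<sigma> a = Some c" by (rule map_leD[OF le1])
  next
    fix x y r
    assume h: "r \<in> R S" "card (L \<sigma> r) = 3" "x \<in> X S" "y \<in> X S" "adj r x" "adj r y" "card (L \<sigma> x) = 2"
        "card (L \<sigma> y) = 2" "L \<sigma> x \<noteq> L \<sigma> y"
    show "adj x y"
    proof (rule ccontr)
      assume nxy: "\<not> adj x y"
      obtain a s where a: "a \<in> S" "adj x a" "\<sigma> a = Some s" "L \<sigma> x = - {s}"
        using X_free_D[OF h(3) SD] h(7) by metis
      obtain d t where d: "d \<in> S" "adj y d" "\<sigma> d = Some t" "L \<sigma> y = - {t}"
        using X_free_D[OF h(4) SD] h(8) by metis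
      have "{x, r, y} \<subseteq> V" using h(1,3,4) XV by blast
      moreover have "card {x, r, y} \<le> 3" by (simp add: card_insert_if)
      ultimately obtain \<tau> where t: "\<tau> \<in> H" "\<sigma> \<subseteq>\<^sub>m \<tau>" "dom \<tau> = dom \<sigma> \<union> {x, r, y}"
        using H_extend[of "{x, r, y}" \<sigma>] sH room by auto
      have "gad1_at S a d \<sigma> \<tau> x y r s t"
        unfolding gad1_at_def using h a d t SD nxy by auto
      then have "?gad (Inl (a, d)) \<sigma> \<tau>" unfolding gad1_def sum.case prod.case by blast
      then show False using no[of "Inl (a, d)"] a(1) d(1) by blast
    qed
  next
    fix x y r s q \<tau>
    assume h: "r \<in> U S \<sigma>" "s \<in> U S \<sigma>" "x \<in> X S" "y \<in> X S" "P4 x r s y" "card (L \<sigma> x) = 2"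
      "card (L \<sigma> y) = 2" "q \<in> L \<sigma> r" "q \<in> L \<sigma> s" "\<tau> \<in> H" "\<sigma> \<subseteq>\<^sub>m \<tau>" "\<tau> x = Some q"
    show "\<tau> y \<noteq> Some q"
    proof
      assume y: "\<tau> y = Some q"
      obtain a ta where a: "a \<in> S" "adj x a" using h(3) unfolding X_def by blast
      obtain d td where d: "d \<in> S" "adj y d" using h(4) unfolding X_def by blast
      have rs: "r \<in> R S" "s \<in> R S" "adj r s" using h(1,2,5) unfolding U_def P4_def by simp_all
      obtain p1 p2 where p: "p1 \<in> V" "p2 \<in> V" "\<forall>v. (r, v) \<in> link S \<longrightarrow> adj v p1 \<or> adj v p2"
        using dominating_pair[OF _ rs] s1(3) unfolding S_def by blast
      have "{r, s, p1, p2} \<subseteq> V" "{x, y} \<subseteq> dom \<tau>" using rs XV p h(12) y by auto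
      moreover have "card {r, s, p1, p2} \<le> 4" "card {x, y} \<le> 2" by (simp_all add: card_insert_if)
      moreover from this have "card (dom \<sigma>) + card {x, y} + card {r, s, p1, p2} \<le> k" using room by linarith
      ultimately obtain \<rho> where r: "\<rho> \<in> H" "\<sigma> \<subseteq>\<^sub>m \<rho>" "dom \<rho> = dom \<sigma> \<union> {x, y} \<union> {r, s, p1, p2}" "\<And>v. v \<in> {x, y} \<Longrightarrow> \<rho> v = \<tau> v"
        using H_reextend[OF h(10,11), of "{x, y}" "{r, s, p1, p2}"] by auto
      have "gad2_at S a d q \<sigma> \<rho> x y r s p1 p2"
        unfolding gad2_at_def using h a d r SD p y by auto
      then have "?gad (Inr (a, d, q)) \<sigma> \<rho>" unfolding gad2_def sum.case prod.case by blast
      then show False using no[of "Inr (a, d, q)"] a(1) d(1) by blast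
    qed
  qed (use SD sH room in auto)
  then show thesis by (rule that)
qed

end

section \<open>Excluded colours\<close>

lemma col_neq3: "\<lbrakk>c \<noteq> p; c \<noteq> q; p \<noteq> q; d \<noteq> p; d \<noteq> q\<rbrakk> \<Longrightarrow> (c :: col) = d"
  by (cases c; cases d; cases p; cases q) auto

lemma other_cols: "\<exists>p q::col. p \<noteq> q \<and> p \<noteq> c \<and> q \<noteq> c \<and> - {c} = {p, q}"
proof -
  have "- {Red} = {Green, Blue}" "- {Green} = {Red, Blue}" "- {Blue} = {Red, Green}"
    using col_UNIV by auto
  then show ?thesis by (cases c) (metis col.distinct)+
qed

context strat
begin

text \<open>Subsets of a two-element set have the Helly property: if every two of the colour sets allowed at \<open>w\<close> by
  the vertices fixed so far meet, they all do.\<close>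

lemma pairwise_consistent:
  assumes "finite C" "\<sigma> \<in> H" "card (dom \<sigma>) + 3 \<le> k" "C \<subseteq> V" "\<And>u. u \<in> C \<Longrightarrow> card (L \<sigma> u) \<le> 2"
  shows "\<exists>f. \<forall>u\<in>C. \<forall>v\<in>C. \<exists>\<tau>\<in>H. \<sigma> \<subseteq>\<^sub>m \<tau> \<and> \<tau> u = Some (f u) \<and> \<tau> v = Some (f v)"
  using assms
proof (induction C rule: finite_induct)
  case empty
  then show ?case by simp
next
  case (insert w C)
  define R2 where "R2 u a v b \<longleftrightarrow> (\<exists>\<tau>\<in>H. \<sigma> \<subseteq>\<^sub>m \<tau> \<and> \<tau> u = Some a \<and> \<tau> v = Some b)" for u v a b
  have R2_sym: "R2 u a v b \<Longrightarrow> R2 v b u a" for u v a b unfolding R2_def by blast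
  obtain f where f: "\<And>u v. u \<in> C \<Longrightarrow> v \<in> C \<Longrightarrow> R2 u (f u) v (f v)"
  proof -
    have "\<exists>f. \<forall>u\<in>C. \<forall>v\<in>C. \<exists>\<tau>\<in>H. \<sigma> \<subseteq>\<^sub>m \<tau> \<and> \<tau> u = Some (f u) \<and> \<tau> v = Some (f v)"
      by (rule insert.IH) (use insert.prems in auto)
    then obtain f where "\<forall>u\<in>C. \<forall>v\<in>C. R2 u (f u) v (f v)" unfolding R2_def by blast
    then show thesis using that by blast
  qed
  have wV: "w \<in> V" using insert.prems by blast
  \<comment> \<open>A third pebble extends a consistent pair to \<open>w\<close>; hence the 3 in the
    assumption on \<open>k\<close>.\<close>
  have join: "\<exists>c. R2 u (f u) w c \<and> R2 v (f v) w c" if uv: "u \<in> C" "v \<in> C" for u v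
  proof -
    obtain \<tau> where t: "\<tau> \<in> H" "\<sigma> \<subseteq>\<^sub>m \<tau>" "\<tau> u = Some (f u)" "\<tau> v = Some (f v)" using f[OF uv] unfolding R2_def by blast
    have "card {u, v} \<le> 2" by (simp add: card_insert_if)
    then obtain \<rho> where r: "\<rho> \<in> H" "\<sigma> \<subseteq>\<^sub>m \<rho>" "dom \<rho> = dom \<sigma> \<union> {u, v} \<union> {w}" "\<And>x. x \<in> {u, v} \<Longrightarrow> \<rho> x = \<tau> x"
      using H_reextend[OF t(1,2), of "{u, v}" "{w}"] t(3,4) wV insert.prems(2) by auto
    then obtain c where "\<rho> w = Some c" by blast
    then show ?thesis using r t unfolding R2_def by (metis insertI1 insertI2)
  qed
  have RL: "R2 u a w c \<Longrightarrow> c \<in> L \<sigma> w" for u a c unfolding R2_def L_def by blast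
  have "\<exists>c. c \<in> L \<sigma> w \<and> (\<forall>u\<in>C. R2 u (f u) w c)"
  proof -
    obtain c0 where c0: "c0 \<in> L \<sigma> w" using L_nonempty[OF insert.prems(1) wV] insert.prems(2) by auto
    show ?thesis
    proof (cases "\<forall>u\<in>C. R2 u (f u) w c0")
      case True
      then show ?thesis using c0 by blast
    next
      case False
      then obtain u0 where u0: "u0 \<in> C" "\<not> R2 u0 (f u0) w c0" by blast
      obtain c1 where c1: "R2 u0 (f u0) w c1" using join[OF u0(1) u0(1)] by blast
      \<comment> \<open>Since \<open>u0\<close> forbids \<open>c0\<close>, it leaves only
        \<open>c1\<close> of the at most two colours in the list of \<open>w\<close>; as every
        \<open>u\<close> has a common colour with \<open>u0\<close>, all of them allow
        \<open>c1\<close>.\<close>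
      have only: "c = c1" if "R2 u0 (f u0) w c" for c
      proof (rule ccontr)
        assume "c \<noteq> c1"
        moreover have "{c0, c1, c} \<subseteq> L \<sigma> w" using c0 RL c1 that by blast
        moreover have "c0 \<noteq> c1" "c0 \<noteq> c" using u0 c1 that by blast+
        ultimately have "3 \<le> card (L \<sigma> w)" using card_mono[of "L \<sigma> w" "{c0, c1, c}"] by simp
        then show False using insert.prems(4)[of w] by simp
      qed
      have "R2 u (f u) w c1" if "u \<in> C" for u
        using join[OF that u0(1)] only by blast
      then show ?thesis using RL[OF c1] by blast
    qed
  qed
  then obtain c where c: "c \<in> L \<sigma> w" "\<And>u. u \<in> C \<Longrightarrow> R2 u (f u) w c" by blast
  have ww: "R2 w c w c" using c(1) unfolding R2_def L_def by blast
  have "R2 u ((f(w := c)) u) v ((f(w := c)) v)" if "u \<in> insert w C" "v \<in> insert w C" for u v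
    using that f c(2) ww R2_sym insert.hyps(2) by (cases "u = w"; cases "v = w") auto
  then show ?case unfolding R2_def by blast
qed

end

locale ext = strat +
  fixes S :: "'a set" and \<sigma> :: "'a \<rightharpoonup> col" and f :: "'a \<Rightarrow> col"
  assumes good: "good S \<sigma>"
    and pair: "\<lbrakk>u \<in> V; v \<in> V; card (L \<sigma> u) \<le> 2; card (L \<sigma> v) \<le> 2\<rbrakk> \<Longrightarrow>
      \<exists>\<tau>\<in>H. \<sigma> \<subseteq>\<^sub>m \<tau> \<and> \<tau> u = Some (f u) \<and> \<tau> v = Some (f v)"
begin

lemma good_state: "S \<subseteq> dom \<sigma>" "\<sigma> \<in> H" "card (dom \<sigma>) + 20 \<le> k" "P4_free (R S)"
  using good unfolding good_def by simp_all

lemma path_rule: "\<lbrakk>a \<in> S; adj x a; card (L \<sigma> x) = 2; {r, s, u} \<subseteq> R S; P4 x r s u; \<tau> \<in> H; \<sigma> \<subseteq>\<^sub>m \<tau>;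
    \<tau> r = Some c; \<tau> u = Some c\<rbrakk> \<Longrightarrow> \<sigma> a = Some c"
  by (rule good[unfolded good_def, THEN conjunct2, THEN conjunct2, THEN conjunct2, THEN conjunct2, THEN conjunct1,
    rule_format, of a x r s u \<tau> c]; intro conjI; assumption)

lemma type_rule: "\<lbrakk>r \<in> R S; card (L \<sigma> r) = 3; x \<in> X S; y \<in> X S; adj r x; adj r y; card (L \<sigma> x) = 2;
    card (L \<sigma> y) = 2; L \<sigma> x \<noteq> L \<sigma> y\<rbrakk> \<Longrightarrow> adj x y"
  by (rule good[unfolded good_def, THEN conjunct2, THEN conjunct2, THEN conjunct2, THEN conjunct2, THEN conjunct2, THEN conjunct1,
    rule_format, of r x y]; intro conjI; assumption)

lemma edge_rule: "\<lbrakk>r \<in> U S \<sigma>; s \<in> U S \<sigma>; x \<in> X S; y \<in> X S; P4 x r s y; card (L \<sigma> x) = 2;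
    card (L \<sigma> y) = 2; q \<in> L \<sigma> r; q \<in> L \<sigma> s; \<tau> \<in> H; \<sigma> \<subseteq>\<^sub>m \<tau>; \<tau> x = Some q\<rbrakk> \<Longrightarrow> \<tau> y \<noteq> Some q"
  by (rule good[unfolded good_def, THEN conjunct2, THEN conjunct2, THEN conjunct2, THEN conjunct2, THEN conjunct2, THEN conjunct2,
    rule_format, of r s x y q \<tau>]; intro conjI; assumption)

abbreviation W :: "'a set" where "W \<equiv> U S \<sigma>"

lemma W_R: "r \<in> W \<Longrightarrow> r \<in> R S"
  unfolding U_def by simp

lemma R_V: "r \<in> R S \<Longrightarrow> r \<in> V"
  unfolding R_def by simp

lemma W_V: "r \<in> W \<Longrightarrow> r \<in> V"
  using W_R R_V by blast

lemma X_V: "x \<in> X S \<Longrightarrow> x \<in> V"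
  unfolding X_def by simp

lemma X_card: "x \<in> X S \<Longrightarrow> card (L \<sigma> x) \<le> 2"
proof -
  assume "x \<in> X S"
  then obtain a where a: "a \<in> S" "adj x a" unfolding X_def by blast
  then obtain t where t: "\<sigma> a = Some t" using good_state(1) by blast
  have "L \<sigma> x \<subseteq> - {t}" using L_adj[of x a \<sigma> t, OF a(2) t] by simp
  moreover have "card (- {t}) = 2" by (cases t) (simp_all add: Compl_eq_Diff_UNIV col_UNIV insert_Diff_if)
  ultimately show ?thesis using card_mono[of "- {t}" "L \<sigma> x"] by simp
qed

lemma f_L: "u \<in> V \<Longrightarrow> card (L \<sigma> u) \<le> 2 \<Longrightarrow> f u \<in> L \<sigma> u"
  using pair[of u u] unfolding L_def by blast

text \<open>The colours excluded at \<open>r\<close> once the vertices with short lists are coloured by \<open>f\<close>.\<close>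

definition Ex :: "'a \<Rightarrow> col set" where
  "Ex r = - L \<sigma> r \<union> {f y | y. y \<in> X S \<and> adj y r}"

text \<open>If the list of \<open>y\<close> were just \<open>{f y}\<close>, a position giving
  \<open>r\<close> the colour \<open>f y\<close> could not be extended to \<open>y\<close>.\<close>

lemma witness_free:
  assumes y: "y \<in> X S" and adj: "adj y r" and c: "f y \<in> L \<sigma> r" and r: "r \<in> V"
  shows "card (L \<sigma> y) = 2"
proof (rule ccontr)
  assume n: "card (L \<sigma> y) \<noteq> 2"
  have fy: "f y \<in> L \<sigma> y" using f_L X_V X_card y by blast
  have "card (L \<sigma> y) \<le> 1" using n X_card[OF y] by linarith
  then have Ly: "L \<sigma> y = {f y}" using fy card_le_Suc0_iff_eq[of "L \<sigma> y"] by auto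
  obtain \<tau> where t: "\<tau> \<in> H" "\<sigma> \<subseteq>\<^sub>m \<tau>" "\<tau> r = Some (f y)" using c unfolding L_def by blast
  obtain \<rho> where r: "\<rho> \<in> H" "\<sigma> \<subseteq>\<^sub>m \<rho>" "dom \<rho> = dom \<sigma> \<union> {r} \<union> {y}" "\<And>v. v \<in> {r} \<Longrightarrow> \<rho> v = \<tau> v"
    using H_reextend[OF t(1,2), of "{r}" "{y}"] t(3) X_V[OF y] good_state(3) by auto
  then obtain c where c: "\<rho> y = Some c" by blast
  then have "c = f y" using L_I[OF r(1,2) c] Ly by simp
  then show False using H_proper[OF r(1) adj c] r(4)[of r] t(3) by simp
qed

text \<open>What every position of \<open>H\<close> above \<open>\<sigma>\<close> satisfies on its
  vertices, whether or not it agrees with \<open>f\<close>. The last clause is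
  \<open>path_rule\<close> expressed through \<open>Ex\<close>; that it needs no vertex fixed
  according to \<open>f\<close> is what makes the later contradictions affordable.\<close>

definition valid :: "('a \<Rightarrow> col) \<Rightarrow> 'a set \<Rightarrow> bool" where
  "valid g T \<longleftrightarrow> (\<forall>u\<in>T. \<forall>v\<in>T. adj u v \<longrightarrow> g u \<noteq> g v) \<and> (\<forall>v\<in>T. g v \<in> L \<sigma> v) \<and>
     (\<forall>r\<in>T \<inter> W. \<forall>s\<in>T \<inter> W. \<forall>u\<in>T \<inter> W. \<forall>c. adj r s \<and> adj s u \<and> \<not> adj r u \<and> c \<in> Ex r \<and> c \<notin> Ex s \<and> c \<notin> Ex u \<and>
        g r = c \<longrightarrow> g u \<noteq> c)"

lemma valid_neq: "valid g T \<Longrightarrow> adj u v \<Longrightarrow> u \<in> T \<Longrightarrow> v \<in> T \<Longrightarrow> g u \<noteq> g v"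
  unfolding valid_def by blast

lemma valid_L: "valid g T \<Longrightarrow> v \<in> T \<Longrightarrow> g v \<in> L \<sigma> v"
  unfolding valid_def by blast

lemma valid_path: "\<lbrakk>valid g T; {r, s, u} \<subseteq> T; {r, s, u} \<subseteq> W; adj r s; adj s u; \<not> adj r u; c \<in> Ex r; c \<notin> Ex s; c \<notin> Ex u; g r = c\<rbrakk>
    \<Longrightarrow> g u \<noteq> c"
  unfolding valid_def by blast

text \<open>For the last clause, a neighbour \<open>y\<close> of \<open>r\<close> in
  \<open>X S\<close> with \<open>f y = c\<close> is adjacent to neither \<open>s\<close> nor
  \<open>u\<close>. So \<open>P4 y r s u\<close> holds, and colour \<open>c\<close> at both
  \<open>r\<close> and \<open>u\<close> would make \<open>c\<close> the colour missing at
  \<open>y\<close>, contrary to \<open>f y = c\<close>.\<close>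

lemma valid_of:
  assumes t: "\<tau> \<in> H" "\<sigma> \<subseteq>\<^sub>m \<tau>" and T: "T \<subseteq> dom \<tau>"
  shows "valid (\<lambda>v. the (\<tau> v)) T"
  unfolding valid_def
proof (intro conjI ballI impI allI; (elim conjE)?)
  fix u v assume uv: "u \<in> T" "v \<in> T" "adj u v"
  obtain c d where "\<tau> u = Some c" "\<tau> v = Some d" using uv T by blast
  then show "the (\<tau> u) \<noteq> the (\<tau> v)" using H_proper[OF t(1) uv(3)] by simp
next
  fix v assume "v \<in> T"
  then obtain c where "\<tau> v = Some c" using T by blast
  then show "the (\<tau> v) \<in> L \<sigma> v" using L_I[OF t] by simp
next
  fix r s u c
  assume h: "r \<in> T \<inter> W" "s \<in> T \<inter> W" "u \<in> T \<inter> W" "adj r s" "adj s u" "\<not> adj r u" "c \<in> Ex r" "c \<notin> Ex s" "c \<notin> Ex u" "the (\<tau> r) = c"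
  show "the (\<tau> u) \<noteq> c"
  proof
    assume tu: "the (\<tau> u) = c"
    have tr: "\<tau> r = Some c" "\<tau> u = Some c" using h(1,3,10) tu T by auto
    have cL: "c \<in> L \<sigma> r" by (rule L_I[OF t tr(1)])
    then obtain y where y: "y \<in> X S" "adj y r" "f y = c" using h(7) unfolding Ex_def by blast
    have ny: "\<not> adj y s" "\<not> adj y u" using h(8,9) y(1,3) unfolding Ex_def by blast+
    have free: "card (L \<sigma> y) = 2" using witness_free[OF y(1,2)] cL y(3) W_V h(1) by blast
    obtain a where a: "a \<in> S" "adj y a" using y(1) unfolding X_def by blast
    have "P4 y r s u" using y(2) h(4-6) ny unfolding P4_def by simp
    moreover have "{r, s, u} \<subseteq> R S" using h(1-3) W_R by blast
    ultimately have sa: "\<sigma> a = Some c" using path_rule[OF a free _ _ t tr] by blast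
    then have "c \<notin> L \<sigma> y" using L_adj[of y a \<sigma> c, OF a(2)] by simp
    then show False using f_L[OF X_V[OF y(1)] X_card[OF y(1)]] y(3) by simp
  qed
qed

text \<open>The colouring \<open>f\<close> is realised by \<open>H\<close> only on two vertices at a time, so an argument may invoke at most two
  of the sets \<open>Y\<close>; the point of \<open>edge_cost\<close> below is that one of them suffices to exclude a colour at both ends of
  an edge.\<close>

definition cost :: "'a set \<Rightarrow> bool" where
  "cost Y \<longleftrightarrow> finite Y \<and> card Y \<le> 1 \<and> (\<forall>y\<in>Y. y \<in> V \<and> card (L \<sigma> y) \<le> 2)"

definition blocks :: "'a set \<Rightarrow> 'a \<Rightarrow> col \<Rightarrow> bool" where
  "blocks Y r c \<longleftrightarrow> (\<forall>\<tau>\<in>H. \<sigma> \<subseteq>\<^sub>m \<tau> \<longrightarrow> (\<forall>y\<in>Y. \<tau> y = Some (f y)) \<longrightarrow> \<tau> r \<noteq> Some c)"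

lemma cost_cases: "cost Y \<Longrightarrow> Y = {} \<or> (\<exists>y. Y = {y} \<and> y \<in> V \<and> card (L \<sigma> y) \<le> 2)"
proof -
  assume c: "cost Y"
  then have "card Y = 0 \<or> card Y = 1" unfolding cost_def by linarith
  then show ?thesis using c unfolding cost_def by (auto simp: card_1_singleton_iff)
qed

text \<open>The two sets contain at most two vertices, which \<open>pair\<close> colours jointly by
  \<open>f\<close>. All pebbles beyond these and \<open>\<sigma>\<close> are dropped before
  \<open>T\<close> is coloured; this takes at most 2 + 10 of the 20 spare pebbles.\<close>

lemma realize:
  assumes Y: "cost Y" "cost Z" and T: "finite T" "T \<subseteq> V" "card T \<le> 10"
  obtains g where "valid g T" "\<And>y. y \<in> T \<inter> (Y \<union> Z) \<Longrightarrow> g y = f y"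
    "\<And>v c. v \<in> T \<Longrightarrow> blocks Y v c \<or> blocks Z v c \<Longrightarrow> g v \<noteq> c"
proof -
  have "\<exists>\<tau>\<in>H. \<sigma> \<subseteq>\<^sub>m \<tau> \<and> (\<forall>y\<in>Y \<union> Z. \<tau> y = Some (f y))"
  proof -
    consider "Y = {}" "Z = {}" | y where "Y = {y} \<or> Y = {}" "Z = {y} \<or> Z = {}" "y \<in> V" "card (L \<sigma> y) \<le> 2"
      | y z where "Y = {y}" "Z = {z}" "y \<in> V" "card (L \<sigma> y) \<le> 2" "z \<in> V" "card (L \<sigma> z) \<le> 2"
      using cost_cases[OF Y(1)] cost_cases[OF Y(2)] by blast
    then show ?thesis
    proof cases
      case 1
      then show ?thesis using good_state(2) map_le_refl by blast
    next
      case (2 y)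
      then show ?thesis using pair[of y y] by auto
    next
      case (3 y z)
      then show ?thesis using pair[of z y] by simp
    qed
  qed
  then obtain \<tau> where t: "\<tau> \<in> H" "\<sigma> \<subseteq>\<^sub>m \<tau>" "\<And>y. y \<in> Y \<union> Z \<Longrightarrow> \<tau> y = Some (f y)" by blast
  have fin: "finite (Y \<union> Z)" using Y unfolding cost_def by simp
  have "card (Y \<union> Z) \<le> 2" using card_Un_le[of Y Z] Y unfolding cost_def by linarith
  then have "card (dom \<sigma>) + card (Y \<union> Z) + card T \<le> k" using good_state(3) T(3) by linarith
  moreover have "Y \<union> Z \<subseteq> dom \<tau>" using t(3) by blast
  ultimately obtain \<rho> where r: "\<rho> \<in> H" "\<sigma> \<subseteq>\<^sub>m \<rho>" "dom \<rho> = dom \<sigma> \<union> (Y \<union> Z) \<union> T" "\<And>v. v \<in> Y \<union> Z \<Longrightarrow> \<rho> v = \<tau> v"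
    using H_reextend[OF t(1,2) _ fin T(1,2)] by blast
  have fy: "\<rho> y = Some (f y)" if "y \<in> Y \<union> Z" for y using r(4) t(3) that by simp
  show thesis
  proof (rule that[of "\<lambda>v. the (\<rho> v)"])
    show "valid (\<lambda>v. the (\<rho> v)) T" by (rule valid_of[OF r(1,2)]) (use r(3) in blast)
    show "the (\<rho> y) = f y" if "y \<in> T \<inter> (Y \<union> Z)" for y using fy that by simp
    show "the (\<rho> v) \<noteq> c" if "v \<in> T" "blocks Y v c \<or> blocks Z v c" for v c
    proof -
      have "\<rho> v \<noteq> Some c" using that(2) r(1,2) fy unfolding blocks_def by blast
      moreover have "v \<in> dom \<rho>" using that(1) r(3) by blast
      ultimately show ?thesis by auto
    qed
  qed
qed

lemma cost_empty: "cost {}"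
  unfolding cost_def by simp

lemma Ex_cost:
  assumes "c \<in> Ex r"
  obtains Y where "cost Y" "blocks Y r c"
proof (cases "c \<in> L \<sigma> r")
  case False
  then have "blocks {} r c" unfolding blocks_def L_def by blast
  then show ?thesis using that cost_empty by blast
next
  case True
  then obtain y where y: "y \<in> X S" "adj y r" "f y = c" using assms unfolding Ex_def by blast
  have "cost {y}" using X_V[OF y(1)] X_card[OF y(1)] unfolding cost_def by simp
  moreover have "blocks {y} r c" unfolding blocks_def using H_proper y by blast
  ultimately show ?thesis by (rule that)
qed

text \<open>If the list of one end lacks \<open>c\<close>, only the other end has to be paid for.
  Otherwise let \<open>y\<close> and \<open>z\<close> exclude \<open>c\<close> at the two ends. Both
  coloured \<open>c\<close> in a common position, they are non-adjacent; so unless one of them is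
  adjacent to both ends, \<open>P4 y r s z\<close> contradicts \<open>edge_rule\<close>.\<close>

lemma edge_cost:
  assumes W: "r \<in> W" "s \<in> W" and rs: "adj r s" and c: "c \<in> Ex r" "c \<in> Ex s"
  obtains Y where "cost Y" "blocks Y r c" "blocks Y s c"
proof -
  have blk: "blocks Y v c" if "c \<notin> L \<sigma> v" for v Y using that unfolding blocks_def L_def by blast
  consider "c \<notin> L \<sigma> r" | "c \<notin> L \<sigma> s" | "c \<in> L \<sigma> r" "c \<in> L \<sigma> s" by blast
  then show thesis
  proof cases
    case 1
    then show ?thesis using that Ex_cost[OF c(2)] blk by blast
  next
    case 2
    then show ?thesis using that Ex_cost[OF c(1)] blk by blast
  next
    case 3
    obtain y where y: "y \<in> X S" "adj y r" "f y = c" using 3(1) c(1) unfolding Ex_def by blast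
    obtain z where z: "z \<in> X S" "adj z s" "f z = c" using 3(2) c(2) unfolding Ex_def by blast
    have free: "card (L \<sigma> y) = 2" "card (L \<sigma> z) = 2"
      using witness_free[OF y(1,2)] witness_free[OF z(1,2)] 3 y(3) z(3) W_V W by simp_all
    have costs: "cost {y}" "cost {z}" unfolding cost_def using free X_V y(1) z(1) by simp_all
    have adjb: "blocks {w} v c" if "adj w v" "f w = c" for w v unfolding blocks_def using H_proper that by blast
    obtain \<tau> where t: "\<tau> \<in> H" "\<sigma> \<subseteq>\<^sub>m \<tau>" "\<tau> y = Some c" "\<tau> z = Some c"
      using pair[OF X_V[OF y(1)] X_V[OF z(1)]] free y(3) z(3) by auto
    have nyz: "\<not> adj y z" using H_proper[OF t(1) _ t(3,4)] by blast
    have "adj y s \<or> adj z r"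
    proof (rule ccontr)
      assume "\<not> (adj y s \<or> adj z r)"
      then have "P4 y r s z" using y(2) z(2) rs nyz unfolding P4_def by (simp add: adj_comm)
      then show False using edge_rule[OF W y(1) z(1) _ free 3 t(1-3)] t(4) by blast
    qed
    then show ?thesis using that adjb y z costs by blast
  qed
qed

end

section \<open>Impossible configurations\<close>

lemma all_col: "(\<forall>c::col. P c) \<longleftrightarrow> P Red \<and> P Green \<and> P Blue"
  by (metis col.exhaust)

lemma ex_col: "(\<exists>c::col. P c) \<longleftrightarrow> P Red \<or> P Green \<or> P Blue"
  by (metis col.exhaust)

text \<open>Without fixed points \<open>t\<close> is not constant, and a non-constant map on three
  points takes some value exactly once.\<close>

lemma unique_value: "(\<And>c::col. t c \<noteq> c) \<Longrightarrow> \<exists>k::col. \<forall>i. i \<noteq> k \<longrightarrow> t i \<noteq> (t k :: col)"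
  unfolding all_col ex_col by (cases "t Red"; cases "t Green"; cases "t Blue") auto

context ext
begin

lemma realize_fixed:
  assumes "cost Y" "cost Z" "finite T" "T \<subseteq> V" "card T \<le> 10"
  obtains g where "valid g T" "\<And>y. y \<in> T \<inter> (Y \<union> Z) \<Longrightarrow> g y = f y"
  by (rule realize[OF assms]) (rule that)

lemma realize_blocks:
  assumes "cost Y" "cost Z" "finite T" "T \<subseteq> V" "card T \<le> 10"
  obtains g where "valid g T" "\<And>v c. v \<in> T \<Longrightarrow> blocks Y v c \<or> blocks Z v c \<Longrightarrow> g v \<noteq> c"
  by (rule realize[OF assms]) (rule that)

lemma X_type: "x \<in> X S \<Longrightarrow> card (L \<sigma> x) = 2 \<Longrightarrow> \<exists>t. L \<sigma> x = - {t}"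
proof -
  assume x: "x \<in> X S" "card (L \<sigma> x) = 2"
  obtain a where a: "a \<in> S" "adj x a" using x(1) unfolding X_def by blast
  then obtain t where "\<sigma> a = Some t" using good_state(1) by blast
  then show ?thesis using L_free[OF a(2) _ x(2)] by blast
qed

text \<open>A colour missing in the list costs nothing, so the other two can be paid for. With a
  full list there are three excluding neighbours \<open>w c\<close>, one too many. One of them,
  \<open>w k\<close>, misses a colour that the other two do not miss, and is adjacent to both by
  \<open>type_rule\<close>. Colouring only those two by \<open>f\<close> thus forces
  \<open>k\<close> on \<open>r\<close> and on \<open>w k\<close>, which are adjacent.\<close>

lemma Ex_not_UNIV:
  assumes r: "r \<in> W"
  shows "Ex r \<noteq> UNIV"
proof
  assume all: "Ex r = UNIV"
  show False
  proof (cases "L \<sigma> r = UNIV")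
    case False
    then obtain p where p: "p \<notin> L \<sigma> r" by blast
    obtain q m where qm: "q \<noteq> m" "q \<noteq> p" "m \<noteq> p" "- {p} = {q, m}" using other_cols[of p] by blast
    have "q \<in> Ex r" "m \<in> Ex r" using all by simp_all
    obtain Y where Y: "cost Y" "blocks Y r q" by (rule Ex_cost[OF \<open>q \<in> Ex r\<close>])
    obtain Z where Z: "cost Z" "blocks Z r m" by (rule Ex_cost[OF \<open>m \<in> Ex r\<close>])
    obtain g where g: "valid g {r}" "g r \<noteq> q" "g r \<noteq> m"
      by (rule realize[OF Y(1) Z(1), of "{r}"]) (use W_V[OF r] Y(2) Z(2) in auto)
    then have "g r = p" using col_cases3[of p q m "g r"] qm by auto
    then show False using valid_L[OF g(1), of r] p by simp
  next
    case True
    have "\<exists>y. y \<in> X S \<and> adj y r \<and> f y = c" for c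
    proof -
      have "c \<in> Ex r" "c \<in> L \<sigma> r" using all True by simp_all
      then show ?thesis unfolding Ex_def by blast
    qed
    then obtain w where w: "\<And>c. w c \<in> X S" "\<And>c. adj (w c) r" "\<And>c. f (w c) = c" by metis
    have free: "card (L \<sigma> (w c)) = 2" for c
      by (rule witness_free[OF w(1,2)]) (use True W_V[OF r] in auto)
    have "\<exists>t. \<forall>c. L \<sigma> (w c) = - {t c}" using X_type[OF w(1) free] by metis
    then obtain t where t: "\<And>c. L \<sigma> (w c) = - {t c}" by blast
    have "t c \<noteq> c" for c using f_L[OF X_V[OF w(1)] X_card[OF w(1)], of c] t[of c] w(3)[of c] by auto
    then obtain k where k: "\<And>i. i \<noteq> k \<Longrightarrow> t i \<noteq> t k" using unique_value by blast
    obtain i j where ij: "i \<noteq> j" "i \<noteq> k" "j \<noteq> k" "- {k} = {i, j}" using other_cols[of k] by blast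
    have wadj: "adj (w k) (w i)" if "i \<noteq> k" for i
    proof (rule type_rule[of r])
      show "L \<sigma> (w k) \<noteq> L \<sigma> (w i)" using t k[OF that] by auto
      show "adj r (w k)" "adj r (w i)" using w(2) adj_sym by blast+
    qed (use r W_R w True free in simp_all)
    have c: "cost {w i}" "cost {w j}" unfolding cost_def using X_V[OF w(1)] free by simp_all
    have T: "finite {r, w i, w j, w k}" "{r, w i, w j, w k} \<subseteq> V" "card {r, w i, w j, w k} \<le> 10"
      using W_V[OF r] X_V[OF w(1)] by (simp_all add: card_insert_if)
    obtain g where g: "valid g {r, w i, w j, w k}" "\<And>y. y \<in> {r, w i, w j, w k} \<inter> ({w i} \<union> {w j}) \<Longrightarrow> g y = f y"
      by (rule realize_fixed[OF c T]) (rule that)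
    have "g (w i) = i" "g (w j) = j" using g(2)[of "w i"] g(2)[of "w j"] w(3) by simp_all
    moreover have "g (w i) \<noteq> g r" "g (w j) \<noteq> g r" "g (w k) \<noteq> g r" "g (w k) \<noteq> g (w i)" "g (w k) \<noteq> g (w j)"
      using valid_neq[OF g(1)] w(2) wadj ij(2,3) by simp_all
    ultimately show False using col_cases3[of i j k "g r"] col_cases3[of i j k "g (w k)"] ij by auto
  qed
qed

lemma Ex_single: "r \<in> W \<Longrightarrow> - {c} \<subseteq> Ex r \<Longrightarrow> c \<notin> Ex r"
  using Ex_not_UNIV[of r] by (metis UNIV_eq_I ComplI singletonD subsetD)

text \<open>Each of the two colours is paid for by one vertex, and the ends of the edge are left
  with a single colour.\<close>

lemma Ex_edge:
  assumes W: "r \<in> W" "s \<in> W" and rs: "adj r s" and pq: "p \<noteq> q"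
    and p: "p \<in> Ex r" "p \<in> Ex s" and q: "q \<in> Ex r" "q \<in> Ex s"
  shows False
proof -
  obtain Y where Y: "cost Y" "blocks Y r p" "blocks Y s p" by (rule edge_cost[OF W rs p])
  obtain Z where Z: "cost Z" "blocks Z r q" "blocks Z s q" by (rule edge_cost[OF W rs q])
  have T: "finite {r, s}" "{r, s} \<subseteq> V" "card {r, s} \<le> 10" using W W_V by (simp_all add: card_insert_if)
  obtain g where g: "valid g {r, s}" "\<And>v c. v \<in> {r, s} \<Longrightarrow> blocks Y v c \<or> blocks Z v c \<Longrightarrow> g v \<noteq> c"
    by (rule realize_blocks[OF Y(1) Z(1) T]) (rule that)
  have "g r \<noteq> g s" using valid_neq[OF g(1) rs] by simp
  then show False using col_neq3[of "g r" p q "g s"] g(2) Y Z pq by simp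
qed

text \<open>One payment for an edge and one for the third vertex leave two colours for a
  triangle.\<close>

lemma Ex_triangle:
  assumes W: "a \<in> W" "b \<in> W" "c \<in> W" and adj: "adj a b" "adj b c" "adj a c"
    and p: "p \<in> Ex a" "p \<in> Ex b" "p \<in> Ex c"
  shows False
proof -
  obtain Y where Y: "cost Y" "blocks Y a p" "blocks Y b p" by (rule edge_cost[OF W(1,2) adj(1) p(1,2)])
  obtain Z where Z: "cost Z" "blocks Z c p" by (rule Ex_cost[OF p(3)])
  have T: "finite {a, b, c}" "{a, b, c} \<subseteq> V" "card {a, b, c} \<le> 10" using W W_V by (simp_all add: card_insert_if)
  obtain g where g: "valid g {a, b, c}" "\<And>v d. v \<in> {a, b, c} \<Longrightarrow> blocks Y v d \<or> blocks Z v d \<Longrightarrow> g v \<noteq> d"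
    by (rule realize_blocks[OF Y(1) Z(1) T]) (rule that)
  have "g a \<noteq> g b" "g b \<noteq> g c" "g a \<noteq> g c" using valid_neq[OF g(1)] adj by simp_all
  moreover have "g a \<noteq> p" "g b \<noteq> p" "g c \<noteq> p" using g(2) Y Z by simp_all
  ultimately show False using col_cases3[of "g a" "g b" "g c" p] by simp
qed

lemma no_K4:
  assumes W: "{a, b, c, d} \<subseteq> W" and adj: "adj a b" "adj a c" "adj a d" "adj b c" "adj b d" "adj c d"
  shows False
proof -
  have T: "finite {a, b, c, d}" "{a, b, c, d} \<subseteq> V" "card {a, b, c, d} \<le> 10"
    using W W_V by (simp_all add: card_insert_if)
  obtain g where g: "valid g {a, b, c, d}" by (rule realize_blocks[OF cost_empty cost_empty T]) (rule that)
  have "g a \<noteq> g b" "g a \<noteq> g c" "g a \<noteq> g d" "g b \<noteq> g c" "g b \<noteq> g d" "g c \<noteq> g d"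
    using valid_neq[OF g] adj by simp_all
  then show False using col_cases3[of "g a" "g b" "g c" "g d"] by simp
qed

text \<open>Only \<open>p\<close> is paid for. The colours \<open>q\<close> and \<open>m\<close>
  then alternate on the path, so \<open>r\<close> and \<open>u\<close> agree; the last clause of
  \<open>valid\<close>, read from \<open>r\<close> for \<open>q\<close> and from \<open>u\<close>
  for \<open>m\<close>, forbids both possibilities.\<close>

lemma Ex_path:
  assumes W: "r \<in> W" "s \<in> W" "u \<in> W" and adj: "adj r s" "adj s u" "\<not> adj r u"
    and pqm: "p \<noteq> q" "q \<noteq> m" "p \<noteq> m"
    and p: "p \<in> Ex r" "p \<in> Ex s" "p \<in> Ex u" and q: "q \<in> Ex r" and m: "m \<in> Ex u"
  shows False
proof -
  have nm: "m \<notin> Ex r" using Ex_not_UNIV[OF W(1)] p q col_cases3[OF pqm] by (metis UNIV_eq_I)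
  have nq: "q \<notin> Ex u" using Ex_not_UNIV[OF W(3)] p m col_cases3[OF pqm] by (metis UNIV_eq_I)
  have ns: "q \<notin> Ex s" "m \<notin> Ex s"
    using Ex_edge[OF W(1,2) adj(1) pqm(1) p(1,2) q] Ex_edge[OF W(2,3) adj(2) pqm(3) p(2,3) _ m] by blast+
  obtain Y where Y: "cost Y" "blocks Y r p" "blocks Y s p" by (rule edge_cost[OF W(1,2) adj(1) p(1,2)])
  obtain Z where Z: "cost Z" "blocks Z u p" by (rule Ex_cost[OF p(3)])
  have T: "finite {r, s, u}" "{r, s, u} \<subseteq> V" "card {r, s, u} \<le> 10" using W W_V by (simp_all add: card_insert_if)
  obtain g where g: "valid g {r, s, u}" "\<And>v c. v \<in> {r, s, u} \<Longrightarrow> blocks Y v c \<or> blocks Z v c \<Longrightarrow> g v \<noteq> c"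
    by (rule realize_blocks[OF Y(1) Z(1) T]) (rule that)
  have neq: "g r \<noteq> g s" "g s \<noteq> g u" using valid_neq[OF g(1)] adj by simp_all
  have np: "g r \<noteq> p" "g s \<noteq> p" "g u \<noteq> p" using g(2) Y Z by simp_all
  have ru: "\<not> adj u r" "adj u s" "adj s r" using adj adj_sym by blast+
  have 1: "g r = q \<Longrightarrow> g u \<noteq> q" using valid_path[OF g(1), of r s u q] W adj q ns nq by simp
  have 2: "g u = m \<Longrightarrow> g r \<noteq> m" using valid_path[OF g(1), of u s r m] W ru m ns nm by simp
  show False using 1 2 neq np col_cases3[OF pqm, of "g r"] col_cases3[OF pqm, of "g s"] col_cases3[OF pqm, of "g u"] by auto
qed

text \<open>Each leaf admits only its own colour, but payment enforces this just for
  \<open>r Red\<close>. By the last clause of \<open>valid\<close> no other leaf is red. With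
  \<open>m\<close> the colour other than red and that of \<open>s\<close>, the two leaves indexed by
  \<open>m\<close> and by the colour of \<open>s\<close> both get \<open>m\<close>, against the same
  clause.\<close>

lemma Ex_claw:
  assumes s: "s \<in> W" and W: "\<And>i. r i \<in> W" and adj: "\<And>i. adj s (r i)" and nadj: "\<And>i j. \<not> adj (r i) (r j)"
    and E: "\<And>i::col. - {i} \<subseteq> Ex (r i)"
  shows False
proof -
  have E1: "j \<in> Ex (r i) \<longleftrightarrow> j \<noteq> i" for i j using E[of i] Ex_single[OF W E] by auto
  have Es: "i \<notin> Ex s" for i
  proof
    assume i: "i \<in> Ex s"
    obtain j m where jm: "j \<noteq> m" "j \<noteq> i" "m \<noteq> i" using other_cols[of i] by blast
    show False
      by (rule Ex_path[where r = "r j" and s = s and u = "r m" and p = i and q = m and m = j])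
        (use W s adj adj_sym[OF adj] nadj jm i E1 in auto)
  qed
  obtain q' m' where o: "q' \<noteq> m'" "q' \<noteq> Red" "m' \<noteq> Red" by (rule that[of Green Blue]) auto
  have "q' \<in> Ex (r Red)" "m' \<in> Ex (r Red)" using E1 o by auto
  obtain Y where Y: "cost Y" "blocks Y (r Red) q'" by (rule Ex_cost[OF \<open>q' \<in> Ex (r Red)\<close>])
  obtain Z where Z: "cost Z" "blocks Z (r Red) m'" by (rule Ex_cost[OF \<open>m' \<in> Ex (r Red)\<close>])
  let ?T = "{s, r Red, r Green, r Blue}"
  have T: "finite ?T" "?T \<subseteq> V" "card ?T \<le> 10" using W s W_V by (simp_all add: card_insert_if)
  obtain g where g: "valid g ?T" "\<And>v c. v \<in> ?T \<Longrightarrow> blocks Y v c \<or> blocks Z v c \<Longrightarrow> g v \<noteq> c"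
    by (rule realize_blocks[OF Y(1) Z(1) T]) (rule that)
  have rT: "r i \<in> ?T" for i by (cases i) simp_all
  have red: "g (r Red) = Red" using g(2)[OF rT[of Red]] Y Z o col_cases3[of q' m' Red "g (r Red)"] by auto
  have ns: "g (r i) \<noteq> g s" for i using valid_neq[OF g(1) adj[of i]] rT by simp
  have p2: "i \<noteq> j \<Longrightarrow> g (r j) = i \<Longrightarrow> g (r i) \<noteq> i" for i j
    using valid_path[OF g(1), of "r j" s "r i" i] W s adj adj_sym[OF adj] nadj Es E1 rT by auto
  have "g s \<noteq> Red" using ns[of Red] red by simp
  then obtain m where m: "m \<noteq> Red" "m \<noteq> g s" using third_col by blast
  have nR: "g (r c) \<noteq> Red" if "c \<noteq> Red" for c using p2[of Red c] red that by auto
  have "g (r (g s)) = m" "g (r m) = m"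
    using nR[of "g s"] nR[of m] ns[of "g s"] ns[of m] col_cases3[of Red "g s" m] \<open>g s \<noteq> Red\<close> m by metis+
  then show False using p2[of m "g s"] m by simp
qed

text \<open>If \<open>a\<close> is excluded at both \<open>s\<close> and \<open>s'\<close>,
  \<open>Ex_path\<close> applies to \<open>s r' s'\<close>. Otherwise paying for \<open>b\<close> on
  \<open>r s\<close> and for \<open>c\<close> on \<open>r s'\<close> colours \<open>r\<close>,
  \<open>s\<close>, \<open>s'\<close>, \<open>r'\<close> with \<open>a\<close>, \<open>c\<close>,
  \<open>b\<close>, \<open>a\<close>, and the last clause of \<open>valid\<close> forbids
  \<open>a\<close> at both \<open>r'\<close> and \<open>r\<close>.\<close>

lemma Ex_square:
  assumes W: "r \<in> W" "r' \<in> W" "s \<in> W" "s' \<in> W"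
    and adj: "adj r s" "adj r s'" "adj r' s" "adj r' s'" "\<not> adj r r'" "\<not> adj s s'"
    and abc: "a \<noteq> b" "b \<noteq> c" "a \<noteq> c"
    and E: "- {a} \<subseteq> Ex r" "a \<in> Ex r'" "b \<in> Ex s" "c \<in> Ex s'"
  shows False
proof -
  have sym: "adj s r" "adj s' r" "adj s r'" "adj s' r'" "\<not> adj r' r" using adj adj_sym by blast+
  have ar: "b \<in> Ex r" "c \<in> Ex r" "a \<notin> Ex r" using E(1) abc Ex_single[OF W(1) E(1)] by auto
  show False
  proof (cases "a \<in> Ex s \<and> a \<in> Ex s'")
    case True
    show ?thesis
      by (rule Ex_path[where r = s and s = r' and u = s' and p = a and q = b and m = c]) (use W adj sym abc E True in auto)
  next
    case False
    obtain Y where Y: "cost Y" "blocks Y r b" "blocks Y s b" by (rule edge_cost[OF W(1,3) adj(1) ar(1) E(3)])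
    obtain Z where Z: "cost Z" "blocks Z r c" "blocks Z s' c" by (rule edge_cost[OF W(1,4) adj(2) ar(2) E(4)])
    let ?T = "{r, r', s, s'}"
    have T: "finite ?T" "?T \<subseteq> V" "card ?T \<le> 10" using W W_V by (simp_all add: card_insert_if)
    obtain g where g: "valid g ?T" "\<And>v c. v \<in> ?T \<Longrightarrow> blocks Y v c \<or> blocks Z v c \<Longrightarrow> g v \<noteq> c"
      by (rule realize_blocks[OF Y(1) Z(1) T]) (rule that)
    have b: "g r \<noteq> b" "g r \<noteq> c" "g s \<noteq> b" "g s' \<noteq> c" using g(2) Y Z by simp_all
    have n: "g r \<noteq> g s" "g r \<noteq> g s'" "g r' \<noteq> g s" "g r' \<noteq> g s'" using valid_neq[OF g(1)] adj by simp_all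
    have 1: "g r = a" using b col_cases3[OF abc] by metis
    have 2: "g s = c" "g s' = b" using 1 b n col_cases3[OF abc] by metis+
    have 3: "g r' = a" using 2 n col_cases3[OF abc] by metis
    show ?thesis
      using False valid_path[OF g(1), of r' s r a] valid_path[OF g(1), of r' s' r a] W adj sym ar(3) E(2) 1 3 by auto
  qed
qed

text \<open>Nothing is paid for. A proper 3-colouring makes one side monochromatic, say in colour
  \<open>i\<close>; the vertex excluding \<open>i\<close> on that side and any other one there
  violate the last clause of \<open>valid\<close>.\<close>

lemma Ex_K33:
  assumes W: "\<And>i. r i \<in> W" "\<And>i. s i \<in> W" and adj: "\<And>i j. adj (r i) (s j)"
    and nadj: "\<And>i j. \<not> adj (r i) (r j)" "\<And>i j. \<not> adj (s i) (s j)"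
    and E: "\<And>i::col. Ex (r i) = {i}" "\<And>i::col. Ex (s i) = {i}"
  shows False
proof -
  let ?T = "{r Red, r Green, r Blue, s Red, s Green, s Blue}"
  have T: "finite ?T" "?T \<subseteq> V" "card ?T \<le> 10" using W W_V by (simp_all add: card_insert_if)
  obtain g where g: "valid g ?T" by (rule realize_blocks[OF cost_empty cost_empty T]) (rule that)
  have rT: "r i \<in> ?T" "s i \<in> ?T" for i by (cases i; simp)+
  have n: "g (r i) \<noteq> g (s j)" for i j using valid_neq[OF g adj] rT by blast
  have sadj: "adj (s i) (r j)" for i j using adj adj_sym by blast
  have 1: "g (r i) = i \<Longrightarrow> g (r j) = i \<Longrightarrow> i \<noteq> j \<Longrightarrow> False" for i j
  proof -
    assume h: "g (r i) = i" "g (r j) = i" "i \<noteq> j"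
    have "g (r j) \<noteq> i"
      by (rule valid_path[OF g, of "r i" "s j"]) (use rT W adj sadj nadj E h in simp_all)
    then show False using h by simp
  qed
  have 2: "g (s i) = i \<Longrightarrow> g (s j) = i \<Longrightarrow> i \<noteq> j \<Longrightarrow> False" for i j
  proof -
    assume h: "g (s i) = i" "g (s j) = i" "i \<noteq> j"
    have "g (s j) \<noteq> i"
      by (rule valid_path[OF g, of "s i" "r j"]) (use rT W adj sadj nadj E h in simp_all)
    then show False using h by simp
  qed
  show False
  proof (cases "\<forall>i j. g (r i) = g (r j)")
    case True
    obtain j where "j \<noteq> g (r Red)" using third_col by blast
    then show ?thesis using 1[of "g (r Red)" j] True by metis
  next
    case False
    then obtain i j where ij: "g (r i) \<noteq> g (r j)" by blast
    have "g (s l) = g (s m)" for l m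
      by (rule col_neq3[of _ "g (r i)" "g (r j)"]) (use n[of i] n[of j] ij in \<open>auto dest: sym\<close>)
    moreover obtain m where "m \<noteq> g (s Red)" using third_col by blast
    ultimately show ?thesis using 2[of "g (s Red)" m] by metis
  qed
qed

text \<open>Payment forces \<open>c\<close> on \<open>e\<close>. Then \<open>a\<close> does not have
  \<open>c\<close>, so \<open>d\<close> or \<open>d'\<close> does, as a triangle uses all three
  colours; together with \<open>e\<close> it violates the last clause of
  \<open>valid\<close>.\<close>

lemma Ex_paw:
  assumes W: "a \<in> W" "d \<in> W" "d' \<in> W" "e \<in> W"
    and adj: "adj a d" "adj a d'" "adj a e" "adj d d'" "\<not> adj d e" "\<not> adj d' e"
    and E: "c \<in> Ex d" "c \<in> Ex d'" "- {c} \<subseteq> Ex e"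
  shows False
proof -
  have sym: "adj d a" "adj d' a" using adj adj_sym by blast+
  have nc: "c \<notin> Ex a" "c \<notin> Ex e"
    using Ex_triangle[OF W(1-3) adj(1,4,2) _ E(1,2)] Ex_single[OF W(4) E(3)] by blast+
  obtain p q where pq: "p \<noteq> q" "p \<noteq> c" "q \<noteq> c" using other_cols[of c] by blast
  have "p \<in> Ex e" "q \<in> Ex e" using E(3) pq by auto
  obtain Y where Y: "cost Y" "blocks Y e p" by (rule Ex_cost[OF \<open>p \<in> Ex e\<close>])
  obtain Z where Z: "cost Z" "blocks Z e q" by (rule Ex_cost[OF \<open>q \<in> Ex e\<close>])
  let ?T = "{a, d, d', e}"
  have T: "finite ?T" "?T \<subseteq> V" "card ?T \<le> 10" using W W_V by (simp_all add: card_insert_if)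
  obtain g where g: "valid g ?T" "\<And>v c. v \<in> ?T \<Longrightarrow> blocks Y v c \<or> blocks Z v c \<Longrightarrow> g v \<noteq> c"
    by (rule realize_blocks[OF Y(1) Z(1) T]) (rule that)
  have n: "g a \<noteq> g d" "g a \<noteq> g d'" "g a \<noteq> g e" "g d \<noteq> g d'" using valid_neq[OF g(1)] adj by simp_all
  have "g e \<noteq> p" "g e \<noteq> q" using g(2) Y Z by simp_all
  then have ec: "g e = c" using col_cases3[of p q c "g e"] pq by simp
  then have "g d = c \<or> g d' = c" using n col_cases3[of "g a" "g d" "g d'" c] by auto
  then show False
    using valid_path[OF g(1), of d a e c] valid_path[OF g(1), of d' a e c] W adj sym nc E(1,2) ec by auto
qed

text \<open>Excluding \<open>p\<close> on the edge \<open>d d'\<close> leaves only \<open>p\<close>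
  for the common neighbour \<open>a\<close>; the edge \<open>e e'\<close> leaves only
  \<open>q\<close>.\<close>

lemma Ex_two_edges:
  assumes W: "a \<in> W" "d \<in> W" "d' \<in> W" "e \<in> W" "e' \<in> W"
    and adj: "adj a d" "adj a d'" "adj a e" "adj a e'" "adj d d'" "adj e e'"
    and E: "p \<in> Ex d" "p \<in> Ex d'" "q \<in> Ex e" "q \<in> Ex e'"
  shows "p = q"
proof -
  obtain Y where Y: "cost Y" "blocks Y d p" "blocks Y d' p" by (rule edge_cost[OF W(2,3) adj(5) E(1,2)])
  obtain Z where Z: "cost Z" "blocks Z e q" "blocks Z e' q" by (rule edge_cost[OF W(4,5) adj(6) E(3,4)])
  let ?T = "{a, d, d', e, e'}"
  have T: "finite ?T" "?T \<subseteq> V" "card ?T \<le> 10" using W W_V by (simp_all add: card_insert_if)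
  obtain g where g: "valid g ?T" "\<And>v c. v \<in> ?T \<Longrightarrow> blocks Y v c \<or> blocks Z v c \<Longrightarrow> g v \<noteq> c"
    by (rule realize_blocks[OF Y(1) Z(1) T]) (rule that)
  have n: "g a \<noteq> g d" "g a \<noteq> g d'" "g d \<noteq> g d'" "g a \<noteq> g e" "g a \<noteq> g e'" "g e \<noteq> g e'" using valid_neq[OF g(1)] adj by simp_all
  have b: "g d \<noteq> p" "g d' \<noteq> p" "g e \<noteq> q" "g e' \<noteq> q" using g(2) Y Z by simp_all
  have "g a = p" using n(1-3) b(1,2) col_cases3[of "g a" "g d" "g d'" p] by auto
  moreover have "g a = q" using n(4-6) b(3,4) col_cases3[of "g a" "g e" "g e'" q] by auto
  ultimately show ?thesis by simp
qed

text \<open>Common neighbours of the ends of an edge are coloured alike. If \<open>c\<close> is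
  excluded at \<open>r\<close> but not at \<open>u\<close>, give \<open>u\<close> the colour
  \<open>c\<close>: then \<open>r\<close> has it too, and the last clause of \<open>valid\<close>
  puts \<open>c\<close> into \<open>Ex h\<close> and \<open>Ex h'\<close>, against
  \<open>Ex_triangle\<close>.\<close>

lemma Ex_twin_subset:
  assumes W: "r \<in> W" "u \<in> W" "h \<in> W" "h' \<in> W"
    and adj: "\<not> adj r u" "adj h h'" "adj r h" "adj r h'" "adj u h" "adj u h'"
  shows "Ex r \<subseteq> Ex u"
proof
  fix c assume c: "c \<in> Ex r"
  show "c \<in> Ex u"
  proof (rule ccontr)
    assume nc: "c \<notin> Ex u"
    then have "c \<in> L \<sigma> u" unfolding Ex_def by simp
    then obtain \<tau> where t: "\<tau> \<in> H" "\<sigma> \<subseteq>\<^sub>m \<tau>" "\<tau> u = Some c" unfolding L_def by blast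
    have "{r, h, h'} \<subseteq> V" using W W_V by simp
    moreover have "card (dom \<sigma>) + card {u} + card {r, h, h'} \<le> k" using good_state(3) by (simp add: card_insert_if)
    ultimately obtain \<rho> where r: "\<rho> \<in> H" "\<sigma> \<subseteq>\<^sub>m \<rho>" "dom \<rho> = dom \<sigma> \<union> {u} \<union> {r, h, h'}" "\<And>v. v \<in> {u} \<Longrightarrow> \<rho> v = \<tau> v"
      using H_reextend[OF t(1,2), of "{u}" "{r, h, h'}"] t(3) by auto
    have sub: "{r, u, h, h'} \<subseteq> dom \<rho>" using r(3) by simp
    define g where "g v = the (\<rho> v)" for v
    have g: "valid g {r, u, h, h'}" unfolding g_def using valid_of[OF r(1,2) sub] .
    have gu: "g u = c" unfolding g_def using r(4)[of u] t(3) by simp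
    have n: "g h \<noteq> g h'" "g r \<noteq> g h" "g r \<noteq> g h'" "g u \<noteq> g h" "g u \<noteq> g h'" using valid_neq[OF g] adj by simp_all
    have gr: "g r = c" using n gu col_cases3[of "g h" "g h'" "g r" c] by auto
    have sym: "adj h u" "adj h' u" using adj adj_sym by blast+
    have "c \<in> Ex h" using valid_path[OF g, of r h u c] W adj sym c nc gr gu by auto
    moreover have "c \<in> Ex h'" using valid_path[OF g, of r h' u c] W adj sym c nc gr gu by auto
    ultimately show False using Ex_triangle[OF W(1,3,4) adj(3,2,4) c] by blast
  qed
qed

lemma Ex_twin:
  assumes W: "r \<in> W" "u \<in> W" "h \<in> W" "h' \<in> W"
    and adj: "\<not> adj r u" "adj h h'" "adj r h" "adj r h'" "adj u h" "adj u h'"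
  shows "Ex r = Ex u"
  using Ex_twin_subset[OF W adj] Ex_twin_subset[OF W(2,1,3,4)] adj adj_sym by blast

section \<open>Colourings that respect excluded colours\<close>

definition avoids :: "'a set \<Rightarrow> ('a \<Rightarrow> col set) \<Rightarrow> ('a \<Rightarrow> col) \<Rightarrow> bool" where
  "avoids K Q h \<longleftrightarrow> (\<forall>u\<in>K. \<forall>v\<in>K. adj u v \<longrightarrow> h u \<noteq> h v) \<and> (\<forall>v\<in>K. h v \<notin> Q v)"

lemma avoids_union:
  assumes "avoids A Q h" "avoids B Q h'" "anticomplete A B"
  shows "\<exists>h. avoids (A \<union> B) Q h"
proof -
  have n: "\<And>a b. a \<in> A \<Longrightarrow> b \<in> B \<Longrightarrow> \<not> adj a b \<and> \<not> adj b a"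
    using assms(3) adj_sym unfolding anticomplete_def by blast
  have "avoids (A \<union> B) Q (\<lambda>v. if v \<in> A then h v else h' v)"
    using assms(1,2) n unfolding avoids_def by (auto split: if_splits)
  then show ?thesis by blast
qed

lemma avoids_join:
  assumes AB: "A \<inter> B = {}" "stable A" and A: "\<And>a. a \<in> A \<Longrightarrow> c \<notin> Q a" and B: "avoids B (\<lambda>v. insert c (Q v)) h"
  shows "\<exists>h. avoids (A \<union> B) Q h"
proof -
  have "avoids (A \<union> B) Q (\<lambda>v. if v \<in> A then c else h v)"
    using assms unfolding avoids_def stable_def anticomplete_def by (auto split: if_splits)
  then show ?thesis by blast
qed

lemma avoids_stable:
  assumes "stable B" "\<And>b. b \<in> B \<Longrightarrow> Q b \<noteq> UNIV"
  shows "\<exists>h. avoids B Q h"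
proof -
  have "\<forall>b\<in>B. \<exists>c. c \<notin> Q b" using assms(2) by blast
  then obtain h where "\<forall>b\<in>B. h b \<notin> Q b" by (rule bchoice[THEN exE])
  then have "avoids B Q h" using assms(1) unfolding avoids_def stable_def anticomplete_def by blast
  then show ?thesis by blast
qed

end

section \<open>Extending the colouring\<close>

context ext
begin

lemma complete_toD: "complete_to A B \<Longrightarrow> a \<in> A \<Longrightarrow> b \<in> B \<Longrightarrow> adj a b \<and> adj b a"
  unfolding complete_to_def using adj_sym by blast

lemma complete_to_sym: "complete_to A B \<Longrightarrow> complete_to B A"
  unfolding complete_to_def using adj_sym by blast

lemma complete_disjoint: "complete_to A B \<Longrightarrow> A \<inter> B = {}"
  unfolding complete_to_def using adj_irrefl by blast

lemma neighbourhood_join_stable: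
  assumes "a0 \<in> W" "A \<subseteq> W" "B \<subseteq> W" "complete_to A B" "\<And>x. x \<in> A \<union> B \<Longrightarrow> adj a0 x" "B \<noteq> {}"
  shows "stable A"
proof (rule ccontr)
  assume "\<not> stable A"
  then obtain u v where uv: "u \<in> A" "v \<in> A" "adj u v" using not_stable by blast
  obtain b where b: "b \<in> B" using assms(6) by blast
  show False
    by (rule no_K4[of a0 u v b]) (use assms uv b complete_toD[OF assms(4)] in auto)
qed

text \<open>Here \<open>B\<close> lies in the neighbourhood of \<open>a0\<close>, and
  \<open>c\<close> is reserved for vertices outside \<open>B\<close>. In a join both sides are
  stable, and each can try one of the two other colours. If both ways fail, either a colour is
  excluded at both ends of an edge, or both colours are excluded on one side; there all vertices are
  twins with equal \<open>Ex\<close>, so a single vertex excludes both.\<close>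

lemma avoid_colour:
  assumes a0: "a0 \<in> W" and "finite B"
    and sub0: "B \<subseteq> W" and adj0: "\<And>b. b \<in> B \<Longrightarrow> adj a0 b" and vertices: "\<And>e. e \<in> B \<Longrightarrow> \<not> - {c} \<subseteq> Ex e"
    and edges: "\<And>d d' p. d \<in> B \<Longrightarrow> d' \<in> B \<Longrightarrow> adj d d' \<Longrightarrow> p \<in> Ex d \<Longrightarrow> p \<in> Ex d' \<Longrightarrow> p = c"
  shows "\<exists>h. avoids B (\<lambda>v. insert c (Ex v)) h"
proof -
  let ?Q = "\<lambda>v. insert c (Ex v)"
  have "P4_free B" by (rule P4_free_subset[OF good_state(4)]) (use sub0 W_R in blast)
  with \<open>finite B\<close> show ?thesis
  proof (induction rule: cograph_induct)
    case (stable A)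
    have "?Q b \<noteq> UNIV" if "b \<in> A" for b using vertices[of b] stable(1) that by blast
    then show ?case by (rule avoids_stable[OF stable(2)])
  next
    case (anticomplete A' B')
    then show ?case using avoids_union by blast
  next
    case (complete A' B')
    note cm = complete(5) and AB = complete(1,2)
    have sub: "A' \<subseteq> W" "B' \<subseteq> W" using AB sub0 by blast+
    have a0adj: "\<And>x. x \<in> A' \<union> B' \<Longrightarrow> adj a0 x" using adj0 AB by blast
    have st: "stable A'" "stable B'"
      using neighbourhood_join_stable[OF a0 sub cm a0adj complete(4)]
        neighbourhood_join_stable[OF a0 sub(2,1) complete_to_sym[OF cm] _ complete(3)] a0adj by auto
    obtain q m where qm: "q \<noteq> m" "q \<noteq> c" "m \<noteq> c" "- {c} = {q, m}" using other_cols[of c] by blast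
    have mode: ?case if pq: "p \<noteq> q" "p \<noteq> c" "q \<noteq> c" and A: "\<And>a. a \<in> A' \<Longrightarrow> p \<notin> Ex a" and B: "\<And>b. b \<in> B' \<Longrightarrow> q \<notin> Ex b"
      for p q
    proof -
      have "avoids B' (\<lambda>v. insert p (?Q v)) (\<lambda>_. q)"
        using st(2) B pq unfolding avoids_def stable_def anticomplete_def by auto
      then show ?thesis using avoids_join[OF complete_disjoint[OF cm] st(1), of p ?Q "\<lambda>_. q"] A pq(2) AB by auto
    qed
    show ?case
    proof (rule ccontr)
      assume no: "\<not> ?case"
      have 1: "(\<exists>a\<in>A'. q \<in> Ex a) \<or> (\<exists>b\<in>B'. m \<in> Ex b)" using mode[of q m] no qm by blast
      have 2: "(\<exists>a\<in>A'. m \<in> Ex a) \<or> (\<exists>b\<in>B'. q \<in> Ex b)" using mode[of m q] no qm by blast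
      have cross: False if "a \<in> A'" "b \<in> B'" "p \<in> Ex a" "p \<in> Ex b" "p \<noteq> c" for a b p
        using edges[of a b p] complete_toD[OF cm that(1,2)] that AB by blast
      have same: False if K: "K = A' \<and> L = B' \<or> K = B' \<and> L = A'" and a: "a \<in> K" "a' \<in> K" "q \<in> Ex a" "m \<in> Ex a'"
        for K L a a'
      proof -
        have "L \<noteq> {}" "stable K" "complete_to K L" "K \<subseteq> B" "L \<subseteq> B"
          using K complete(3,4) AB st cm complete_to_sym[OF cm] by auto
        then obtain b where b: "b \<in> L" by blast
        have n: "\<not> adj a a'" using stableD[OF \<open>stable K\<close>] a by blast
        have BB: "a \<in> B" "a' \<in> B" "b \<in> B" using a b \<open>K \<subseteq> B\<close> \<open>L \<subseteq> B\<close> by auto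
        have "Ex a = Ex a'"
          by (rule Ex_twin[of a a' a0 b])
            (use BB sub0 adj0 a0 n adj_sym[OF adj0] complete_toD[OF \<open>complete_to K L\<close>] a b in auto)
        then show False using vertices[OF BB(1)] a qm by auto
      qed
      show False using 1 2 cross qm same[of A' B'] same[of B' A'] by metis
    qed
  qed
qed

text \<open>By \<open>fA\<close> and \<open>fB\<close>, no constant colour on one side leaves room
  for the other side. Suppose \<open>r\<close> admits at most \<open>c\<close>. Then some
  \<open>r'\<close> in \<open>A\<close> excludes \<open>c\<close>, and each of the other colours
  \<open>p\<close>, \<open>q\<close> is excluded somewhere in \<open>B\<close>, as otherwise three
  vertices of \<open>A\<close> with a centre in \<open>B\<close> would contradict
  \<open>Ex_claw\<close>. This is the situation of \<open>Ex_square\<close>.\<close>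

lemma bipartite_no_pair:
  assumes sub: "A \<subseteq> W" "B \<subseteq> W" and cm: "complete_to A B" and st: "stable A" "stable B" and ne: "B \<noteq> {}"
    and fA: "\<And>c. (\<exists>a\<in>A. c \<in> Ex a) \<or> (\<exists>b\<in>B. - {c} \<subseteq> Ex b)"
    and fB: "\<And>c. (\<exists>b\<in>B. c \<in> Ex b) \<or> (\<exists>a\<in>A. - {c} \<subseteq> Ex a)"
    and r: "r \<in> A"
  shows "\<not> - {c} \<subseteq> Ex r"
proof
  assume E: "- {c} \<subseteq> Ex r"
  note adj = complete_toD[OF cm]
  obtain p q where pq: "p \<noteq> q" "p \<noteq> c" "q \<noteq> c" using other_cols[of c] by blast
  have rpq: "p \<in> Ex r" "q \<in> Ex r" using E pq by auto
  have nB: "\<not> - {c} \<subseteq> Ex b" if b: "b \<in> B" for b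
  proof
    assume "- {c} \<subseteq> Ex b"
    then have "p \<in> Ex b" "q \<in> Ex b" using pq by auto
    then show False using Ex_edge[of r b p q] rpq pq(1) r b sub adj[OF r b] by blast
  qed
  then obtain r' where r': "r' \<in> A" "c \<in> Ex r'" using fA[of c] by blast
  have seen: "\<exists>b\<in>B. p \<in> Ex b" if pq: "p \<noteq> q" "p \<noteq> c" "q \<noteq> c" for p q
  proof (rule ccontr)
    assume "\<not> ?thesis"
    then obtain r2 where r2: "r2 \<in> A" "- {p} \<subseteq> Ex r2" using fB[of p] by blast
    have q2: "p \<in> Ex r" "q \<in> Ex r" "q \<in> Ex r2" "c \<in> Ex r2" using E r2(2) pq by auto
    have nq: "q \<notin> Ex b" if b: "b \<in> B" for b
    proof
      assume "q \<in> Ex b"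
      then show False
        using Ex_path[of r b r2 q p c] r b r2 adj[OF r b] adj[OF r2(1) b] stableD[OF st(1) r r2(1)] sub q2 pq by blast
    qed
    then obtain r3 where r3: "r3 \<in> A" "- {q} \<subseteq> Ex r3" using fB[of q] by blast
    obtain b where b: "b \<in> B" using ne by blast
    define rr where "rr i = (if i = c then r else if i = p then r2 else r3)" for i
    have rA: "rr i \<in> A" for i unfolding rr_def using r r2 r3 by simp
    show False
    proof (rule Ex_claw[of b rr])
      show "- {i} \<subseteq> Ex (rr i)" for i
        using col_cases3[of c p q i] pq E r2 r3 unfolding rr_def by auto
      show "adj b (rr i)" for i using adj[OF rA b] by simp
      show "\<not> adj (rr i) (rr j)" for i j by (rule stableD[OF st(1) rA rA])
      show "rr i \<in> W" for i using rA sub by blast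
      show "b \<in> W" using b sub by blast
    qed
  qed
  obtain s where s: "s \<in> B" "p \<in> Ex s" using seen[of p q] pq by blast
  obtain s' where s': "s' \<in> B" "q \<in> Ex s'" using seen[of q p] pq by blast
  show False
    by (rule Ex_square[of r r' s s' c p q])
      (use r r' s s' sub E adj stableD[OF st(1)] stableD[OF st(2)] pq in auto)
qed

text \<open>On failure, no vertex excludes two colours, by \<open>bipartite_no_pair\<close>. So each
  side has, for every colour, a vertex excluding exactly that colour: the situation of
  \<open>Ex_K33\<close>.\<close>

lemma avoids_bipartite:
  assumes sub: "A \<subseteq> W" "B \<subseteq> W" and cm: "complete_to A B" and st: "stable A" "stable B" and ne: "A \<noteq> {}" "B \<noteq> {}"
  shows "\<exists>h. avoids (A \<union> B) Ex h"
proof (rule ccontr)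
  assume no: "\<not> ?thesis"
  \<comment> \<open>With \<open>A\<close> constantly coloured \<open>c\<close>, the vertices of the
    stable set \<open>B\<close> can be coloured independently.\<close>
  have mode: "(\<exists>a\<in>A. c \<in> Ex a) \<or> (\<exists>b\<in>B. - {c} \<subseteq> Ex b)"
    if no: "\<not> (\<exists>h. avoids (A \<union> B) Ex h)" and st: "stable A" "stable B" and d: "A \<inter> B = {}" for A B c
  proof (rule ccontr)
    assume n: "\<not> ?thesis"
    obtain h where "avoids B (\<lambda>v. insert c (Ex v)) h"
      using avoids_stable[OF st(2), of "\<lambda>v. insert c (Ex v)"] n by blast
    then show False using avoids_join[OF d st(1), of c Ex h] n no by blast
  qed
  note dis = complete_disjoint[OF cm] complete_disjoint[OF complete_to_sym[OF cm]]
  have fA: "\<And>c. (\<exists>a\<in>A. c \<in> Ex a) \<or> (\<exists>b\<in>B. - {c} \<subseteq> Ex b)" by (rule mode[OF no st dis(1)])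
  have fB: "\<And>c. (\<exists>b\<in>B. c \<in> Ex b) \<or> (\<exists>a\<in>A. - {c} \<subseteq> Ex a)"
    by (rule mode[OF _ st(2,1) dis(2)]) (use no in \<open>simp add: Un_commute\<close>)
  have pA: "\<not> - {c} \<subseteq> Ex a" if "a \<in> A" for a c by (rule bipartite_no_pair[OF sub cm st ne(2) fA fB that])
  have pB: "\<not> - {c} \<subseteq> Ex b" if "b \<in> B" for b c
    by (rule bipartite_no_pair[OF sub(2,1) complete_to_sym[OF cm] st(2,1) ne(1) fB fA that])
  have "\<forall>c. \<exists>a. a \<in> A \<and> c \<in> Ex a" using fA pB by blast
  then obtain r where r: "\<And>c. r c \<in> A" "\<And>c. c \<in> Ex (r c)" by metis
  have "\<forall>c. \<exists>b. b \<in> B \<and> c \<in> Ex b" using fB pA by blast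
  then obtain s where s: "\<And>c. s c \<in> B" "\<And>c. c \<in> Ex (s c)" by metis
  have single: "E = {c}" if E: "c \<in> E" "\<And>c. \<not> - {c} \<subseteq> E" for E and c :: col
  proof (rule ccontr)
    assume "E \<noteq> {c}"
    then obtain d where d: "d \<in> E" "d \<noteq> c" using E(1) by blast
    obtain m where m: "m \<noteq> c" "m \<noteq> d" using third_col by blast
    have "- {m} \<subseteq> E"
    proof
      show "x \<in> E" if "x \<in> - {m}" for x using col_cases3[of c d m x] d m E(1) that by auto
    qed
    then show False using E(2) by blast
  qed
  show False
  proof (rule Ex_K33[of r s])
    show "Ex (r i) = {i}" for i by (rule single[OF r(2)]) (rule pA[OF r(1)])
    show "Ex (s i) = {i}" for i by (rule single[OF s(2)]) (rule pB[OF s(1)])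
    show "adj (r i) (s j)" for i j using complete_toD[OF cm r(1) s(1)] by simp
    show "\<not> adj (r i) (r j)" "\<not> adj (s i) (s j)" for i j
      by (rule stableD[OF st(1) r(1) r(1)], rule stableD[OF st(2) s(1) s(1)])
    show "r i \<in> W" "s i \<in> W" for i using r(1) s(1) sub by blast+
  qed
qed

text \<open>As \<open>B\<close> has an edge, all vertices of \<open>A\<close> are twins, so any
  colour outside \<open>Ex a0\<close> could serve for the whole of \<open>A\<close>. Failure
  provides for each such colour \<open>c\<close> a vertex \<open>e c\<close> of \<open>B\<close>
  that excludes the other two.\<close>

lemma avoids_stable_edge:
  assumes sub: "A \<subseteq> W" "B \<subseteq> W" and fin: "finite B" and cm: "complete_to A B" and st: "stable A" and ne: "A \<noteq> {}"
    and nst: "\<not> stable B"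
  shows "\<exists>h. avoids (A \<union> B) Ex h"
proof (rule ccontr)
  assume no: "\<not> ?thesis"
  note adj = complete_toD[OF cm]
  obtain u v where uv: "u \<in> B" "v \<in> B" "adj u v" using not_stable[OF nst] by blast
  obtain a0 where a0: "a0 \<in> A" using ne by blast
  have a0W: "a0 \<in> W" using a0 sub by blast
  have const: "Ex a = Ex a0" if a: "a \<in> A" for a
    by (rule Ex_twin[of a a0 u v]) (use a a0 uv sub adj stableD[OF st a a0] in auto)
  have colour: "\<not> (\<exists>h. avoids B (\<lambda>v. insert c (Ex v)) h)" if "c \<notin> Ex a0" for c
    using avoids_join[OF complete_disjoint[OF cm] st, of c Ex] const that no by auto
  \<comment> \<open>This supplies the hypothesis \<open>edges\<close> of
    \<open>avoid_colour\<close>. A colour \<open>p\<close> excluded along an edge of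
    \<open>B\<close> is not in \<open>Ex a0\<close>, so some \<open>e\<close> admits at most
    \<open>p\<close>; each way of attaching \<open>e\<close> to that edge is impossible.\<close>
  have nedge: False if d: "d \<in> B" "d' \<in> B" "adj d d'" "p \<in> Ex d" "p \<in> Ex d'" for d d' p
  proof -
    have W: "d \<in> W" "d' \<in> W" using d sub by auto
    have "p \<notin> Ex a0" using Ex_triangle[OF a0W W _ d(3) _ _ d(4,5)] adj[OF a0] d by blast
    then have n: "\<not> (\<exists>h. avoids B (\<lambda>v. insert p (Ex v)) h)" by (rule colour)
    have two: "q = p" if "e \<in> B" "e' \<in> B" "adj e e'" "q \<in> Ex e" "q \<in> Ex e'" for e e' q
      by (rule Ex_two_edges[of a0 e e' d d']) (use that d a0 sub adj in auto)
    have "\<exists>e\<in>B. - {p} \<subseteq> Ex e"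
    proof (rule ccontr)
      assume "\<not> ?thesis"
      then have "\<exists>h. avoids B (\<lambda>v. insert p (Ex v)) h"
        by (intro avoid_colour[OF a0W fin sub(2)]) (use adj[OF a0] two in blast)+
      then show False using n by blast
    qed
    then obtain e where e: "e \<in> B" "- {p} \<subseteq> Ex e" by blast
    have eW: "e \<in> W" using e sub by blast
    have pe: "p \<notin> Ex e" by (rule Ex_single[OF eW e(2)])
    have half: False if de: "adj d e" "\<not> adj d' e" and d: "d \<in> B" "d' \<in> B" "adj d d'" "p \<in> Ex d" "p \<in> Ex d'" for d d'
    proof -
      have "Ex d' = Ex e"
        by (rule Ex_twin[of d' e a0 d]) (use de d e a0 sub adj adj_sym in auto)
      then show False using pe d by simp
    qed
    show False
    proof (cases "adj d e"; cases "adj d' e")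
      assume "adj d e" "adj d' e"
      then show False using no_K4[of a0 d d' e] d e a0 sub adj by auto
    next
      assume "adj d e" "\<not> adj d' e"
      then show False by (rule half) (use d in auto)
    next
      assume "\<not> adj d e" "adj d' e"
      then show False using half[of d' d] d adj_sym by blast
    next
      assume "\<not> adj d e" "\<not> adj d' e"
      then show False using Ex_paw[of a0 d d' e p] d e a0 sub adj by auto
    qed
  qed
  have "\<exists>e\<in>B. - {c} \<subseteq> Ex e" if "c \<notin> Ex a0" for c
  proof (rule ccontr)
    assume "\<not> ?thesis"
    then have "\<exists>h. avoids B (\<lambda>v. insert c (Ex v)) h"
      by (intro avoid_colour[OF a0W fin sub(2)]) (use adj[OF a0] nedge in blast)+
    then show False using colour[OF that] by blast
  qed
  then obtain e where e: "\<And>c. c \<notin> Ex a0 \<Longrightarrow> e c \<in> B" "\<And>c. c \<notin> Ex a0 \<Longrightarrow> - {c} \<subseteq> Ex (e c)" by metis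
  have nadj: "\<not> adj (e c) (e d)" if "c \<notin> Ex a0" "d \<notin> Ex a0" for c d
  proof
    assume a: "adj (e c) (e d)"
    obtain m where m: "m \<noteq> c" "m \<noteq> d" using third_col by blast
    then have "m \<in> Ex (e c)" "m \<in> Ex (e d)" using e(2) that by auto
    then show False using nedge[OF e(1,1) a] that by blast
  qed
  have eadj: "adj a0 (e c)" "adj (e c) a0" "e c \<in> W" if "c \<notin> Ex a0" for c
    using adj[OF a0 e(1)[OF that]] e(1)[OF that] sub by auto
  obtain m where m: "m \<notin> Ex a0" using Ex_not_UNIV[OF a0W] by blast
  obtain p q where pq: "p \<noteq> q" "p \<noteq> m" "q \<noteq> m" "- {m} = {p, q}" using other_cols[of m] by blast
  have one: False if pq: "p \<noteq> q" "p \<noteq> m" "q \<noteq> m" and p: "p \<in> Ex a0" "q \<notin> Ex a0" for p q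
    by (rule Ex_path[of "e m" a0 "e q" p q m]) (use pq p m a0W nadj eadj e(2)[OF m] e(2)[OF p(2)] in auto)
  \<comment> \<open>If \<open>Ex a0\<close> has two colours, \<open>Ex_edge\<close> applies; if it
    has none, \<open>Ex_claw\<close>; if it has one, \<open>Ex_path\<close>.\<close>
  show False
  proof (cases "p \<in> Ex a0"; cases "q \<in> Ex a0")
    assume a: "p \<in> Ex a0" "q \<in> Ex a0"
    have "p \<in> Ex (e m)" "q \<in> Ex (e m)" using e(2)[OF m] pq by auto
    then show False using Ex_edge[OF a0W eadj(3,1)[OF m] pq(1)] a by blast
  next
    assume a: "p \<notin> Ex a0" "q \<notin> Ex a0"
    have "c \<notin> Ex a0" for c using a m col_cases3[of p q m c] pq by auto
    then show False using Ex_claw[OF a0W eadj(3,1) nadj e(2)] by blast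
  qed (use one[of p q] one[of q p] pq in blast)+
qed

text \<open>As \<open>W\<close> contains no \<open>K4\<close>, at least one side of a join is
  stable.\<close>

lemma avoids_exists:
  assumes K: "finite K" "K \<subseteq> W"
  shows "\<exists>h. avoids K Ex h"
proof -
  have "P4_free K" by (rule P4_free_subset[OF good_state(4)]) (use K(2) W_R in blast)
  with K(1) show ?thesis
  proof (induction rule: cograph_induct)
    case (stable A)
    then show ?case using Ex_not_UNIV K(2) by (intro avoids_stable) blast+
  next
    case (anticomplete A B)
    then show ?case using avoids_union by blast
  next
    case (complete A B)
    have sub: "A \<subseteq> W" "B \<subseteq> W" "finite A" "finite B" using complete(1,2) K finite_subset by blast+
    note cm = complete(5) and ne = complete(3,4)
    have "stable A \<or> stable B"
    proof (rule ccontr)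
      assume "\<not> ?thesis"
      then obtain u v x y where "u \<in> A" "v \<in> A" "adj u v" "x \<in> B" "y \<in> B" "adj x y" using not_stable by metis
      then show False using no_K4[of u v x y] complete_toD[OF cm] sub by auto
    qed
    then consider "stable A" "stable B" | "stable A" "\<not> stable B" | "stable B" "\<not> stable A" by blast
    then show ?case
    proof cases
      case 1
      then show ?thesis by (rule avoids_bipartite[OF sub(1,2) cm _ _ ne])
    next
      case 2
      then show ?thesis by (rule avoids_stable_edge[OF sub(1,2,4) cm _ ne(1)])
    next
      case 3
      then show ?thesis using avoids_stable_edge[OF sub(2,1,3) complete_to_sym[OF cm] _ ne(2)] by (simp add: Un_commute)
    qed
  qed
qed

lemma W_outside: "v \<in> V \<Longrightarrow> v \<notin> W \<Longrightarrow> card (L \<sigma> v) \<le> 2"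
proof -
  assume v: "v \<in> V" "v \<notin> W"
  consider "v \<in> S" | "v \<in> X S" | "v \<in> R S" using v(1) unfolding X_def R_def by blast
  then show ?thesis
  proof cases
    case 1
    then obtain c where "\<sigma> v = Some c" using good_state(1) by blast
    then have "L \<sigma> v \<subseteq> {c}" by (rule L_dom)
    then show ?thesis using card_mono[of "{c}" "L \<sigma> v"] by simp
  next
    case 2
    then show ?thesis by (rule X_card)
  next
    case 3
    then have "card (L \<sigma> v) \<noteq> 3" using v(2) link_refl unfolding U_def by blast
    moreover have "card (L \<sigma> v) \<le> 3" using card_mono[of UNIV "L \<sigma> v"] by simp
    ultimately show ?thesis by simp
  qed
qed

lemma W_neighbour: "adj u v \<Longrightarrow> u \<in> W \<Longrightarrow> v \<notin> W \<Longrightarrow> v \<in> X S"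
proof (rule ccontr)
  assume a: "adj u v" "u \<in> W" "v \<notin> W" "v \<notin> X S"
  have "v \<notin> S" using R_nonadj[OF W_R[OF a(2)], of v] a(1) by blast
  then have v: "v \<in> R S" using a(4) adj_V2[OF a(1)] unfolding X_def R_def by blast
  then have "(v, u) \<in> link S" using W_R[OF a(2)] adj_sym[OF a(1)] unfolding link_def by blast
  then show False using a(2,3) v link_trans unfolding U_def by blast
qed

text \<open>\<open>W\<close> is coloured by the cograph argument and the rest by \<open>f\<close>.
  Edges between the two are respected because the outer end lies in \<open>X S\<close> and is thus
  recorded in \<open>Ex\<close>.\<close>

lemma ext_colourable: "\<exists>h :: 'a \<Rightarrow> col. \<forall>u v. adj u v \<longrightarrow> h u \<noteq> h v"
proof -
  have "W \<subseteq> V" using W_V by blast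
  then obtain h where h: "avoids W Ex h" using avoids_exists[of W] finite_subset[OF _ finV, of W] by blast
  define c where "c v = (if v \<in> W then h v else f v)" for v
  have mixed: "c u \<noteq> c v" if uv: "adj u v" "u \<in> W" "v \<notin> W" for u v
  proof -
    have "f v \<in> Ex u" unfolding Ex_def using W_neighbour[OF uv] adj_sym[OF uv(1)] by blast
    then show ?thesis using h uv(2,3) unfolding avoids_def c_def by auto
  qed
  have "c u \<noteq> c v" if uv: "adj u v" for u v
  proof (cases "u \<in> W"; cases "v \<in> W")
    assume "u \<in> W" "v \<in> W"
    then show ?thesis using h uv unfolding avoids_def c_def by simp
  next
    assume w: "u \<notin> W" "v \<notin> W"
    obtain \<tau> where t: "\<tau> \<in> H" "\<tau> u = Some (f u)" "\<tau> v = Some (f v)"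
      using pair[of u v] W_outside w adj_V[OF uv] adj_V2[OF uv] by blast
    then show ?thesis using H_proper[OF t(1) uv t(2,3)] w unfolding c_def by simp
  qed (use mixed uv adj_sym in metis)+
  then show ?thesis by blast
qed

end

lemma (in strat) colourable:
  assumes k: "k \<ge> 200000"
  shows "\<exists>h :: 'a \<Rightarrow> col. \<forall>u v. adj u v \<longrightarrow> h u \<noteq> h v"
proof -
  obtain S \<sigma> where g: "good S \<sigma>" by (rule good_exists[OF k])
  let ?C = "{u \<in> V. card (L \<sigma> u) \<le> 2}"
  have "\<exists>f. \<forall>u\<in>?C. \<forall>v\<in>?C. \<exists>\<tau>\<in>H. \<sigma> \<subseteq>\<^sub>m \<tau> \<and> \<tau> u = Some (f u) \<and> \<tau> v = Some (f v)"
    by (rule pairwise_consistent) (use g finV in \<open>auto simp: good_def\<close>)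
  then obtain f where f: "\<forall>u\<in>?C. \<forall>v\<in>?C. \<exists>\<tau>\<in>H. \<sigma> \<subseteq>\<^sub>m \<tau> \<and> \<tau> u = Some (f u) \<and> \<tau> v = Some (f v)" by blast
  interpret ext V adj k H S \<sigma> f
    by unfold_locales (use g f in auto)
  show ?thesis by (rule ext_colourable)
qed

section \<open>Programs with bounded running time\<close>

text \<open>As \<open>exec\<close> is deterministic, the existence of one halting run amounts to
  total correctness.\<close>

definition halts :: "prog \<Rightarrow> state \<Rightarrow> nat \<Rightarrow> (state \<Rightarrow> bool) \<Rightarrow> bool" where
  "halts P s b Q \<longleftrightarrow> (\<exists>t s'. exec P s t s' \<and> t \<le> b \<and> Q s')"

lemma halts_mono: "halts P s b Q \<Longrightarrow> b \<le> b' \<Longrightarrow> (\<And>s'. Q s' \<Longrightarrow> Q' s') \<Longrightarrow> halts P s b' Q'"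
  unfolding halts_def by (meson le_trans)

lemma halts_Skip: "Q s \<Longrightarrow> halts Skip s 1 Q"
  unfolding halts_def using exec.Skip by blast

lemma halts_Assign: "Q ((fst s)(x := eval_expr a s), snd s) \<Longrightarrow> halts (Assign x a) s (expr_cost a + 1) Q"
  unfolding halts_def using exec.Assign by blast

lemma halts_Store: "Q (fst s, (snd s)(eval_expr a s := eval_expr b s)) \<Longrightarrow>
    halts (Store a b) s (expr_cost a + expr_cost b + 1) Q"
  unfolding halts_def using exec.Store by blast

lemma halts_Seq:
  assumes "halts P s b Q" "\<And>s'. Q s' \<Longrightarrow> halts P' s' b' Q'"
  shows "halts (Seq P P') s (b + b') Q'"
proof -
  obtain t s' where 1: "exec P s t s'" "t \<le> b" "Q s'" using assms(1) unfolding halts_def by blast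
  obtain t' s'' where 2: "exec P' s' t' s''" "t' \<le> b'" "Q' s''" using assms(2)[OF 1(3)] unfolding halts_def by blast
  have "exec (Seq P P') s (t + t') s''" by (rule exec.Seq[OF 1(1) 2(1)])
  moreover have "t + t' \<le> b + b'" using 1(2) 2(2) by simp
  ultimately show ?thesis using 2(3) unfolding halts_def by blast
qed

lemma halts_Seq_eq: "halts P s b ((=) s1) \<Longrightarrow> halts P' s1 b' Q \<Longrightarrow> halts (Seq P P') s (b + b') Q"
  by (rule halts_Seq[where Q = "(=) s1"]) simp_all

lemma halts_Seq_Assign:
  "halts P ((fst s)(x := eval_expr a s), snd s) b Q \<Longrightarrow> halts (Seq (Assign x a) P) s (expr_cost a + 1 + b) Q"
  by (rule halts_Seq_eq[OF halts_Assign]) simp_all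

lemma halts_Cond:
  assumes "eval_expr a s \<noteq> 0 \<Longrightarrow> halts P s b Q" "eval_expr a s = 0 \<Longrightarrow> halts P' s b Q"
  shows "halts (Cond a P P') s (expr_cost a + 1 + b) Q"
proof (cases "eval_expr a s = 0")
  case True
  then obtain t s' where "exec P' s t s'" "t \<le> b" "Q s'" using assms(2) unfolding halts_def by blast
  moreover from this True have "exec (Cond a P P') s (expr_cost a + 1 + t) s'" by (intro exec.CondFalse)
  ultimately show ?thesis unfolding halts_def by (meson add_left_mono)
next
  case False
  then obtain t s' where "exec P s t s'" "t \<le> b" "Q s'" using assms(1) unfolding halts_def by blast
  moreover from this False have "exec (Cond a P P') s (expr_cost a + 1 + t) s'" by (intro exec.CondTrue)
  ultimately show ?thesis unfolding halts_def by (meson add_left_mono)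
qed

text \<open>The index of the invariant decreases in every round and so bounds their number.\<close>

lemma halts_While:
  assumes I: "I i s"
    and step: "\<And>i s. I i s \<Longrightarrow> eval_expr a s \<noteq> 0 \<Longrightarrow> halts P s b (\<lambda>s'. \<exists>j<i. I j s')"
    and stop: "\<And>i s. I i s \<Longrightarrow> eval_expr a s = 0 \<Longrightarrow> Q s"
  shows "halts (While a P) s (i * (expr_cost a + 1 + b) + expr_cost a + 1) Q"
  using I
proof (induction i arbitrary: s rule: less_induct)
  case (less i)
  show ?case
  proof (cases "eval_expr a s = 0")
    case True
    then have "exec (While a P) s (expr_cost a + 1) s" by (rule exec.WhileFalse)
    then show ?thesis using stop[OF less.prems True] unfolding halts_def
      by (intro exI[of _ "expr_cost a + 1"] exI[of _ s]) simp
  next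
    case False
    then obtain t s' j where 1: "exec P s t s'" "t \<le> b" "j < i" "I j s'"
      using step[OF less.prems False] unfolding halts_def by blast
    obtain t' s'' where 2: "exec (While a P) s' t' s''" "t' \<le> j * (expr_cost a + 1 + b) + expr_cost a + 1" "Q s''"
      using less.IH[OF 1(3,4)] unfolding halts_def by blast
    have "exec (While a P) s (expr_cost a + 1 + t + t') s''" by (rule exec.WhileTrue[OF False 1(1) 2(1)])
    moreover have "expr_cost a + 1 + t + t' \<le> i * (expr_cost a + 1 + b) + expr_cost a + 1"
    proof -
      have "Suc j * (expr_cost a + 1 + b) \<le> i * (expr_cost a + 1 + b)" using 1(3) by (intro mult_le_mono1) simp
      then show ?thesis using 1(2) 2(2) by simp
    qed
    ultimately show ?thesis using 2(3) unfolding halts_def by blast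
  qed
qed

definition For :: "nat \<Rightarrow> expr \<Rightarrow> prog \<Rightarrow> prog" where
  "For x a P = Seq (Assign x (Num 0)) (While (Minus a (Reg x)) (Seq P (Assign x (Plus (Reg x) (Num 1)))))"

text \<open>The limit is evaluated anew in each round, so \<open>a\<close> has to keep the value
  \<open>m\<close>. The 7 accounts for the test and the increment of the counter.\<close>

lemma halts_For:
  assumes init: "I 0 ((fst s)(x := 0), snd s)"
    and bound: "\<And>i s. I i s \<Longrightarrow> fst s x = i \<and> eval_expr a s = m"
    and step: "\<And>i s. I i s \<Longrightarrow> i < m \<Longrightarrow> halts P s b (\<lambda>s'. fst s' x = i \<and> I (Suc i) ((fst s')(x := Suc i), snd s'))"
    and stop: "\<And>s. I m s \<Longrightarrow> Q s"
    and time: "m * (expr_cost a + b + 7) + expr_cost a + 5 \<le> T"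
  shows "halts (For x a P) s T Q"
proof -
  define J where "J d t \<longleftrightarrow> (\<exists>i\<le>m. d = m - i \<and> I i t)" for d t
  have "halts (While (Minus a (Reg x)) (Seq P (Assign x (Plus (Reg x) (Num 1))))) ((fst s)(x := 0), snd s)
      (m * (expr_cost (Minus a (Reg x)) + 1 + (b + 4)) + expr_cost (Minus a (Reg x)) + 1) Q"
  proof (rule halts_While[of J])
    show "J m ((fst s)(x := 0), snd s)" unfolding J_def using init by auto
  next
    fix d t assume "J d t" and nz: "eval_expr (Minus a (Reg x)) t \<noteq> 0"
    then obtain i where i: "d = m - i" "I i t" unfolding J_def by blast
    then have im: "i < m" using nz bound[OF i(2)] by simp
    have "J (m - Suc i) t'" if "I (Suc i) t'" for t' unfolding J_def using im that by (intro exI[of _ "Suc i"]) simp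
    moreover have "m - Suc i < d" using i im by simp
    ultimately have ex: "I (Suc i) t' \<Longrightarrow> \<exists>j<d. J j t'" for t' by blast
    show "halts (Seq P (Assign x (Plus (Reg x) (Num 1)))) t (b + 4) (\<lambda>s'. \<exists>j<d. J j s')"
      by (rule halts_Seq[OF step[OF i(2) im]], rule halts_mono[OF halts_Assign[of "\<lambda>s'. \<exists>j<d. J j s'"]])
        (use ex in auto)
  next
    fix d t assume "J d t" and z: "eval_expr (Minus a (Reg x)) t = 0"
    then obtain i where i: "i \<le> m" "I i t" unfolding J_def by blast
    then have "i = m" using z bound[OF i(2)] by simp
    then show "Q t" using i stop by simp
  qed
  note W = this
  have "halts (For x a P) s (expr_cost (Num 0) + 1 +
      (m * (expr_cost (Minus a (Reg x)) + 1 + (b + 4)) + expr_cost (Minus a (Reg x)) + 1)) Q"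
    unfolding For_def by (rule halts_Seq_Assign, simp only: eval_expr.simps, rule W)
  then show ?thesis by (rule halts_mono) (use time in \<open>simp_all add: algebra_simps\<close>)
qed

text \<open>Repeated subtraction is fast enough, since the numbers divided are at most
  \<open>(3 n) ^ k\<close>, a polynomial for fixed \<open>k\<close>. The loop test is nonzero iff
  the divisor is at most the current remainder.\<close>

definition divmod :: "nat \<Rightarrow> nat \<Rightarrow> nat \<Rightarrow> nat \<Rightarrow> prog" where
  "divmod q r x y = Seq (Assign r (Reg x)) (Seq (Assign q (Num 0))
     (While (Minus (Plus (Reg r) (Num 1)) (Reg y)) (Seq (Assign r (Minus (Reg r) (Reg y))) (Assign q (Plus (Reg q) (Num 1))))))"

lemma halts_divmod:
  assumes y: "fst s y > 0" and d: "q \<noteq> r" "y \<noteq> q" "y \<noteq> r"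
  shows "halts (divmod q r x y) s (14 * fst s x + 10)
    ((=) ((fst s)(r := fst s x mod fst s y, q := fst s x div fst s y), snd s))"
proof -
  define I where "I d t \<longleftrightarrow> (\<exists>m. d = m \<and> fst s x = m + fst t q * fst s y \<and> t = ((fst s)(r := m, q := fst t q), snd s))" for d t
  have "halts (While (Minus (Plus (Reg r) (Num 1)) (Reg y)) (Seq (Assign r (Minus (Reg r) (Reg y))) (Assign q (Plus (Reg q) (Num 1)))))
     ((fst s)(r := fst s x, q := 0), snd s) (fst s x * (5 + 1 + 8) + 5 + 1)
     ((=) ((fst s)(r := fst s x mod fst s y, q := fst s x div fst s y), snd s))"
  proof (rule halts_mono[OF halts_While[of I]])
    show "I (fst s x) ((fst s)(r := fst s x, q := 0), snd s)" unfolding I_def by auto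
  next
    fix m t assume "I m t" and nz: "eval_expr (Minus (Plus (Reg r) (Num 1)) (Reg y)) t \<noteq> 0"
    then have t: "fst s x = m + fst t q * fst s y" "t = ((fst s)(r := m, q := fst t q), snd s)" unfolding I_def by auto
    have vals: "fst t r = m" "fst t y = fst s y" using d by (subst t(2), simp)+
    have my: "fst s y \<le> m" using nz vals by simp
    let ?t = "((fst s)(r := m - fst s y, q := Suc (fst t q)), snd s)"
    have eq: "((fst t)(r := m - fst s y, q := Suc (fst t q)), snd t) = ?t"
      by (subst t(2), subst (3) t(2)) (use d in \<open>auto simp: fun_eq_iff\<close>)
    have "I (m - fst s y) ?t" unfolding I_def using t(1) my by simp
    then have "\<exists>j<m. I j ?t" using my y by (intro exI[of _ "m - fst s y"]) auto
    then show "halts (Seq (Assign r (Minus (Reg r) (Reg y))) (Assign q (Plus (Reg q) (Num 1)))) t 8 (\<lambda>s'. \<exists>j<m. I j s')"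
      by (intro halts_mono[OF halts_Seq_Assign[OF halts_Assign]]) (use d vals eq in auto)
  next
    fix m t assume "I m t" and z: "eval_expr (Minus (Plus (Reg r) (Num 1)) (Reg y)) t = 0"
    then have t: "fst s x = m + fst t q * fst s y" "t = ((fst s)(r := m, q := fst t q), snd s)" unfolding I_def by auto
    have vals: "fst t r = m" "fst t y = fst s y" using d by (subst t(2), simp)+
    have "m < fst s y" using z vals by simp
    then have "fst s x mod fst s y = m" "fst s x div fst s y = fst t q" using t(1) by simp_all
    then show "((fst s)(r := fst s x mod fst s y, q := fst s x div fst s y), snd s) = t" using t(2) by simp
  qed simp_all
  note W = this
  have "halts (divmod q r x y) s (expr_cost (Reg x) + 1 + (expr_cost (Num 0) + 1 + (fst s x * (5 + 1 + 8) + 5 + 1)))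
    ((=) ((fst s)(r := fst s x mod fst s y, q := fst s x div fst s y), snd s))"
    unfolding divmod_def
    by (rule halts_Seq_Assign, rule halts_Seq_Assign, simp only: eval_expr.simps fst_conv snd_conv, rule W)
  then show ?thesis by (rule halts_mono) (simp_all add: algebra_simps)
qed

definition mul :: "nat \<Rightarrow> nat \<Rightarrow> nat \<Rightarrow> nat \<Rightarrow> prog" where
  "mul z t x y = Seq (Assign t (Reg x)) (Seq (Assign z (Num 0))
     (While (Reg t) (Seq (Assign z (Plus (Reg z) (Reg y))) (Assign t (Minus (Reg t) (Num 1))))))"

lemma halts_mul:
  assumes d: "z \<noteq> t" "y \<noteq> z" "y \<noteq> t"
  shows "halts (mul z t x y) s (10 * fst s x + 6) ((=) ((fst s)(z := fst s x * fst s y, t := 0), snd s))"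
proof -
  define I where "I d u \<longleftrightarrow> (\<exists>m. fst s x = d + m \<and> u = ((fst s)(t := d, z := m * fst s y), snd s))" for d u
  have "halts (While (Reg t) (Seq (Assign z (Plus (Reg z) (Reg y))) (Assign t (Minus (Reg t) (Num 1)))))
     ((fst s)(t := fst s x, z := 0), snd s) (fst s x * (1 + 1 + 8) + 1 + 1)
     ((=) ((fst s)(z := fst s x * fst s y, t := 0), snd s))"
  proof (rule halts_mono[OF halts_While[of I]])
    show "I (fst s x) ((fst s)(t := fst s x, z := 0), snd s)" unfolding I_def by auto
  next
    fix i u assume "I i u" and nz: "eval_expr (Reg t) u \<noteq> 0"
    then obtain m where u: "fst s x = i + m" "u = ((fst s)(t := i, z := m * fst s y), snd s)" unfolding I_def by blast
    have i: "i > 0" using nz d u(2) by simp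
    have "I (i - 1) ((fst s)(t := i - 1, z := Suc m * fst s y), snd s)"
      unfolding I_def using u(1) i by (intro exI[of _ "Suc m"]) simp
    moreover have "((fst s)(t := i - 1, z := Suc m * fst s y), snd s) =
       ((fst u)(z := fst u z + fst u y, t := fst u t - 1), snd u)" using u(2) d by (auto simp: fun_eq_iff)
    ultimately have "\<exists>j<i. I j ((fst u)(z := fst u z + fst u y, t := fst u t - 1), snd u)"
      using i by (intro exI[of _ "i - 1"]) auto
    then show "halts (Seq (Assign z (Plus (Reg z) (Reg y))) (Assign t (Minus (Reg t) (Num 1)))) u 8 (\<lambda>s'. \<exists>j<i. I j s')"
      by (intro halts_mono[OF halts_Seq_Assign[OF halts_Assign]]) (use d in auto)
  next
    fix i u assume "I i u" and z: "eval_expr (Reg t) u = 0"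
    then obtain m where u: "fst s x = i + m" "u = ((fst s)(t := i, z := m * fst s y), snd s)" unfolding I_def by blast
    have "i = 0" using z d u(2) by simp
    then show "((fst s)(z := fst s x * fst s y, t := 0), snd s) = u" using u d by (auto simp: fun_eq_iff)
  qed simp_all
  note W = this
  have "halts (mul z t x y) s (expr_cost (Reg x) + 1 + (expr_cost (Num 0) + 1 + (fst s x * (1 + 1 + 8) + 1 + 1)))
    ((=) ((fst s)(z := fst s x * fst s y, t := 0), snd s))"
    unfolding mul_def
    by (rule halts_Seq_Assign, rule halts_Seq_Assign, simp only: eval_expr.simps fst_conv snd_conv, rule W)
  then show ?thesis by (rule halts_mono) (simp_all add: algebra_simps)
qed

section \<open>Tables of tuples\<close>

definition digit :: "nat \<Rightarrow> nat \<Rightarrow> nat \<Rightarrow> nat" where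
  "digit M i x = x div M ^ i mod M"

definition encode :: "nat \<Rightarrow> nat \<Rightarrow> (nat \<Rightarrow> nat) \<Rightarrow> nat" where
  "encode M k d = (\<Sum>i<k. d i * M ^ i)"

text \<open>The truncated subtraction is exact below \<open>M ^ k\<close>, where the removed term is
  a summand of \<open>x\<close>. The machine computes table addresses in this form.\<close>

definition replace_digit :: "nat \<Rightarrow> nat \<Rightarrow> nat \<Rightarrow> nat \<Rightarrow> nat" where
  "replace_digit M i e x = x - digit M i x * M ^ i + e * M ^ i"

lemma encode_Suc: "encode M (Suc k) d = d 0 + M * encode M k (\<lambda>i. d (Suc i))"
  unfolding encode_def sum.lessThan_Suc_shift by (simp add: sum_distrib_left mult_ac)

lemma digit_Suc: "digit M (Suc i) x = digit M i (x div M)"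
  unfolding digit_def by (simp add: div_mult2_eq)

lemma digit_less: "0 < M \<Longrightarrow> digit M i x < M"
  unfolding digit_def by simp

lemma encode_less: "(\<And>i. i < k \<Longrightarrow> d i < M) \<Longrightarrow> encode M k d < M ^ k"
proof (induction k arbitrary: d)
  case 0
  then show ?case by (simp add: encode_def)
next
  case (Suc k)
  have "encode M k (\<lambda>i. d (Suc i)) < M ^ k" by (rule Suc.IH) (use Suc.prems in simp)
  then have "M * Suc (encode M k (\<lambda>i. d (Suc i))) \<le> M * M ^ k" by (intro mult_le_mono2) simp
  then show ?case using Suc.prems[of 0] unfolding encode_Suc by simp
qed

lemma digit_encode: "(\<And>i. i < k \<Longrightarrow> d i < M) \<Longrightarrow> i < k \<Longrightarrow> digit M i (encode M k d) = d i"
proof (induction k arbitrary: d i)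
  case 0
  then show ?case by simp
next
  case (Suc k)
  show ?case
  proof (cases i)
    case 0
    then show ?thesis using Suc.prems(1)[of 0] by (simp add: digit_def encode_Suc)
  next
    case (Suc j)
    have "digit M j (encode M k (\<lambda>i. d (Suc i))) = d (Suc j)"
      by (rule Suc.IH) (use Suc.prems Suc in simp_all)
    then show ?thesis using Suc.prems(1)[of 0] Suc by (simp add: digit_Suc encode_Suc)
  qed
qed

lemma encode_digits: "x < M ^ k \<Longrightarrow> encode M k (\<lambda>i. digit M i x) = x"
proof (induction k arbitrary: x)
  case 0
  then show ?case by (simp add: encode_def)
next
  case (Suc k)
  have "encode M k (\<lambda>i. digit M i (x div M)) = x div M"
    by (rule Suc.IH) (use Suc.prems in \<open>simp add: less_mult_imp_div_less mult.commute\<close>)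
  then show ?case by (simp add: encode_Suc digit_Suc) (simp add: digit_def)
qed

lemma replace_digit_encode:
  assumes "x < M ^ k" "i < k"
  shows "replace_digit M i e x = encode M k ((\<lambda>j. digit M j x)(i := e))"
proof -
  let ?r = "\<Sum>j\<in>{..<k} - {i}. digit M j x * M ^ j"
  have "x = digit M i x * M ^ i + ?r"
    using encode_digits[OF assms(1)] assms(2) unfolding encode_def by (simp add: sum.remove)
  moreover have "encode M k ((\<lambda>j. digit M j x)(i := e)) = e * M ^ i + ?r"
    using assms(2) unfolding encode_def by (simp add: sum.remove)
  ultimately show ?thesis unfolding replace_digit_def by simp
qed

lemma replace_digit_less: "x < M ^ k \<Longrightarrow> i < k \<Longrightarrow> e < M \<Longrightarrow> replace_digit M i e x < M ^ k"
  unfolding replace_digit_encode by (rule encode_less) (auto simp: digit_less)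

lemma digit_replace:
  assumes "x < M ^ k" "i < k" "e < M" "j < k"
  shows "digit M j (replace_digit M i e x) = (if j = i then e else digit M j x)"
  unfolding replace_digit_encode[OF assms(1,2)]
  by (subst digit_encode) (use assms in \<open>auto simp: digit_less\<close>)

text \<open>A number below \<open>(3 n) ^ k\<close> encodes a \<open>k\<close>-tuple of digits, and the digit \<open>3 v + c\<close> says that vertex \<open>v\<close>
  receives colour \<open>c\<close>. The set \<open>D\<close> consists of the tuples that have been discarded.\<close>

definition conflict :: "(nat \<Rightarrow> nat \<Rightarrow> bool) \<Rightarrow> nat \<Rightarrow> nat \<Rightarrow> bool" where
  "conflict A e e' \<longleftrightarrow> e div 3 = e' div 3 \<and> e \<noteq> e' \<or> A (e div 3) (e' div 3) \<and> e mod 3 = e' mod 3"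

definition blocked :: "nat \<Rightarrow> nat set \<Rightarrow> nat \<Rightarrow> nat \<Rightarrow> nat \<Rightarrow> bool" where
  "blocked n D x i v \<longleftrightarrow> (\<forall>c<3. replace_digit (3 * n) i (3 * v + c) x \<in> D)"

definition bad :: "(nat \<Rightarrow> nat \<Rightarrow> bool) \<Rightarrow> nat \<Rightarrow> nat \<Rightarrow> nat set \<Rightarrow> nat \<Rightarrow> bool" where
  "bad A n k D x \<longleftrightarrow> (\<exists>i<k. (\<exists>j<k. conflict A (digit (3 * n) i x) (digit (3 * n) j x)) \<or> (\<exists>v<n. blocked n D x i v))"

definition compatible :: "nat \<Rightarrow> nat \<Rightarrow> (nat \<Rightarrow> nat) \<Rightarrow> nat set" where
  "compatible n k h = {x. x < (3 * n) ^ k \<and> (\<forall>i<k. digit (3 * n) i x mod 3 = h (digit (3 * n) i x div 3))}"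

text \<open>If all digits follow \<open>h\<close>, replacing one of them by a vertex
  \<open>v\<close> with its colour \<open>h v\<close> gives again such a tuple, which is not in
  \<open>D\<close>; so no position is blocked.\<close>

lemma compatible_not_bad:
  assumes h: "\<And>v. v < n \<Longrightarrow> h v < 3" "\<And>v w. v < n \<Longrightarrow> w < n \<Longrightarrow> A v w \<Longrightarrow> h v \<noteq> h w"
    and x: "x \<in> compatible n k h" and D: "D \<inter> compatible n k h = {}"
  shows "\<not> bad A n k D x"
proof
  assume "bad A n k D x"
  then obtain i where i: "i < k" and
    c: "(\<exists>j<k. conflict A (digit (3 * n) i x) (digit (3 * n) j x)) \<or> (\<exists>v<n. blocked n D x i v)"
    unfolding bad_def by blast
  have xs: "x < (3 * n) ^ k" and xd: "\<And>i. i < k \<Longrightarrow> digit (3 * n) i x mod 3 = h (digit (3 * n) i x div 3)"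
    using x unfolding compatible_def by auto
  have n: "0 < n" using xs i by (cases "n = 0") (auto simp: power_0_left)
  have dl: "digit (3 * n) j x div 3 < n" for j
    using digit_less[of "3 * n" j x] n by (simp add: less_mult_imp_div_less mult.commute)
  have nc: False if j: "j < k" and cf: "conflict A (digit (3 * n) i x) (digit (3 * n) j x)" for j
    using cf unfolding conflict_def
  proof (elim disjE conjE)
    assume e: "digit (3 * n) i x div 3 = digit (3 * n) j x div 3" "digit (3 * n) i x \<noteq> digit (3 * n) j x"
    then have "digit (3 * n) i x mod 3 = digit (3 * n) j x mod 3" using xd[OF i] xd[OF j] by simp
    then show False using e by (metis div_mult_mod_eq)
  next
    assume "A (digit (3 * n) i x div 3) (digit (3 * n) j x div 3)" "digit (3 * n) i x mod 3 = digit (3 * n) j x mod 3"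
    then show False using h(2)[OF dl dl] xd[OF i] xd[OF j] by metis
  qed
  then obtain v where v: "v < n" "blocked n D x i v" using c by blast
  let ?y = "replace_digit (3 * n) i (3 * v + h v) x"
  have e: "3 * v + h v < 3 * n" using v(1) h(1)[OF v(1)] by linarith
  have "?y < (3 * n) ^ k" by (rule replace_digit_less[OF xs i e])
  moreover have "digit (3 * n) j ?y mod 3 = h (digit (3 * n) j ?y div 3)" if "j < k" for j
    using digit_replace[OF xs i e that] xd[OF that] h(1)[OF v(1)] by simp
  ultimately have "?y \<in> compatible n k h" unfolding compatible_def by simp
  moreover have "?y \<in> D" using v(2) h(1)[OF v(1)] unfolding blocked_def by blast
  ultimately show False using D by blast
qed

lemma compatible_nonempty:
  assumes "0 < n" "\<And>v. v < n \<Longrightarrow> h v < 3"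
  shows "compatible n k h \<noteq> {}"
proof -
  have h: "h 0 < 3 * n" using assms(2)[of 0] assms(1) by linarith
  have "encode (3 * n) k (\<lambda>_. h 0) \<in> compatible n k h"
    unfolding compatible_def using encode_less[of k "\<lambda>_. h 0" "3 * n"] digit_encode[of k "\<lambda>_. h 0" "3 * n"] h assms(2)[OF assms(1)]
    by simp
  then show ?thesis by blast
qed

section \<open>From surviving tuples to a strategy\<close>

definition nth_col :: "nat \<Rightarrow> col" where
  "nth_col c = (if c = 0 then Red else if c = 1 then Green else Blue)"

lemma nth_col_inj: "c < 3 \<Longrightarrow> d < 3 \<Longrightarrow> nth_col c = nth_col d \<longleftrightarrow> c = d"
  unfolding nth_col_def by auto

definition assignments :: "'a list \<Rightarrow> nat \<Rightarrow> nat set \<Rightarrow> ('a \<rightharpoonup> col) set" where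
  "assignments vs k D = {\<tau>. \<exists>x. x < (3 * length vs) ^ k \<and> x \<notin> D \<and> (\<forall>v c. \<tau> v = Some c \<longrightarrow>
     (\<exists>i<k. vs ! (digit (3 * length vs) i x div 3) = v \<and> nth_col (digit (3 * length vs) i x mod 3) = c))}"

lemma strategy_assignments:
  assumes vs: "distinct vs" and k: "0 < k"
    and adj: "\<And>u v. adj u v \<Longrightarrow> adj v u" 
    and stable: "\<And>x. x < (3 * length vs) ^ k \<Longrightarrow> x \<notin> D \<Longrightarrow> \<not> bad (\<lambda>i j. adj (vs ! i) (vs ! j)) (length vs) k D x"
    and x0: "x0 < (3 * length vs) ^ k" "x0 \<notin> D"
  shows "strategy (set vs) adj k (assignments vs k D)"
proof -
  let ?n = "length vs" and ?A = "\<lambda>i j. adj (vs ! i) (vs ! j)"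
  let ?d = "digit (3 * length vs)"
  have n: "0 < ?n" using x0(1) k by (cases "?n = 0") (auto simp: power_0_left)
  have dl: "?d j x div 3 < ?n" for j x
    using digit_less[of "3 * ?n" j x] n by (simp add: less_mult_imp_div_less mult.commute)
  have noconf: "\<not> conflict ?A (?d i x) (?d j x)" if "x < (3 * ?n) ^ k" "x \<notin> D" "i < k" "j < k" for x i j
    using stable[OF that(1,2)] that(3,4) unfolding bad_def by blast
  have unblocked: "\<exists>c<3. replace_digit (3 * ?n) i (3 * v + c) x \<notin> D" if "x < (3 * ?n) ^ k" "x \<notin> D" "i < k" "v < ?n" for x i v
    using stable[OF that(1,2)] that(3,4) unfolding bad_def blocked_def by blast
  show ?thesis unfolding strategy_def
  proof (intro conjI ballI allI impI)
    have "Map.empty \<in> assignments vs k D" unfolding assignments_def using x0 by auto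
    then show "assignments vs k D \<noteq> {}" by blast
  next
    fix \<tau> assume "\<tau> \<in> assignments vs k D"
    then obtain x where x: "\<And>v c. \<tau> v = Some c \<Longrightarrow> (\<exists>i<k. vs ! (?d i x div 3) = v \<and> nth_col (?d i x mod 3) = c)"
      unfolding assignments_def by blast
    show "dom \<tau> \<subseteq> set vs"
    proof
      fix v assume "v \<in> dom \<tau>"
      then obtain i where "vs ! (?d i x div 3) = v" using x by blast
      then show "v \<in> set vs" using dl[of i x] nth_mem by blast
    qed
  next
    fix \<tau> u v assume t: "\<tau> \<in> assignments vs k D" and uv: "adj u v" "u \<in> dom \<tau>" "v \<in> dom \<tau>"
    obtain x where xs: "x < (3 * ?n) ^ k" "x \<notin> D" and
      x: "\<And>v c. \<tau> v = Some c \<Longrightarrow> (\<exists>i<k. vs ! (?d i x div 3) = v \<and> nth_col (?d i x mod 3) = c)"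
      using t unfolding assignments_def by blast
    obtain c d where cd: "\<tau> u = Some c" "\<tau> v = Some d" using uv by blast
    obtain i where i: "i < k" "vs ! (?d i x div 3) = u" "nth_col (?d i x mod 3) = c" using x[OF cd(1)] by blast
    obtain j where j: "j < k" "vs ! (?d j x div 3) = v" "nth_col (?d j x mod 3) = d" using x[OF cd(2)] by blast
    have "?d i x mod 3 \<noteq> ?d j x mod 3" using noconf[OF xs i(1) j(1)] i(2) j(2) uv(1) unfolding conflict_def by auto
    then show "\<tau> u \<noteq> \<tau> v" using i(3) j(3) cd nth_col_inj[of "?d i x mod 3" "?d j x mod 3"] by simp
  next
    fix \<tau> \<sigma> :: "'a \<rightharpoonup> col" assume "\<tau> \<in> assignments vs k D" "\<sigma> \<subseteq>\<^sub>m \<tau>"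
    moreover have "\<tau> v = Some c" if "\<sigma> v = Some c" for v c using \<open>\<sigma> \<subseteq>\<^sub>m \<tau>\<close> that unfolding map_le_def by (metis domI)
    ultimately show "\<sigma> \<in> assignments vs k D" unfolding assignments_def by blast
  next
    fix \<tau> v assume t: "\<tau> \<in> assignments vs k D" and v: "v \<in> set vs" "card (dom \<tau>) < k" "v \<notin> dom \<tau>"
    obtain x where xs: "x < (3 * ?n) ^ k" "x \<notin> D" and
      x: "\<And>v c. \<tau> v = Some c \<Longrightarrow> (\<exists>i<k. vs ! (?d i x div 3) = v \<and> nth_col (?d i x mod 3) = c)"
      using t unfolding assignments_def by blast
    have "\<forall>u\<in>dom \<tau>. \<exists>i. i < k \<and> vs ! (?d i x div 3) = u \<and> Some (nth_col (?d i x mod 3)) = \<tau> u"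
    proof
      fix u assume "u \<in> dom \<tau>"
      then obtain a where a: "\<tau> u = Some a" by blast
      show "\<exists>i. i < k \<and> vs ! (?d i x div 3) = u \<and> Some (nth_col (?d i x mod 3)) = \<tau> u" using x[OF a] a by auto
    qed
    then obtain p where p: "\<And>u. u \<in> dom \<tau> \<Longrightarrow> p u < k \<and> vs ! (?d (p u) x div 3) = u \<and> Some (nth_col (?d (p u) x mod 3)) = \<tau> u"
      by metis
    have "finite (dom \<tau>)"
    proof (rule finite_subset)
      show "dom \<tau> \<subseteq> (\<lambda>i. vs ! (?d i x div 3)) ` {..<k}" 
      proof
        fix u assume "u \<in> dom \<tau>"
        then have "p u < k" "u = vs ! (?d (p u) x div 3)" using p[of u] by simp_all
        then show "u \<in> (\<lambda>i. vs ! (?d i x div 3)) ` {..<k}" by blast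
      qed
    qed simp
    then have "card (p ` dom \<tau>) < card {..<k}" using card_image_le[of "dom \<tau>" p] v(2) by simp
    then have "\<not> {..<k} \<subseteq> p ` dom \<tau>" using card_mono[OF finite_imageI[OF \<open>finite (dom \<tau>)\<close>]] by (meson not_le)
    then obtain i where i: "i < k" "i \<notin> p ` dom \<tau>" by blast
    obtain w where w: "w < ?n" "vs ! w = v" using v(1) by (auto simp: in_set_conv_nth)
    obtain c where c: "c < 3" "replace_digit (3 * ?n) i (3 * w + c) x \<notin> D" using unblocked[OF xs i(1) w(1)] by blast
    let ?y = "replace_digit (3 * ?n) i (3 * w + c) x"
    have e: "3 * w + c < 3 * ?n" using c(1) w(1) by linarith
    note dr = digit_replace[OF xs(1) i(1) e]
    have "\<exists>j<k. vs ! (?d j ?y div 3) = u \<and> nth_col (?d j ?y mod 3) = a" if u: "(\<tau>(v \<mapsto> nth_col c)) u = Some a" for u a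
    proof (cases "u = v")
      case True
      then show ?thesis using u dr[OF i(1)] i(1) c(1) w(2) by (intro exI[of _ i]) simp
    next
      case False
      then have t: "\<tau> u = Some a" using u by simp
      then have ud: "u \<in> dom \<tau>" by blast
      have pu: "p u \<noteq> i" "p u < k" using i(2) ud p[OF ud] by auto
      then show ?thesis using p[OF ud] t dr[OF pu(2)] pu by (intro exI[of _ "p u"]) auto
    qed
    then have "\<tau>(v \<mapsto> nth_col c) \<in> assignments vs k D"
      unfolding assignments_def using replace_digit_less[OF xs(1) i(1) e] c(2) by blast
    then show "\<exists>c. \<tau>(v \<mapsto> c) \<in> assignments vs k D" by blast
  qed
qed

section \<open>The consistency program\<close>

definition keeps :: "nat set \<Rightarrow> state \<Rightarrow> state \<Rightarrow> bool" where
  "keeps X s t \<longleftrightarrow> snd t = snd s \<and> (\<forall>y. y \<notin> X \<longrightarrow> fst t y = fst s y)"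

lemma keeps_reg: "keeps X s t \<Longrightarrow> y \<notin> X \<Longrightarrow> fst t y = fst s y"
  unfolding keeps_def by blast

lemma keeps_mem: "keeps X s t \<Longrightarrow> snd t = snd s"
  unfolding keeps_def by blast

definition table :: "(nat \<Rightarrow> nat \<Rightarrow> bool) \<Rightarrow> nat \<Rightarrow> nat set \<Rightarrow> nat \<Rightarrow> nat" where
  "table A n D y = (if y < n * n then of_bool (A (y div n) (y mod n)) else of_bool (y - n * n \<in> D))"

lemma table_adj: "v < n \<Longrightarrow> w < n \<Longrightarrow> table A n D (v * n + w) = of_bool (A v w)"
proof -
  assume v: "v < n" and w: "w < n"
  have "Suc v * n \<le> n * n" using v by (intro mult_le_mono1) simp
  then have "v * n + w < n * n" using w by simp
  then show ?thesis using w unfolding table_def by simp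
qed

lemma table_dead: "table A n D (n * n + y) = of_bool (y \<in> D)"
  unfolding table_def by simp

lemma table_update: "(table A n D)(n * n + x := 1) = table A n (insert x D)"
  by (auto simp: table_def fun_eq_iff)

text \<open>Register 0 holds \<open>n\<close>, 1 holds \<open>3 n\<close>, 2 holds \<open>N = (3 n) ^ k\<close>, 3 holds \<open>n\<^sup>2\<close>, 4 is the flag that the table
  has changed, 5 the flag that an undiscarded tuple has been seen, 6 the current tuple \<open>x\<close>, 7 counts the reasons
  for discarding it, 8, 15 and 22 are loop counters for positions \<open>i\<close>, \<open>j\<close> and vertices, and 25 holds 3. With
  \<open>e\<close> the \<open>i\<close>-th digit of \<open>x\<close>, 12, 13 and 14 hold \<open>e\<close>, \<open>e div 3\<close> and \<open>e mod 3\<close>, and 18, 19 and 20 the same for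
  the \<open>j\<close>-th digit. The quotients of \<open>x\<close> by powers of \<open>3 n\<close> are in 9 and 16, the power \<open>(3 n) ^ i\<close> is in 10,
  and 21 is the address of the entry of the tuple with the \<open>i\<close>-th digit replaced by \<open>3 v\<close>. The table entry of
  \<open>x\<close> is memory cell \<open>n\<^sup>2 + x\<close>.\<close>

abbreviation dist_expr :: "nat \<Rightarrow> nat \<Rightarrow> expr" where
  "dist_expr a b \<equiv> Plus (Minus (Reg a) (Reg b)) (Minus (Reg b) (Reg a))"

text \<open>In the absence of Boolean connectives, truncated differences test for a conflict: the
  first summand added to register 7 is nonzero iff the digits differ and their vertices agree, the
  second iff the vertices are adjacent and the colours agree.\<close>

definition pair_body :: prog where
  "pair_body = Seq (divmod 17 18 16 1) (Seq (divmod 19 20 18 25) (Seq (Assign 7 (Plus (Reg 7) (Plus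
     (Minus (Minus (Num 1) (Minus (Num 1) (dist_expr 12 18))) (dist_expr 13 19))
     (Minus (Load (Plus (Reg 23) (Reg 19))) (dist_expr 14 20))))) (Assign 16 (Reg 17))))"

lemma conflict_zero:
  assumes "e < 3 * n" "e' < 3 * n"
  shows "(1 - (1 - ((e - e') + (e' - e)))) - ((e div 3 - e' div 3) + (e' div 3 - e div 3))
      + (table A n D (e div 3 * n + e' div 3) - ((e mod 3 - e' mod 3) + (e' mod 3 - e mod 3))) = 0
    \<longleftrightarrow> \<not> conflict A e e'"
proof -
  have "e div 3 < n" "e' div 3 < n" using assms by (simp_all add: less_mult_imp_div_less mult.commute)
  then have t: "table A n D (e div 3 * n + e' div 3) = of_bool (A (e div 3) (e' div 3))" by (rule table_adj)
  have 1: "(1 - (1 - d)) - d' = 0 \<longleftrightarrow> d = 0 \<or> d' \<noteq> 0" for d d' :: nat by linarith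
  have 2: "of_bool P - d = 0 \<longleftrightarrow> \<not> P \<or> d \<noteq> 0" for P and d :: nat by (cases P) (simp_all add: neq0_conv Suc_le_eq)
  have 3: "(a - b) + (b - a) = 0 \<longleftrightarrow> a = b" for a b :: nat by linarith
  show ?thesis unfolding t conflict_def add_eq_0_iff_both_eq_0 1 2 unfolding add_eq_0_iff_both_eq_0[symmetric] 3 by blast
qed

lemma halts_pairs:
  assumes mem: "snd s = table A n D" and reg: "fst s 1 = 3 * n" "fst s 25 = 3" "fst s 16 = x" "fst s 12 = e"
      "fst s 13 = e div 3" "fst s 14 = e mod 3" "fst s 23 = e div 3 * n"
    and e: "e < 3 * n" and x: "x \<le> N"
  shows "halts (For 15 (Num k) pair_body) s (k * (14 * N + 42 * n + 80) + 6)
    (\<lambda>t. keeps {7, 15, 16, 17, 18, 19, 20} s t \<and>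
       (fst t 7 = 0 \<longleftrightarrow> fst s 7 = 0 \<and> (\<forall>j<k. \<not> conflict A e (digit (3 * n) j x))))"
proof -
  let ?X = "{7, 15, 16, 17, 18, 19, 20} :: nat set" and ?M = "3 * n"
  have M: "0 < ?M" using e by simp
  define I where "I j t \<longleftrightarrow> keeps ?X s t \<and> fst t 15 = j \<and> fst t 16 = x div ?M ^ j \<and>
       (fst t 7 = 0 \<longleftrightarrow> fst s 7 = 0 \<and> (\<forall>i<j. \<not> conflict A e (digit ?M i x)))" for j t
  have step: "halts pair_body t (14 * N + 42 * n + 70) (\<lambda>s'. fst s' 15 = j \<and> I (Suc j) ((fst s')(15 := Suc j), snd s'))"
    if I: "I j t" for j t
  proof -
    note K = I[unfolded I_def, THEN conjunct1]
    have r: "fst t 1 = ?M" "fst t 25 = 3" "fst t 12 = e" "fst t 13 = e div 3" "fst t 14 = e mod 3" "fst t 23 = e div 3 * n"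
      using keeps_reg[OF K] reg by simp_all
    have r': "fst t 15 = j" "fst t 16 = x div ?M ^ j"
       "fst t 7 = 0 \<longleftrightarrow> fst s 7 = 0 \<and> (\<forall>i<j. \<not> conflict A e (digit ?M i x))" using I unfolding I_def by auto
    have tm: "snd t = table A n D" using keeps_mem[OF K] mem by simp
    define d where "d = digit ?M j x"
    have dM: "d < ?M" unfolding d_def by (rule digit_less[OF M])
    define y where "y = x div ?M ^ Suc j"
    have y: "y = x div ?M ^ j div ?M" unfolding y_def power_Suc2 div_mult2_eq ..
    let ?t1 = "((fst t)(18 := d, 17 := y), snd t)"
    let ?t2 = "((fst ?t1)(20 := d mod 3, 19 := d div 3), snd t)"
    have 1: "halts (divmod 17 18 16 1) t (14 * N + 10) ((=) ?t1)"
    proof (rule halts_mono[OF halts_divmod])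
      have "x div ?M ^ j \<le> N" using x div_le_dividend le_trans by blast
      then show "14 * fst t 16 + 10 \<le> 14 * N + 10" using r' by simp
    qed (use r r' M y in \<open>simp_all add: d_def digit_def\<close>)
    have 2: "halts (divmod 19 20 18 25) ?t1 (42 * n + 10) ((=) ?t2)"
      by (rule halts_mono[OF halts_divmod]) (use r dM in simp_all)
    let ?v = "fst t 7 + ((1 - (1 - ((e - d) + (d - e)))) - ((e div 3 - d div 3) + (d div 3 - e div 3))
      + (table A n D (e div 3 * n + d div 3) - ((e mod 3 - d mod 3) + (d mod 3 - e mod 3))))"
    let ?t3 = "((fst ?t2)(7 := ?v), snd t)"
    let ?t4 = "((fst ?t3)(16 := y), snd t)"
    have K4: "keeps ?X s ((fst ?t4)(15 := Suc j), snd t)" using K unfolding keeps_def by simp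
    have "?v = 0 \<longleftrightarrow> fst t 7 = 0 \<and> \<not> conflict A e d" using conflict_zero[OF e dM, of A D] by simp
    then have "I (Suc j) ((fst ?t4)(15 := Suc j), snd t)"
      unfolding I_def using K4 r'(3) by (auto simp: d_def y_def less_Suc_eq)
    moreover have "fst ?t4 15 = j" using r' by simp
    ultimately have Q: "fst ?t4 15 = j \<and> I (Suc j) ((fst ?t4)(15 := Suc j), snd ?t4)" by simp
    have 3: "halts (Seq (Assign 7 (Plus (Reg 7) (Plus
     (Minus (Minus (Num 1) (Minus (Num 1) (dist_expr 12 18))) (dist_expr 13 19))
     (Minus (Load (Plus (Reg 23) (Reg 19))) (dist_expr 14 20))))) (Assign 16 (Reg 17))) ?t2 50 ((=) ?t4)"
      by (rule halts_mono[OF halts_Seq_Assign[OF halts_Assign]]) (use r tm in simp_all)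
    show ?thesis unfolding pair_body_def
      by (rule halts_mono[OF halts_Seq_eq[OF 1 halts_Seq_eq[OF 2 3]]]) (use Q in auto)
  qed
  show ?thesis
  proof (rule halts_For[of I])
    show "I 0 ((fst s)(15 := 0), snd s)" unfolding I_def using reg by (simp add: keeps_def)
    show "fst t 15 = i \<and> eval_expr (Num k) t = k" if "I i t" for i t using that unfolding I_def by simp
    show "halts pair_body t (14 * N + 42 * n + 70) (\<lambda>s'. fst s' 15 = j \<and> I (Suc j) ((fst s')(15 := Suc j), snd s'))"
      if "I j t" "j < k" for j t by (rule step[OF that(1)])
    show "keeps ?X s t \<and> (fst t 7 = 0 \<longleftrightarrow> fst s 7 = 0 \<and> (\<forall>j<k. \<not> conflict A e (digit (3 * n) j x)))" if "I k t" for t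
      using that unfolding I_def by simp
  qed (simp add: algebra_simps)
qed

text \<open>The entries for the three colours of a vertex lie at distance \<open>(3 n) ^ i\<close>
  from each other. They are 0 or 1, so their sum minus 2 is nonzero iff all three tuples are
  discarded.\<close>

definition block_body :: prog where
  "block_body = Seq (Assign 7 (Plus (Reg 7) (Minus (Plus (Plus (Load (Reg 21)) (Load (Plus (Reg 21) (Reg 10))))
      (Load (Plus (Reg 21) (Plus (Reg 10) (Reg 10))))) (Num 2))))
    (Assign 21 (Plus (Reg 21) (Plus (Reg 10) (Plus (Reg 10) (Reg 10)))))"

lemma less_3: "(\<forall>c<3::nat. P c) \<longleftrightarrow> P 0 \<and> P 1 \<and> P 2"
  by (auto simp: numeral_3_eq_3 less_Suc_eq numeral_2_eq_2)

lemma halts_blocks: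
  assumes mem: "snd s = table A n D" and reg: "fst s 0 = n" "fst s 10 = (3 * n) ^ i"
      "fst s 21 = n * n + (x - digit (3 * n) i x * (3 * n) ^ i)"
  shows "halts (For 22 (Reg 0) block_body) s (n * 60 + 6)
    (\<lambda>t. keeps {7, 21, 22} s t \<and> (fst t 7 = 0 \<longleftrightarrow> fst s 7 = 0 \<and> (\<forall>v<n. \<not> blocked n D x i v)))"
proof -
  let ?X = "{7, 21, 22} :: nat set" and ?M = "3 * n"
  let ?b = "x - digit ?M i x * ?M ^ i"
  define I where "I v t \<longleftrightarrow> keeps ?X s t \<and> fst t 22 = v \<and> fst t 21 = n * n + (?b + 3 * v * ?M ^ i) \<and>
       (fst t 7 = 0 \<longleftrightarrow> fst s 7 = 0 \<and> (\<forall>w<v. \<not> blocked n D x i w))" for v t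
  have step: "halts block_body t 40 (\<lambda>s'. fst s' 22 = v \<and> I (Suc v) ((fst s')(22 := Suc v), snd s'))"
    if I: "I v t" for v t
  proof -
    note K = I[unfolded I_def, THEN conjunct1]
    have r: "fst t 10 = ?M ^ i" using keeps_reg[OF K, of 10] reg by simp
    have r': "fst t 22 = v" "fst t 21 = n * n + (?b + 3 * v * ?M ^ i)"
       "fst t 7 = 0 \<longleftrightarrow> fst s 7 = 0 \<and> (\<forall>w<v. \<not> blocked n D x i w)" using I unfolding I_def by auto
    have tm: "snd t = table A n D" using keeps_mem[OF K] mem by simp
    define a where "a c = (of_bool (replace_digit ?M i (3 * v + c) x \<in> D) :: nat)" for c
    have a: "table A n D (n * n + (?b + 3 * v * ?M ^ i + c * ?M ^ i)) = a c" for c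
      unfolding table_dead a_def replace_digit_def by (simp add: algebra_simps)
    have addr: "fst t 21 = n * n + (?b + 3 * v * ?M ^ i + 0 * ?M ^ i)"
      "fst t 21 + fst t 10 = n * n + (?b + 3 * v * ?M ^ i + 1 * ?M ^ i)"
      "fst t 21 + (fst t 10 + fst t 10) = n * n + (?b + 3 * v * ?M ^ i + 2 * ?M ^ i)"
      unfolding r'(2) r by linarith+
    have loads: "snd t (fst t 21) = a 0" "snd t (fst t 21 + fst t 10) = a 1" "snd t (fst t 21 + (fst t 10 + fst t 10)) = a 2"
      unfolding tm addr(2,3) unfolding addr(1) by (rule a)+
    let ?v = "fst t 7 + (a 0 + a 1 + a 2 - 2)"
    let ?t = "((fst t)(7 := ?v, 21 := n * n + (?b + 3 * Suc v * ?M ^ i)), snd t)"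
    have "a 0 + a 1 + a 2 - 2 = 0 \<longleftrightarrow> \<not> blocked n D x i v" unfolding blocked_def less_3 a_def by auto
    then have "?v = 0 \<longleftrightarrow> fst t 7 = 0 \<and> \<not> blocked n D x i v" by simp
    moreover have "keeps ?X s ((fst ?t)(22 := Suc v), snd t)" using K unfolding keeps_def by simp
    ultimately have "I (Suc v) ((fst ?t)(22 := Suc v), snd t)"
      unfolding I_def using r'(3) by (auto simp: less_Suc_eq)
    then have Q: "fst ?t 22 = v \<and> I (Suc v) ((fst ?t)(22 := Suc v), snd ?t)" using r' by simp
    have "halts block_body t 40 ((=) ?t)" unfolding block_body_def
      by (rule halts_mono[OF halts_Seq_Assign[OF halts_Assign]]) (use loads r r' in \<open>simp_all add: algebra_simps\<close>)
    then show ?thesis by (rule halts_mono) (use Q in auto)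
  qed
  show ?thesis
  proof (rule halts_For[of I])
    show "I 0 ((fst s)(22 := 0), snd s)" unfolding I_def using reg by (simp add: keeps_def)
    show "fst t 22 = v \<and> eval_expr (Reg 0) t = n" if "I v t" for v t
      using that keeps_reg[of ?X s t 0] reg unfolding I_def by simp
    show "halts block_body t 40 (\<lambda>s'. fst s' 22 = v \<and> I (Suc v) ((fst s')(22 := Suc v), snd s'))"
      if "I v t" "v < n" for v t by (rule step[OF that(1)])
    show "keeps ?X s t \<and> (fst t 7 = 0 \<longleftrightarrow> fst s 7 = 0 \<and> (\<forall>v<n. \<not> blocked n D x i v))" if "I n t" for t
      using that unfolding I_def by simp
  qed (simp add: algebra_simps)
qed

definition index_body :: "nat \<Rightarrow> prog" where
  "index_body k = Seq (divmod 11 12 9 1) (Seq (divmod 13 14 12 25) (Seq (mul 23 24 13 0) (Seq (Assign 16 (Reg 6))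
     (Seq (For 15 (Num k) pair_body) (Seq (mul 23 24 12 10) (Seq (Assign 21 (Plus (Reg 3) (Minus (Reg 6) (Reg 23))))
     (Seq (For 22 (Reg 0) block_body) (Seq (Assign 9 (Reg 11)) (Seq (mul 23 24 10 1) (Assign 10 (Reg 23)))))))))))"

definition check :: "nat \<Rightarrow> prog" where
  "check k = Seq (Assign 7 (Num 0)) (Seq (Assign 9 (Reg 6)) (Seq (Assign 10 (Num 1)) (For 8 (Num k) (index_body k))))"

definition index_time :: "nat \<Rightarrow> nat \<Rightarrow> nat \<Rightarrow> nat" where
  "index_time k n N = k * (14 * N + 42 * n + 80) + 24 * N + 142 * n + 100"

lemma halts_index:
  assumes mem: "snd s = table A n D" and reg: "fst s 0 = n" "fst s 1 = 3 * n" "fst s 3 = n * n" "fst s 6 = x" "fst s 25 = 3"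
      "fst s 9 = x div (3 * n) ^ i" "fst s 10 = (3 * n) ^ i"
    and x: "x < N" and N: "N = (3 * n) ^ k" and i: "i < k"
  shows "halts (index_body k) s (index_time k n N)
    (\<lambda>t. keeps ({7..24} - {8}) s t \<and> fst t 9 = x div (3 * n) ^ Suc i \<and> fst t 10 = (3 * n) ^ Suc i \<and>
       (fst t 7 = 0 \<longleftrightarrow> fst s 7 = 0 \<and> (\<forall>j<k. \<not> conflict A (digit (3 * n) i x) (digit (3 * n) j x)) \<and> (\<forall>v<n. \<not> blocked n D x i v)))"
proof -
  let ?X = "{7..24} - {8} :: nat set"
  have M: "0 < 3 * n" using x N i by (cases "n = 0") (auto simp: power_0_left)
  \<comment> \<open>Bounds the time of the last multiplication, which is linear in its first
    factor.\<close>
  have pw: "(3 * n) ^ i \<le> N" unfolding N using i M by (intro power_increasing) simp_all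
  define P where "P = (3 * n) ^ i"
  define e where "e = digit (3 * n) i x"
  define y where "y = x div (3 * n) ^ Suc i"
  have y: "y = x div P div (3 * n)" unfolding y_def P_def power_Suc2 div_mult2_eq ..
  have e: "e = x div P mod (3 * n)" unfolding e_def P_def digit_def ..
  have eM: "e < 3 * n" unfolding e_def by (rule digit_less[OF M])
  note reg = reg[folded P_def]
  have 1: "halts (divmod 11 12 9 1) s (14 * N + 10) ((=) ((fst s)(12 := e, 11 := y), snd s))" (is "halts _ _ _ ((=) ?s1)")
  proof (rule halts_mono[OF halts_divmod])
    have "x div P \<le> N" using x div_le_dividend[of x P] by linarith
    then show "14 * fst s 9 + 10 \<le> 14 * N + 10" using reg by simp
  qed (use reg M y e in simp_all)
  have 2: "halts (divmod 13 14 12 25) ?s1 (42 * n + 10) ((=) ((fst ?s1)(14 := e mod 3, 13 := e div 3), snd s))"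
    (is "halts _ _ _ ((=) ?s2)")
    by (rule halts_mono[OF halts_divmod]) (use reg eM in simp_all)
  have 3: "halts (mul 23 24 13 0) ?s2 (10 * n + 6) ((=) ((fst ?s2)(23 := e div 3 * n, 24 := 0), snd s))"
    (is "halts _ _ _ ((=) ?s3)")
  proof (rule halts_mono[OF halts_mul])
    have "e div 3 < n" using eM by (simp add: less_mult_imp_div_less mult.commute)
    then show "10 * fst ?s2 13 + 6 \<le> 10 * n + 6" by simp
  qed (use reg in simp_all)
  have 4: "halts (Assign 16 (Reg 6)) ?s3 2 ((=) ((fst ?s3)(16 := x), snd s))" (is "halts _ _ _ ((=) ?s4)")
    by (rule halts_mono[OF halts_Assign]) (use reg in simp_all)
  define Q5 where "Q5 t \<longleftrightarrow> keeps {7, 15, 16, 17, 18, 19, 20} ?s4 t \<and>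
       (fst t 7 = 0 \<longleftrightarrow> fst ?s4 7 = 0 \<and> (\<forall>j<k. \<not> conflict A e (digit (3 * n) j x)))" for t
  have 5: "halts (For 15 (Num k) pair_body) ?s4 (k * (14 * N + 42 * n + 80) + 6) Q5"
    unfolding Q5_def by (rule halts_pairs) (use mem reg eM x in simp_all)
  let ?R = "\<lambda>t. keeps ?X s t \<and> fst t 9 = y \<and> fst t 10 = (3 * n) ^ Suc i \<and>
       (fst t 7 = 0 \<longleftrightarrow> fst s 7 = 0 \<and> (\<forall>j<k. \<not> conflict A e (digit (3 * n) j x)) \<and> (\<forall>v<n. \<not> blocked n D x i v))"
  have rest: "halts (Seq (mul 23 24 12 10) (Seq (Assign 21 (Plus (Reg 3) (Minus (Reg 6) (Reg 23))))
     (Seq (For 22 (Reg 0) block_body) (Seq (Assign 9 (Reg 11)) (Seq (mul 23 24 10 1) (Assign 10 (Reg 23))))))) t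
     (30 * n + 6 + (6 + (n * 60 + 6 + (2 + (10 * N + 6 + 2))))) ?R" if Q: "Q5 t" for t
  proof -
    have K: "keeps {7, 15, 16, 17, 18, 19, 20} ?s4 t" using Q unfolding Q5_def by blast
    have t7: "fst t 7 = 0 \<longleftrightarrow> fst s 7 = 0 \<and> (\<forall>j<k. \<not> conflict A e (digit (3 * n) j x))" using Q unfolding Q5_def by simp
    have r: "fst t 0 = n" "fst t 1 = 3 * n" "fst t 3 = n * n" "fst t 6 = x" "fst t 10 = P" "fst t 11 = y" "fst t 12 = e"
      using keeps_reg[OF K] reg by simp_all
    have Ks: "keeps ?X s t" using K unfolding keeps_def by auto
    have tm: "snd t = table A n D" using keeps_mem[OF K] mem by simp
    have 6: "halts (mul 23 24 12 10) t (30 * n + 6) ((=) ((fst t)(23 := e * P, 24 := 0), snd t))" (is "halts _ _ _ ((=) ?s6)")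
      by (rule halts_mono[OF halts_mul]) (use r eM in simp_all)
    have 7: "halts (Assign 21 (Plus (Reg 3) (Minus (Reg 6) (Reg 23)))) ?s6 6 ((=) ((fst ?s6)(21 := n * n + (x - e * P)), snd t))"
      (is "halts _ _ _ ((=) ?s7)")
      by (rule halts_mono[OF halts_Assign]) (use r in simp_all)
    define Q8 where "Q8 u \<longleftrightarrow> keeps {7, 21, 22} ?s7 u \<and> (fst u 7 = 0 \<longleftrightarrow> fst ?s7 7 = 0 \<and> (\<forall>v<n. \<not> blocked n D x i v))" for u
    have 8: "halts (For 22 (Reg 0) block_body) ?s7 (n * 60 + 6) Q8"
      unfolding Q8_def by (rule halts_blocks) (use tm r in \<open>simp_all add: e_def P_def\<close>)
    have rest2: "halts (Seq (Assign 9 (Reg 11)) (Seq (mul 23 24 10 1) (Assign 10 (Reg 23)))) u (2 + (10 * N + 6 + 2)) ?R"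
      if Q: "Q8 u" for u
    proof -
      have K: "keeps {7, 21, 22} ?s7 u" using Q unfolding Q8_def by blast
      have u7: "fst u 7 = 0 \<longleftrightarrow> fst t 7 = 0 \<and> (\<forall>v<n. \<not> blocked n D x i v)" using Q unfolding Q8_def by simp
      have r: "fst u 1 = 3 * n" "fst u 10 = P" "fst u 11 = y" using keeps_reg[OF K] r by simp_all
      have Ku: "keeps ?X s u" using K Ks unfolding keeps_def by auto
      let ?u1 = "((fst u)(9 := y), snd u)"
      let ?u2 = "((fst ?u1)(23 := P * (3 * n), 24 := 0), snd u)"
      let ?u3 = "((fst ?u2)(10 := P * (3 * n)), snd u)"
      have 9: "halts (Assign 9 (Reg 11)) u 2 ((=) ?u1)" by (rule halts_mono[OF halts_Assign]) (use r in simp_all)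
      have 10: "halts (mul 23 24 10 1) ?u1 (10 * N + 6) ((=) ?u2)"
        by (rule halts_mono[OF halts_mul]) (use r pw in \<open>simp_all add: P_def\<close>)
      have 11: "halts (Assign 10 (Reg 23)) ?u2 2 ((=) ?u3)" by (rule halts_mono[OF halts_Assign]) simp_all
      have "keeps ?X s ?u3" using Ku unfolding keeps_def by simp
      then have "?R ?u3" using u7 t7 unfolding P_def power_Suc2 by simp
      then show ?thesis by (intro halts_mono[OF halts_Seq_eq[OF 9 halts_Seq_eq[OF 10 11]]]) auto
    qed
    show ?thesis by (rule halts_Seq_eq[OF 6 halts_Seq_eq[OF 7 halts_Seq[OF 8 rest2]]])
  qed
  show ?thesis unfolding index_body_def y_def[symmetric] e_def[symmetric]
    by (rule halts_mono[OF halts_Seq_eq[OF 1 halts_Seq_eq[OF 2 halts_Seq_eq[OF 3 halts_Seq_eq[OF 4 halts_Seq[OF 5 rest]]]]]])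
      (auto simp: index_time_def)
qed

lemma halts_check:
  assumes mem: "snd s = table A n D" and reg: "fst s 0 = n" "fst s 1 = 3 * n" "fst s 3 = n * n" "fst s 6 = x" "fst s 25 = 3"
    and x: "x < N" and N: "N = (3 * n) ^ k"
  shows "halts (check k) s (k * (index_time k n N + 10) + 20) (\<lambda>t. keeps {7..24} s t \<and> (fst t 7 = 0 \<longleftrightarrow> \<not> bad A n k D x))"
proof -
  let ?X = "{7..24} :: nat set"
  let ?no = "\<lambda>i. (\<forall>j<k. \<not> conflict A (digit (3 * n) i x) (digit (3 * n) j x)) \<and> (\<forall>v<n. \<not> blocked n D x i v)"
  let ?s = "((fst s)(7 := 0, 9 := x, 10 := 1), snd s)"
  define I where "I i t \<longleftrightarrow> keeps ?X s t \<and> fst t 8 = i \<and> fst t 9 = x div (3 * n) ^ i \<and> fst t 10 = (3 * n) ^ i \<and>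
     (fst t 7 = 0 \<longleftrightarrow> (\<forall>j<i. ?no j))" for i t
  have step: "halts (index_body k) t (index_time k n N) (\<lambda>s'. fst s' 8 = i \<and> I (Suc i) ((fst s')(8 := Suc i), snd s'))"
    if I: "I i t" and i: "i < k" for i t
  proof -
    have K: "keeps ?X s t" using I unfolding I_def by blast
    have r: "fst t 0 = n" "fst t 1 = 3 * n" "fst t 3 = n * n" "fst t 6 = x" "fst t 25 = 3" using keeps_reg[OF K] reg by simp_all
    have r': "fst t 9 = x div (3 * n) ^ i" "fst t 10 = (3 * n) ^ i" "fst t 8 = i" "fst t 7 = 0 \<longleftrightarrow> (\<forall>j<i. ?no j)"
      using I unfolding I_def by blast+
    have tm: "snd t = table A n D" using keeps_mem[OF K] mem by simp
    show ?thesis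
    proof (rule halts_mono[OF halts_index[OF tm r r'(1,2) x N i]])
      fix u assume u: "keeps ({7..24} - {8}) t u \<and> fst u 9 = x div (3 * n) ^ Suc i \<and> fst u 10 = (3 * n) ^ Suc i \<and>
       (fst u 7 = 0 \<longleftrightarrow> fst t 7 = 0 \<and> (\<forall>j<k. \<not> conflict A (digit (3 * n) i x) (digit (3 * n) j x)) \<and> (\<forall>v<n. \<not> blocked n D x i v))"
      have "keeps ?X s ((fst u)(8 := Suc i), snd u)" using K u unfolding keeps_def by auto
      moreover have "fst u 8 = i" using keeps_reg[of "{7..24} - {8}" t u 8] u r'(3) by simp
      moreover have "fst u 7 = 0 \<longleftrightarrow> (\<forall>j<Suc i. ?no j)" using u r'(4) by (simp only: less_Suc_eq all_simps disj_imp) blast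
      ultimately show "fst u 8 = i \<and> I (Suc i) ((fst u)(8 := Suc i), snd u)" using u unfolding I_def by simp
    qed simp
  qed
  have loop: "halts (For 8 (Num k) (index_body k)) ?s (k * (index_time k n N + 8) + 6) (\<lambda>t. keeps ?X s t \<and> (fst t 7 = 0 \<longleftrightarrow> \<not> bad A n k D x))"
  proof (rule halts_For[of I])
    show "I 0 ((fst ?s)(8 := 0), snd ?s)" unfolding I_def by (simp add: keeps_def)
    show "fst t 8 = i \<and> eval_expr (Num k) t = k" if "I i t" for i t using that unfolding I_def by simp
    show "halts (index_body k) t (index_time k n N) (\<lambda>s'. fst s' 8 = i \<and> I (Suc i) ((fst s')(8 := Suc i), snd s'))"
      if "I i t" "i < k" for i t by (rule step[OF that])
    show "keeps ?X s t \<and> (fst t 7 = 0 \<longleftrightarrow> \<not> bad A n k D x)" if "I k t" for t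
      using that unfolding I_def bad_def by blast
  qed simp
  have "halts (check k) s (expr_cost (Num 0) + 1 + (expr_cost (Reg 6) + 1 + (expr_cost (Num 1) + 1 + (k * (index_time k n N + 8) + 6))))
     (\<lambda>t. keeps ?X s t \<and> (fst t 7 = 0 \<longleftrightarrow> \<not> bad A n k D x))"
    unfolding check_def
    by (rule halts_Seq_Assign, rule halts_Seq_Assign, rule halts_Seq_Assign) (use loop reg in \<open>simp add: fun_upd_def\<close>)
  then show ?thesis by (rule halts_mono) (auto simp: algebra_simps)
qed

section \<open>The main loop\<close>

definition examine :: "nat \<Rightarrow> prog" where
  "examine k = Cond (Load (Plus (Reg 3) (Reg 6))) Skip (Seq (check k)
     (Cond (Reg 7) (Seq (Store (Plus (Reg 3) (Reg 6)) (Num 1)) (Assign 4 (Num 1))) (Assign 5 (Num 1))))"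

definition sweep :: "nat \<Rightarrow> prog" where
  "sweep k = Seq (Assign 4 (Num 0)) (Seq (Assign 5 (Num 0)) (For 6 (Reg 2) (examine k)))"

definition start :: "nat \<Rightarrow> prog" where
  "start k = Seq (Assign 25 (Num 3)) (Seq (Assign 1 (Plus (Reg 0) (Plus (Reg 0) (Reg 0)))) (Seq (mul 3 24 0 0)
     (Seq (Assign 2 (Num 1)) (Seq (For 8 (Num k) (Seq (mul 23 24 2 1) (Assign 2 (Reg 23)))) (Assign 4 (Num 1))))))"

text \<open>The second summand of the answer is 1 only for \<open>n = 0\<close>: the empty graph is
  colourable, but for positive \<open>k\<close> it has no tuples and register 5 stays 0.\<close>

definition consistency :: "nat \<Rightarrow> prog" where
  "consistency k = Seq (start k) (Seq (While (Reg 4) (sweep k)) (Assign 0 (Plus (Reg 5) (Minus (Num 1) (Reg 0)))))"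

definition base :: "nat \<Rightarrow> nat \<Rightarrow> state \<Rightarrow> bool" where
  "base n N s \<longleftrightarrow> fst s 0 = n \<and> fst s 1 = 3 * n \<and> fst s 2 = N \<and> fst s 3 = n * n \<and> fst s 25 = 3"

definition examine_time :: "nat \<Rightarrow> nat \<Rightarrow> nat \<Rightarrow> nat" where
  "examine_time k n N = k * (index_time k n N + 10) + 40"

lemma halts_start:
  assumes "fst s 0 = n" and N: "N = (3 * n) ^ k"
  shows "halts (start k) s (10 * n + k * (10 * N + 30) + 40) (\<lambda>t. base n N t \<and> fst t 4 = 1 \<and> snd t = snd s)"
proof -
  let ?s1 = "((fst s)(25 := 3), snd s)"
  let ?s2 = "((fst ?s1)(1 := 3 * n), snd s)"
  let ?s3 = "((fst ?s2)(3 := n * n, 24 := 0), snd s)"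
  let ?s4 = "((fst ?s3)(2 := 1), snd s)"
  have 1: "halts (Assign 25 (Num 3)) s 2 ((=) ?s1)" by (rule halts_mono[OF halts_Assign]) simp_all
  have 2: "halts (Assign 1 (Plus (Reg 0) (Plus (Reg 0) (Reg 0)))) ?s1 6 ((=) ?s2)"
    by (rule halts_mono[OF halts_Assign]) (use assms(1) in \<open>simp_all add: fun_eq_iff\<close>)
  have 3: "halts (mul 3 24 0 0) ?s2 (10 * n + 6) ((=) ?s3)" by (rule halts_mono[OF halts_mul]) (use assms in simp_all)
  have 4: "halts (Assign 2 (Num 1)) ?s3 2 ((=) ?s4)" by (rule halts_mono[OF halts_Assign]) simp_all
  define I where "I i t \<longleftrightarrow> fst t 8 = i \<and> base n ((3 * n) ^ i) t \<and> snd t = snd s" for i t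
  have step: "halts (Seq (mul 23 24 2 1) (Assign 2 (Reg 23))) t (10 * N + 20) (\<lambda>s'. fst s' 8 = i \<and> I (Suc i) ((fst s')(8 := Suc i), snd s'))"
    if I: "I i t" and i: "i < k" for i t
  proof -
    have r: "fst t 8 = i" "fst t 0 = n" "fst t 1 = 3 * n" "fst t 2 = (3 * n) ^ i" "fst t 3 = n * n" "fst t 25 = 3" "snd t = snd s"
      using I unfolding I_def base_def by blast+
    \<comment> \<open>The summand 1 is for \<open>n = 0\<close>, where the power is 1 at
      \<open>i = 0\<close> but \<open>N\<close> is 0.\<close>
    have "(3 * n) ^ i \<le> N + 1"
    proof (cases "n = 0")
      case False
      then show ?thesis unfolding N using i power_increasing[of i k "3 * n"] by simp
    qed (simp add: power_0_left)
    then have b: "10 * fst t 2 + 6 \<le> 10 * N + 16" using r(4) by simp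
    let ?t1 = "((fst t)(23 := (3 * n) ^ Suc i, 24 := 0), snd t)"
    let ?t2 = "((fst ?t1)(2 := (3 * n) ^ Suc i), snd t)"
    have 1: "halts (mul 23 24 2 1) t (10 * N + 16) ((=) ?t1)"
      by (rule halts_mono[OF halts_mul]) (use r b in \<open>simp_all add: mult_ac\<close>)
    have 2: "halts (Assign 2 (Reg 23)) ?t1 2 ((=) ?t2)" by (rule halts_mono[OF halts_Assign]) simp_all
    have "fst ?t2 8 = i \<and> I (Suc i) ((fst ?t2)(8 := Suc i), snd ?t2)" unfolding I_def base_def using r by simp
    then show ?thesis by (intro halts_mono[OF halts_Seq_eq[OF 1 2]]) auto
  qed
  have 5: "halts (For 8 (Num k) (Seq (mul 23 24 2 1) (Assign 2 (Reg 23)))) ?s4 (k * (10 * N + 28) + 6) (\<lambda>t. base n N t \<and> snd t = snd s)"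
  proof (rule halts_For[of I])
    show "I 0 ((fst ?s4)(8 := 0), snd ?s4)" unfolding I_def base_def using assms by simp
    show "fst t 8 = i \<and> eval_expr (Num k) t = k" if "I i t" for i t using that unfolding I_def by simp
    show "halts (Seq (mul 23 24 2 1) (Assign 2 (Reg 23))) t (10 * N + 20) (\<lambda>s'. fst s' 8 = i \<and> I (Suc i) ((fst s')(8 := Suc i), snd s'))"
      if "I i t" "i < k" for i t by (rule step[OF that])
    show "base n N t \<and> snd t = snd s" if "I k t" for t using that unfolding I_def N by simp
  qed (simp add: algebra_simps)
  have 6: "halts (Assign 4 (Num 1)) t 2 (\<lambda>t. base n N t \<and> fst t 4 = 1 \<and> snd t = snd s)" if "base n N t \<and> snd t = snd s" for t
    by (rule halts_mono[OF halts_Assign[of "\<lambda>t. base n N t \<and> fst t 4 = 1 \<and> snd t = snd s"]])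
      (use that in \<open>simp_all add: base_def\<close>)
  show ?thesis unfolding start_def
    by (rule halts_mono[OF halts_Seq_eq[OF 1 halts_Seq_eq[OF 2 halts_Seq_eq[OF 3 halts_Seq_eq[OF 4 halts_Seq[OF 5 6]]]]]])
      (auto simp: algebra_simps)
qed

text \<open>\<open>P\<close> is an arbitrary invariant of the set of discarded tuples. It will be
  instantiated with the soundness of discarding.\<close>

context
  fixes A :: "nat \<Rightarrow> nat \<Rightarrow> bool" and n k N :: nat and P :: "nat set \<Rightarrow> bool"
  assumes N: "N = (3 * n) ^ k"
    and P: "\<And>D x. P D \<Longrightarrow> x < N \<Longrightarrow> bad A n k D x \<Longrightarrow> P (insert x D)"
begin

text \<open>\<open>D\<close> is the set at the beginning of the sweep. As long as flag 4 is zero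
  nothing has been discarded, so all tests so far refer to the same set; only then is anything
  claimed about them and about flag 5.\<close>

definition swept :: "nat set \<Rightarrow> nat \<Rightarrow> state \<Rightarrow> bool" where
  "swept D x s \<longleftrightarrow> base n N s \<and> (\<exists>D'. snd s = table A n D' \<and> P D' \<and> D \<subseteq> D' \<and> D' \<subseteq> {..<N} \<and>
     (if fst s 4 = 0 then D' = D \<and> (\<forall>y<x. y \<notin> D \<longrightarrow> \<not> bad A n k D y) \<and> fst s 5 = of_bool (\<exists>y<x. y \<notin> D) else D \<noteq> D'))"

lemma halts_examine:
  assumes s: "swept D x s" "fst s 6 = x" and x: "x < N"
  shows "halts (examine k) s (examine_time k n N) (\<lambda>t. fst t 6 = x \<and> swept D (Suc x) ((fst t)(6 := Suc x), snd t))"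
proof -
  let ?Q = "\<lambda>t. fst t 6 = x \<and> swept D (Suc x) ((fst t)(6 := Suc x), snd t)"
  obtain D' where D': "snd s = table A n D'" "P D'" "D \<subseteq> D'" "D' \<subseteq> {..<N}" and
    c: "if fst s 4 = 0 then D' = D \<and> (\<forall>y<x. y \<notin> D \<longrightarrow> \<not> bad A n k D y) \<and> fst s 5 = of_bool (\<exists>y<x. y \<notin> D) else D \<noteq> D'"
    and b: "base n N s"
    using s(1) unfolding swept_def by blast
  have r: "fst s 0 = n" "fst s 1 = 3 * n" "fst s 2 = N" "fst s 3 = n * n" "fst s 25 = 3" using b unfolding base_def by blast+
  have load: "eval_expr (Load (Plus (Reg 3) (Reg 6))) s = of_bool (x \<in> D')"
    using s(2) r D'(1) by (simp add: table_dead)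
  define T where "T = k * (index_time k n N + 10) + 20 + (2 + 10)"
  have "halts (examine k) s (expr_cost (Load (Plus (Reg 3) (Reg 6))) + 1 + T) ?Q" unfolding examine_def
  proof (rule halts_Cond)
    assume "eval_expr (Load (Plus (Reg 3) (Reg 6))) s \<noteq> 0"
    then have xD: "x \<in> D'" using load by simp
    have "swept D (Suc x) ((fst s)(6 := Suc x), snd s)"
      unfolding swept_def using b D' c xD by (intro conjI exI[of _ D']) (auto simp: base_def less_Suc_eq split: if_splits)
    then have "?Q s" using s(2) by simp
    then show "halts Skip s T ?Q" by (intro halts_mono[OF halts_Skip[of ?Q]]) (auto simp: T_def)
  next
    assume "eval_expr (Load (Plus (Reg 3) (Reg 6))) s = 0"
    then have xD: "x \<notin> D'" using load by simp
    show "halts (Seq (check k) (Cond (Reg 7) (Seq (Store (Plus (Reg 3) (Reg 6)) (Num 1)) (Assign 4 (Num 1))) (Assign 5 (Num 1)))) s T ?Q"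
      unfolding T_def
    proof (rule halts_Seq[OF halts_check[OF D'(1) r(1,2,4) s(2) r(5) x N]])
      fix t assume t: "keeps {7..24} s t \<and> (fst t 7 = 0 \<longleftrightarrow> \<not> bad A n k D' x)"
      then have K: "keeps {7..24} s t" by blast
      have rt: "fst t 0 = n" "fst t 1 = 3 * n" "fst t 2 = N" "fst t 3 = n * n" "fst t 4 = fst s 4" "fst t 5 = fst s 5"
        "fst t 6 = x" "fst t 25 = 3" "snd t = table A n D'"
        using keeps_reg[OF K] keeps_mem[OF K] r s(2) D'(1) by simp_all
      have "halts (Cond (Reg 7) (Seq (Store (Plus (Reg 3) (Reg 6)) (Num 1)) (Assign 4 (Num 1))) (Assign 5 (Num 1))) t
          (expr_cost (Reg 7) + 1 + 10) ?Q"
      proof (rule halts_Cond)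
        assume "eval_expr (Reg 7) t \<noteq> 0"
        then have bd: "bad A n k D' x" using t by simp
        let ?u1 = "(fst t, table A n (insert x D'))"
        let ?u2 = "((fst t)(4 := 1), table A n (insert x D'))"
        have 1: "halts (Store (Plus (Reg 3) (Reg 6)) (Num 1)) t 5 ((=) ?u1)"
          by (rule halts_mono[OF halts_Store]) (use rt in \<open>simp_all add: table_update[symmetric]\<close>)
        have 2: "halts (Assign 4 (Num 1)) ?u1 2 ((=) ?u2)" by (rule halts_mono[OF halts_Assign]) simp_all
        have "swept D (Suc x) ((fst ?u2)(6 := Suc x), snd ?u2)"
          unfolding swept_def using D' xD x rt P[OF D'(2) x bd] by (intro conjI exI[of _ "insert x D'"]) (auto simp: base_def)
        then have "?Q ?u2" using rt by simp
        then show "halts (Seq (Store (Plus (Reg 3) (Reg 6)) (Num 1)) (Assign 4 (Num 1))) t 10 ?Q"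
          by (intro halts_mono[OF halts_Seq_eq[OF 1 2]]) auto
      next
        assume "eval_expr (Reg 7) t = 0"
        then have bd: "\<not> bad A n k D' x" using t by simp
        let ?u = "((fst t)(5 := 1), snd t)"
        have 1: "halts (Assign 5 (Num 1)) t 2 ((=) ?u)" by (rule halts_mono[OF halts_Assign]) simp_all
        have "swept D (Suc x) ((fst ?u)(6 := Suc x), snd ?u)"
          unfolding swept_def using D' xD bd rt c by (intro conjI exI[of _ D']) (auto simp: base_def less_Suc_eq)
        then have "?Q ?u" using rt by simp
        then show "halts (Assign 5 (Num 1)) t 10 ?Q" by (intro halts_mono[OF 1]) auto
      qed
      then show "halts (Cond (Reg 7) (Seq (Store (Plus (Reg 3) (Reg 6)) (Num 1)) (Assign 4 (Num 1))) (Assign 5 (Num 1))) t (2 + 10) ?Q"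
        by (rule halts_mono) simp_all
    qed
  qed
  then show ?thesis by (rule halts_mono) (simp_all add: T_def examine_time_def)
qed

lemma halts_sweep:
  assumes b: "base n N s" and D: "snd s = table A n D" "P D" "D \<subseteq> {..<N}"
  shows "halts (sweep k) s (N * (examine_time k n N + 8) + 10) (swept D N)"
proof -
  let ?s = "((fst s)(4 := 0, 5 := 0), snd s)"
  define I where "I x t \<longleftrightarrow> swept D x t \<and> fst t 6 = x" for x t
  have "halts (For 6 (Reg 2) (examine k)) ?s (N * (examine_time k n N + 8) + 6) (swept D N)"
  proof (rule halts_For[of I])
    show "I 0 ((fst ?s)(6 := 0), snd ?s)" unfolding I_def swept_def using b D by (simp add: base_def)
    show "fst t 6 = i \<and> eval_expr (Reg 2) t = N" if "I i t" for i t using that unfolding I_def swept_def base_def by simp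
    show "halts (examine k) t (examine_time k n N) (\<lambda>s'. fst s' 6 = i \<and> I (Suc i) ((fst s')(6 := Suc i), snd s'))"
      if "I i t" "i < N" for i t
      by (rule halts_mono[OF halts_examine[of D i]]) (use that in \<open>auto simp: I_def\<close>)
    show "swept D N t" if "I N t" for t using that unfolding I_def by simp
  qed simp
  then have "halts (sweep k) s (expr_cost (Num 0) + 1 + (expr_cost (Num 0) + 1 + (N * (examine_time k n N + 8) + 6))) (swept D N)"
    unfolding sweep_def by (intro halts_Seq_Assign) simp
  then show ?thesis by (rule halts_mono) simp_all
qed

text \<open>Every sweep but the last enlarges the set of discarded tuples, so there are at most
  \<open>N + 1\<close> sweeps. While flag 4 is set, the index of \<open>J\<close> is positive; a
  sweep without changes leads to index 0.\<close>

lemma halts_consistency: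
  assumes s: "fst s 0 = n" "snd s = table A n {}" and P0: "P {}"
  shows "halts (consistency k) s (10 * n + k * (10 * N + 30) + (N + 1) * (N * (examine_time k n N + 8) + 20) + 60)
    (\<lambda>t. \<exists>D. P D \<and> D \<subseteq> {..<N} \<and> (\<forall>x<N. x \<notin> D \<longrightarrow> \<not> bad A n k D x) \<and> fst t 0 = of_bool (\<exists>x<N. x \<notin> D) + (1 - n))"
proof -
  let ?b = "N * (examine_time k n N + 8) + 10"
  define J where "J m t \<longleftrightarrow> base n N t \<and> (\<exists>D. snd t = table A n D \<and> P D \<and> D \<subseteq> {..<N} \<and>
    (if fst t 4 = 0 then (\<forall>x<N. x \<notin> D \<longrightarrow> \<not> bad A n k D x) \<and> fst t 5 = of_bool (\<exists>x<N. x \<notin> D) else m = Suc (N - card D)))" for m t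
  let ?F = "\<lambda>t. \<exists>D. P D \<and> D \<subseteq> {..<N} \<and> (\<forall>x<N. x \<notin> D \<longrightarrow> \<not> bad A n k D x) \<and> fst t 0 = of_bool (\<exists>x<N. x \<notin> D) + (1 - n)"
  have step: "halts (sweep k) t ?b (\<lambda>t'. \<exists>j<m. J j t')" if J: "J m t" and nz: "eval_expr (Reg 4) t \<noteq> 0" for m t
  proof -
    obtain D where D: "snd t = table A n D" "P D" "D \<subseteq> {..<N}" "m = Suc (N - card D)" and b: "base n N t"
      using J nz unfolding J_def by auto
    show ?thesis
    proof (rule halts_mono[OF halts_sweep[OF b D(1-3)]])
      fix t' assume "swept D N t'"
      then obtain D' where D': "base n N t'" "snd t' = table A n D'" "P D'" "D \<subseteq> D'" "D' \<subseteq> {..<N}" and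
        c: "if fst t' 4 = 0 then D' = D \<and> (\<forall>y<N. y \<notin> D \<longrightarrow> \<not> bad A n k D y) \<and> fst t' 5 = of_bool (\<exists>y<N. y \<notin> D) else D \<noteq> D'"
        unfolding swept_def by blast
      show "\<exists>j<m. J j t'"
      proof (cases "fst t' 4 = 0")
        case True
        then have "J 0 t'" unfolding J_def using D' c by auto
        then show ?thesis using D(4) by blast
      next
        case False
        then have "D \<subset> D'" using c D'(4) by auto
        then have "card D < card D'" using psubset_card_mono finite_subset[OF D'(5)] by blast
        moreover have "card D' \<le> N" using card_mono[OF _ D'(5)] by simp
        moreover have "J (Suc (N - card D')) t'" unfolding J_def using D' False by auto
        ultimately show ?thesis unfolding D(4) by (intro exI[of _ "Suc (N - card D')"]) linarith
      qed
    qed simp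
  qed
  have loop: "halts (While (Reg 4) (sweep k)) t ((N + 1) * (expr_cost (Reg 4) + 1 + ?b) + expr_cost (Reg 4) + 1)
      (\<lambda>t. J 0 t \<and> fst t 4 = 0)" if t: "base n N t \<and> fst t 4 = 1 \<and> snd t = snd s" for t
  proof (rule halts_While[of J])
    show "J (N + 1) t" unfolding J_def using t s(2) P0 by (intro conjI exI[of _ "{}"]) auto
    show "J 0 u \<and> fst u 4 = 0" if "J m u" "eval_expr (Reg 4) u = 0" for m u using that unfolding J_def by auto
  qed (rule step)
  have final: "halts (Assign 0 (Plus (Reg 5) (Minus (Num 1) (Reg 0)))) t 6 ?F" if t: "J 0 t \<and> fst t 4 = 0" for t
  proof (rule halts_mono[OF halts_Assign[of ?F]])
    obtain D where "base n N t" "P D" "D \<subseteq> {..<N}" "\<forall>x<N. x \<notin> D \<longrightarrow> \<not> bad A n k D x" "fst t 5 = of_bool (\<exists>x<N. x \<notin> D)"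
      using t unfolding J_def by auto
    then show "?F ((fst t)(0 := eval_expr (Plus (Reg 5) (Minus (Num 1) (Reg 0))) t), snd t)"
      by (intro exI[of _ D]) (simp add: base_def)
    show "\<exists>D. P D \<and> D \<subseteq> {..<N} \<and> (\<forall>x<N. x \<notin> D \<longrightarrow> \<not> bad A n k D x) \<and> fst u 0 = of_bool (\<exists>x<N. x \<notin> D) + (1 - n)" if "?F u" for u
      using that .
  qed simp
  show ?thesis unfolding consistency_def
    by (rule halts_mono[OF halts_Seq[OF halts_start[OF s(1) N] halts_Seq[OF loop final]]]) (auto simp: algebra_simps)
qed

end

section \<open>Correctness\<close>

definition polynomial :: "(nat \<Rightarrow> nat) \<Rightarrow> bool" where
  "polynomial f \<longleftrightarrow> (\<exists>p :: nat poly. \<forall>n. f n = poly p n)"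

lemma polynomial_const: "polynomial (\<lambda>_. c)"
  unfolding polynomial_def by (intro exI[of _ "[:c:]"]) simp

lemma polynomial_id: "polynomial (\<lambda>n. n)"
  unfolding polynomial_def by (intro exI[of _ "[:0, 1:]"]) simp

lemma polynomial_add: "polynomial f \<Longrightarrow> polynomial g \<Longrightarrow> polynomial (\<lambda>n. f n + g n)"
  unfolding polynomial_def by (metis poly_add)

lemma polynomial_mult: "polynomial f \<Longrightarrow> polynomial g \<Longrightarrow> polynomial (\<lambda>n. f n * g n)"
  unfolding polynomial_def by (metis poly_mult)

lemma polynomial_power: "polynomial f \<Longrightarrow> polynomial (\<lambda>n. f n ^ k)"
  unfolding polynomial_def by (metis poly_power)

lemmas polynomial_intros = polynomial_add polynomial_mult polynomial_power polynomial_id polynomial_const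

section \<open>Forbidden induced subgraphs\<close>

lemma contains_induced_image:
  assumes g: "inj_on g (verts H)" "g ` verts H \<subseteq> verts G"
    and e: "\<And>u v. u \<in> verts H \<Longrightarrow> v \<in> verts H \<Longrightarrow> {g u, g v} \<in> edges G \<longleftrightarrow> {u, v} \<in> edges H"
  shows "contains_induced G H"
proof -
  let ?f = "inv_into (verts H) g"
  have "bij_betw ?f (g ` verts H) (verts H)" using g(1) by (simp add: bij_betw_inv_into inj_on_imp_bij_betw)
  moreover have "{u, v} \<in> edges (induced_subgraph G (g ` verts H)) \<longleftrightarrow> {?f u, ?f v} \<in> edges H"
    if "u \<in> g ` verts H" "v \<in> g ` verts H" for u v
    using that e g(1) by (auto simp: induced_subgraph_def)
  ultimately have "isomorphic (induced_subgraph G (g ` verts H)) H"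
    unfolding isomorphic_def by (intro exI[of _ ?f]) (auto simp: induced_subgraph_def)
  then show ?thesis unfolding contains_induced_def using g(2) by blast
qed

lemma edge_cycle_5: "i < 5 \<Longrightarrow> j < 5 \<Longrightarrow> {i, j} \<in> edges (cycle_graph 5) \<longleftrightarrow> j = Suc i mod 5 \<or> i = Suc j mod 5"
  unfolding cycle_graph_def by (auto simp: doubleton_eq_iff)

lemma edge_path_4: "i < 4 \<Longrightarrow> j < 4 \<Longrightarrow> {i, j} \<in> edges (path_graph 4) \<longleftrightarrow> j = Suc i \<or> i = Suc j"
  unfolding path_graph_def by (auto simp: doubleton_eq_iff)

lemma edge_disjoint_union:
  "{Inl i, Inl j} \<in> edges (disjoint_union G H) \<longleftrightarrow> {i, j} \<in> edges G"
  "{Inr i', Inr j'} \<in> edges (disjoint_union G H) \<longleftrightarrow> {i', j'} \<in> edges H"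
  "{Inl i, Inr j'} \<notin> edges (disjoint_union G H)"
  "{Inr j', Inl i} \<notin> edges (disjoint_union G H)"
proof -
  have img: "{Inl i, Inl j} = Inl ` {i, j}" "{Inr i', Inr j'} = Inr ` {i', j'}" by simp_all
  have neq: "Inl ` a \<noteq> Inr ` b" "Inr ` b \<noteq> Inl ` a" if "a \<noteq> {} \<or> b \<noteq> {}" for a :: "'a set" and b :: "'b set"
    using that by blast+
  have l: "Inl ` a \<in> (`) Inl ` E \<longleftrightarrow> a \<in> E" and r: "Inr ` b \<in> (`) Inr ` F \<longleftrightarrow> b \<in> F"
    for a :: "'a set" and b :: "'b set" and E F by (auto simp: inj_image_eq_iff)
  show "{Inl i, Inl j} \<in> edges (disjoint_union G H) \<longleftrightarrow> {i, j} \<in> edges G"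
    unfolding img disjoint_union_def snd_conv Un_iff l using neq(1)[of "{i, j}"] by blast
  show "{Inr i', Inr j'} \<in> edges (disjoint_union G H) \<longleftrightarrow> {i', j'} \<in> edges H"
    unfolding img disjoint_union_def snd_conv Un_iff r using neq(2)[of _ "{i', j'}"] by blast
  show "{Inl i, Inr j'} \<notin> edges (disjoint_union G H)" "{Inr j', Inl i} \<notin> edges (disjoint_union G H)"
    unfolding disjoint_union_def by auto
qed

lemma less_5: "i < 5 \<longleftrightarrow> i = 0 \<or> i = 1 \<or> i = 2 \<or> i = 3 \<or> i = (4::nat)"
  by auto

lemma less_4: "i < 4 \<longleftrightarrow> i = 0 \<or> i = 1 \<or> i = 2 \<or> i = (3::nat)"
  by auto

lemma simple_graph_fgraph: "simple_graph G \<Longrightarrow> fgraph (verts G) (\<lambda>u v. {u, v} \<in> edges G)"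
proof
  assume G: "simple_graph G"
  show "finite (verts G)" using G unfolding simple_graph_def by blast
  show "u \<in> verts G" if "{u, v} \<in> edges G" for u v using G that unfolding simple_graph_def by blast
  show "{v, u} \<in> edges G" if "{u, v} \<in> edges G" for u v using that by (simp add: insert_commute)
  show "{v, v} \<notin> edges G" for v using G unfolding simple_graph_def by force
qed

text \<open>The embedding is injective because distinct vertices of a 5-cycle have distinct
  neighbourhoods.\<close>

lemma contains_cycle_5:
  assumes G: "simple_graph G"
    and a: "{a, b} \<in> edges G" "{b, c} \<in> edges G" "{c, d} \<in> edges G" "{d, e} \<in> edges G" "{e, a} \<in> edges G"
    and n: "{a, c} \<notin> edges G" "{a, d} \<notin> edges G" "{b, d} \<notin> edges G" "{b, e} \<notin> edges G" "{c, e} \<notin> edges G"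
  shows "contains_induced G (cycle_graph 5)"
proof (rule contains_induced_image[of "(!) [a, b, c, d, e]"])
  interpret fgraph "verts G" "\<lambda>u v. {u, v} \<in> edges G" by (rule simple_graph_fgraph[OF G])
  have V: "verts (cycle_graph 5) = {..<5}" unfolding cycle_graph_def by simp
  have E: "{i, j} \<in> edges (cycle_graph 5) \<longleftrightarrow> {[a, b, c, d, e] ! i, [a, b, c, d, e] ! j} \<in> edges G" if "i < 5" "j < 5" for i j
    unfolding edge_cycle_5[OF that] using that a n adj_irrefl unfolding less_5 by (elim disjE) (simp_all add: insert_commute)
  show "inj_on ((!) [a, b, c, d, e]) (verts (cycle_graph 5))"
  proof (rule inj_onI)
    fix i j assume ij: "i \<in> verts (cycle_graph 5)" "j \<in> verts (cycle_graph 5)" and eq: "[a, b, c, d, e] ! i = [a, b, c, d, e] ! j"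
    then have l: "i < 5" "j < 5" unfolding V by simp_all
    have "{i, m} \<in> edges (cycle_graph 5) \<longleftrightarrow> {j, m} \<in> edges (cycle_graph 5)" if "m < 5" for m
      unfolding E[OF l(1) that] E[OF l(2) that] eq ..
    then have "m = Suc i mod 5 \<or> i = Suc m mod 5 \<longleftrightarrow> m = Suc j mod 5 \<or> j = Suc m mod 5" if "m < 5" for m
      using that edge_cycle_5 l by metis
    from this[of 0] this[of 1] this[of 2] this[of 3] this[of 4] show "i = j"
      using l unfolding less_5 by (elim disjE) simp_all
  qed
  show "(!) [a, b, c, d, e] ` verts (cycle_graph 5) \<subseteq> verts G"
    unfolding V using adj_V[OF a(1)] adj_V[OF a(2)] adj_V[OF a(3)] adj_V[OF a(4)] adj_V[OF a(5)] by (auto simp: less_5)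
  show "{[a, b, c, d, e] ! i, [a, b, c, d, e] ! j} \<in> edges G \<longleftrightarrow> {i, j} \<in> edges (cycle_graph 5)"
    if "i \<in> verts (cycle_graph 5)" "j \<in> verts (cycle_graph 5)" for i j
    using E that unfolding V by simp
qed

text \<open>Within one path injectivity follows from neighbourhoods, as for the cycle. Every vertex
  has a neighbour on its path, so a vertex common to both paths would give an edge between
  them.\<close>

lemma contains_two_paths_4:
  assumes G: "simple_graph G"
  defines "adj \<equiv> \<lambda>u v. {u, v} \<in> edges G"
  assumes P: "fgraph.P4 adj a b c d" "fgraph.P4 adj p q r s" and n: "fgraph.anticomplete adj {a, b, c, d} {p, q, r, s}"
  shows "contains_induced G (disjoint_union (path_graph 4) (path_graph 4))" (is "contains_induced G ?H")
proof -
  interpret fgraph "verts G" adj unfolding adj_def by (rule simple_graph_fgraph[OF G])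
  let ?f = "(!) [a, b, c, d]" and ?g = "(!) [p, q, r, s]"
  have V: "verts ?H = {..<4} <+> {..<4}" unfolding disjoint_union_def path_graph_def by simp
  have path: "{i, j} \<in> edges (path_graph 4) \<longleftrightarrow> adj ([a, b, c, d] ! i) ([a, b, c, d] ! j)"
    if "i < 4" "j < 4" "P4 a b c d" for i j a b c d
    unfolding edge_path_4[OF that(1,2)] using that unfolding P4_def less_4 by (elim disjE) (simp_all add: adj_comm adj_irrefl)
  have inj: "i = j" if "i < 4" "j < 4" "P4 a b c d" "[a, b, c, d] ! i = [a, b, c, d] ! j" for i j a b c d
  proof -
    have "{i, m} \<in> edges (path_graph 4) \<longleftrightarrow> {j, m} \<in> edges (path_graph 4)" if "m < 4" for m
      unfolding path[OF \<open>i < 4\<close> that \<open>P4 a b c d\<close>] path[OF \<open>j < 4\<close> that \<open>P4 a b c d\<close>] \<open>_ ! i = _\<close> ..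
    then have "m = Suc i \<or> i = Suc m \<longleftrightarrow> m = Suc j \<or> j = Suc m" if "m < 4" for m
      using that edge_path_4 \<open>i < 4\<close> \<open>j < 4\<close> by metis
    from this[of 0] this[of 1] this[of 2] this[of 3] show "i = j"
      using that(1,2) unfolding less_4 by (elim disjE) simp_all
  qed
  have cross: "\<not> adj (?f i) (?g j)" "\<not> adj (?g j) (?f i)" if "i < 4" "j < 4" for i j
    using n that adj_comm[of "?g j" "?f i"] unfolding anticomplete_def less_4 by auto
  have nbr: "\<exists>m<4. adj ([a, b, c, d] ! i) ([a, b, c, d] ! m)" if "i < 4" "P4 a b c d" for i a b c d
  proof -
    have "adj a b" "adj b a" "adj c b" "adj d c" using that(2) adj_sym unfolding P4_def by blast+
    moreover have "i = 0 \<or> i = 1 \<or> i = 2 \<or> i = 3" using that(1) less_4 by blast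
    ultimately have "\<exists>m\<in>{0, 1, 2}. adj ([a, b, c, d] ! i) ([a, b, c, d] ! m)" by (elim disjE) simp_all
    then obtain m where "m \<in> {0, 1, 2::nat}" "adj ([a, b, c, d] ! i) ([a, b, c, d] ! m)" by blast
    moreover from this(1) have "m < 4" by auto
    ultimately show ?thesis by blast
  qed
  have cross_neq: "?f i \<noteq> ?g j" if ij: "i < 4" "j < 4" for i j
  proof
    assume eq: "?f i = ?g j"
    obtain m where m: "m < 4" "adj (?f i) (?f m)" using nbr[OF ij(1) P(1)] by blast
    then show False using cross(2)[OF m(1) ij(2)] eq by simp
  qed
  have mem: "Inl i \<in> verts ?H \<longleftrightarrow> i < 4" "Inr i \<in> verts ?H \<longleftrightarrow> i < 4" for i
    unfolding V by auto
  show ?thesis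
  proof (rule contains_induced_image[of "case_sum ?f ?g"])
    show "inj_on (case_sum ?f ?g) (verts ?H)"
    proof (rule inj_onI)
      fix u v assume uv: "u \<in> verts ?H" "v \<in> verts ?H" and eq: "case_sum ?f ?g u = case_sum ?f ?g v"
      show "u = v"
      proof (cases u; cases v)
        fix i j assume h: "u = Inl i" "v = Inl j"
        then show ?thesis using inj[OF _ _ P(1), of i j] uv eq mem by simp
      next
        fix i j assume h: "u = Inr i" "v = Inr j"
        then show ?thesis using inj[OF _ _ P(2), of i j] uv eq mem by simp
      next
        fix i j assume h: "u = Inl i" "v = Inr j"
        then show ?thesis using cross_neq[of i j] uv eq mem by simp
      next
        fix i j assume h: "u = Inr i" "v = Inl j"
        then show ?thesis using cross_neq[of j i] uv eq mem by simp
      qed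
    qed
    show "case_sum ?f ?g ` verts ?H \<subseteq> verts G"
    proof -
      have "{a, b, c, d} \<subseteq> verts G" "{p, q, r, s} \<subseteq> verts G" using P adj_V adj_V2 unfolding P4_def by blast+
      then show ?thesis unfolding V by (auto simp: less_4)
    qed
    show "{case_sum ?f ?g u, case_sum ?f ?g v} \<in> edges G \<longleftrightarrow> {u, v} \<in> edges ?H" if "u \<in> verts ?H" "v \<in> verts ?H" for u v
    proof (cases u; cases v)
      fix i j assume h: "u = Inl i" "v = Inl j"
      then show ?thesis using path[OF _ _ P(1), of i j] that mem unfolding adj_def by (simp add: edge_disjoint_union)
    next
      fix i j assume h: "u = Inr i" "v = Inr j"
      then show ?thesis using path[OF _ _ P(2), of i j] that mem unfolding adj_def by (simp add: edge_disjoint_union)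
    next
      fix i j assume h: "u = Inl i" "v = Inr j"
      then show ?thesis using cross[of i j] that mem unfolding adj_def by (simp add: edge_disjoint_union)
    next
      fix i j assume h: "u = Inr i" "v = Inl j"
      then show ?thesis using cross[of j i] that mem unfolding adj_def by (simp add: edge_disjoint_union)
    qed
  qed
qed

lemma three_colorableI:
  fixes h :: "'a \<Rightarrow> col"
  assumes h: "\<And>u v. {u, v} \<in> edges G \<Longrightarrow> h u \<noteq> h v"
  shows "three_colorable G"
proof -
  define num :: "col \<Rightarrow> nat" where "num = case_col 1 2 3"
  have num: "num c \<in> {1, 2, 3}" "num c = num d \<longleftrightarrow> c = d" for c d unfolding num_def by (cases c; cases d; simp)+
  have "proper_coloring G {1, 2, 3} (num \<circ> h)" unfolding proper_coloring_def using h num by auto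
  then show ?thesis unfolding three_colorable_def by blast
qed

lemma consistency_correct:
  assumes G: "simple_graph G" "\<not> contains_induced G (disjoint_union (path_graph 4) (path_graph 4))"
      "\<not> contains_induced G (cycle_graph 5)"
    and vs: "distinct vs" "set vs = verts G" and k: "k \<ge> 200000"
    and D: "\<forall>x < (3 * length vs) ^ k. x \<notin> D \<longrightarrow> \<not> bad (\<lambda>i j. {vs ! i, vs ! j} \<in> edges G) (length vs) k D x"
    and x: "x < (3 * length vs) ^ k" "x \<notin> D"
  shows "three_colorable G"
proof -
  let ?adj = "\<lambda>u v. {u, v} \<in> edges G"
  interpret fgraph "verts G" ?adj by (rule simple_graph_fgraph[OF G(1)])
  have "strategy (set vs) ?adj k (assignments vs k D)"
    by (rule strategy_assignments[OF vs(1) _ _ _ x]) (use k D adj_sym in auto)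
  then interpret strat "verts G" ?adj k "assignments vs k D"
  proof (unfold_locales, goal_cases)
    case 1
    then show ?case using vs(2) by simp
  next
    case (2 a b c d e)
    then show ?case using contains_cycle_5[OF G(1)] G(3) by blast
  next
    case (3 a b c d p q r s)
    then show ?case using contains_two_paths_4[OF G(1)] G(2) by blast
  qed
  show ?thesis using colourable[OF k] three_colorableI by blast
qed

lemma consistency_complete:
  assumes G: "simple_graph G" "three_colorable G" and vs: "distinct vs" "set vs = verts G"
  obtains h :: "nat \<Rightarrow> nat" where "\<And>v. v < length vs \<Longrightarrow> h v < 3"
    "\<And>v w. v < length vs \<Longrightarrow> w < length vs \<Longrightarrow> {vs ! v, vs ! w} \<in> edges G \<Longrightarrow> h v \<noteq> h w"
proof -
  obtain c where c: "c \<in> verts G \<rightarrow> {1, 2, 3 :: nat}" "\<And>u v. {u, v} \<in> edges G \<Longrightarrow> c u \<noteq> c v"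
    using G(2) unfolding three_colorable_def proper_coloring_def by blast
  have r: "c (vs ! v) \<in> {1, 2, 3}" if "v < length vs" for v
    using c(1) nth_mem[OF that] vs(2) by blast
  show thesis
  \<comment> \<open>The colours 1, 2, 3 of the problem become the residues 0, 1, 2 of the
    table.\<close>
  proof (rule that[of "\<lambda>v. c (vs ! v) - 1"])
    show "c (vs ! v) - 1 < 3" if "v < length vs" for v using r[OF that] by auto
    show "c (vs ! v) - 1 \<noteq> c (vs ! w) - 1" if "v < length vs" "w < length vs" "{vs ! v, vs ! w} \<in> edges G" for v w
      using r[OF that(1)] r[OF that(2)] c(2)[OF that(3)] by auto
  qed
qed

theorem theorem1p1:
  "poly_time_solvable_on
     {G. simple_graph G \<and>
         \<not> contains_induced G (disjoint_union (path_graph 4) (path_graph 4)) \<and>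
         \<not> contains_induced G (cycle_graph 5)}
     three_colorable"
proof -
  \<comment> \<open>Any fixed \<open>k\<close> above the bound will do; it stays symbolic in the
    polynomial below.\<close>
  obtain k :: nat where k: "k \<ge> 200000" by blast
  define T where "T n N = 10 * n + k * (10 * N + 30) + (N + 1) * (N * (examine_time k n N + 8) + 20) + 60" for n N
  have "polynomial (\<lambda>n. T n ((3 * n) ^ k))"
    unfolding T_def examine_time_def index_time_def by (intro polynomial_intros)
  then obtain p :: "nat poly" where p: "\<And>n. T n ((3 * n) ^ k) = poly p n" unfolding polynomial_def by blast
  have "\<exists>t s. exec (consistency k) (input_state G vs) t s \<and> t \<le> poly p (card (verts G)) \<and>
      fst s 0 = (if three_colorable G then 1 else 0)"
    if G: "simple_graph G" "\<not> contains_induced G (disjoint_union (path_graph 4) (path_graph 4))"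
      "\<not> contains_induced G (cycle_graph 5)" and vs: "distinct vs" "set vs = verts G" for G :: "nat graph" and vs
  proof -
    define n where "n = length vs"
    let ?A = "\<lambda>i j. {vs ! i, vs ! j} \<in> edges G"
    let ?N = "(3 * n) ^ k"
    \<comment> \<open>Soundness of discarding: no tuple that agrees with a proper colouring is lost.
      All colourings are quantified over, so that the invariant makes sense before one is known to
      exist.\<close>
    define P where "P D \<longleftrightarrow> (\<forall>h. (\<forall>v<n. h v < 3) \<and> (\<forall>v<n. \<forall>w<n. ?A v w \<longrightarrow> h v \<noteq> h w) \<longrightarrow> D \<inter> compatible n k h = {})" for D
    have step: "P (insert x D)" if "P D" "bad ?A n k D x" for D x
      unfolding P_def
    proof (intro allI impI)
      fix h :: "nat \<Rightarrow> nat" assume h: "(\<forall>v<n. h v < 3) \<and> (\<forall>v<n. \<forall>w<n. ?A v w \<longrightarrow> h v \<noteq> h w)"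
      then have d: "D \<inter> compatible n k h = {}" using that(1) unfolding P_def by blast
      have "x \<notin> compatible n k h" using compatible_not_bad[of n h ?A x k D] h d that(2) by blast
      then show "insert x D \<inter> compatible n k h = {}" using d by blast
    qed
    have s: "fst (input_state G vs) 0 = n" "snd (input_state G vs) = table ?A n {}"
      unfolding input_state_def n_def Let_def by (auto simp: table_def fun_eq_iff)
    have P0: "P {}" unfolding P_def by simp
    have "halts (consistency k) (input_state G vs) (T n ?N)
      (\<lambda>t. \<exists>D. P D \<and> D \<subseteq> {..<?N} \<and> (\<forall>x<?N. x \<notin> D \<longrightarrow> \<not> bad ?A n k D x) \<and> fst t 0 = of_bool (\<exists>x<?N. x \<notin> D) + (1 - n))"
      unfolding T_def by (rule halts_consistency[where P = P]) (use s P0 step in simp_all)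
    then obtain t u D where e: "exec (consistency k) (input_state G vs) t u" "t \<le> T n ?N" and
      D: "P D" "\<And>x. x < ?N \<Longrightarrow> x \<notin> D \<Longrightarrow> \<not> bad ?A n k D x" and u: "fst u 0 = of_bool (\<exists>x<?N. x \<notin> D) + (1 - n)"
      unfolding halts_def by blast
    have "card (verts G) = n" using distinct_card[OF vs(1)] vs(2) unfolding n_def by simp
    then have "t \<le> poly p (card (verts G))" using e(2) p by simp
    moreover have "fst u 0 = (if three_colorable G then 1 else 0)"
    proof (cases "n = 0")
      case True
      then have "verts G = {}" using vs(2) unfolding n_def by simp
      then have "{u, v} \<notin> edges G" for u v using G(1) unfolding simple_graph_def by blast
      then have "three_colorable G" using three_colorableI[of G "\<lambda>_. Red"] by blast
      moreover have "?N = 0" using True k by (simp add: power_0_left)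
      ultimately show ?thesis using u True by (simp add: power_0_left)
    next
      case False
      have "three_colorable G \<longleftrightarrow> (\<exists>x<?N. x \<notin> D)"
      proof
        assume "three_colorable G"
        then obtain h :: "nat \<Rightarrow> nat" where h: "\<And>v. v < n \<Longrightarrow> h v < 3" "\<And>v w. v < n \<Longrightarrow> w < n \<Longrightarrow> ?A v w \<Longrightarrow> h v \<noteq> h w"
          using consistency_complete[OF G(1) _ vs] unfolding n_def by blast
        then have "D \<inter> compatible n k h = {}" using D(1) unfolding P_def by blast
        moreover obtain x where "x \<in> compatible n k h" using compatible_nonempty[of n h k] h(1) False by blast
        ultimately show "\<exists>x<?N. x \<notin> D" unfolding compatible_def by blast
      next
        assume "\<exists>x<?N. x \<notin> D"
        then obtain x where x: "x < ?N" "x \<notin> D" by blast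
        show "three_colorable G"
          by (rule consistency_correct[OF G vs k _ x[unfolded n_def]]) (use D(2) in \<open>simp add: n_def\<close>)
      qed
      then show ?thesis using u False by simp
    qed
    ultimately show ?thesis using e(1) by blast
  qed
  then show ?thesis unfolding poly_time_solvable_on_def by (intro exI[of _ "consistency k"] exI[of _ p]) simp
qed

end
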